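(* Let $h\in\Sigma[1]$ and suppose that $F_t(z)=h^{-1}(h(z)+t)$ can be extended for some $z\in\Delta$ to the whole real axis with $$\lim_{t\to-\infty}F_t(z)=1;$$ in other words, there is a nonempty backward flow invariant domain $\Omega$ of $p$-type for $\{F_t\}_{t\ge0}$. Suppose further that $\partial\Omega$ has a Dini-smooth corner of opening $\pi\gamma$ at the point $z=1$. The following assertions hold: (i) $h\in\Sigma_A^\alpha[1]$ with $\alpha=\dfrac1\gamma$, and $\mu:=\angle\lim_{z\to1}(1-z)^{1+\alpha}h'(z)\ne0,\infty$; (ii) $\frac12\le\gamma\le1$, hence the angle of the opening cannot be less than $\dfrac{\pi}{2}$, and $|\arg\mu|\le\dfrac{\pi(2\gamma-1)}{2\gamma}$; (iii) the angular limit of the inverse Visser-Ostrovskii quotient $$\angle\lim_{z\to1}\frac{h(z)}{(1-z)h'(z)}$$ exists and equals $\gamma$.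
   Context: $\Delta$ is the open unit disk in $\mathbb{C}$; $\angle\lim_{z\to1}$ is the angular (nontangential) limit; powers of $1-z$ and $\arg$ are principal values. $\Sigma[1]$ is the class of univalent holomorphic functions $h:\Delta\to\mathbb{C}$ such that $h(0)=0$, $h(z)+t\in h(\Delta)$ for all $z\in\Delta$, $t\ge0$, and $\lim_{t\to\infty}h^{-1}(h(z)+t)=1$ for all $z\in\Delta$. For $\alpha\ge0$, $\Sigma_A^\alpha[1]$ is the class of those $h\in\Sigma[1]$ for which $\angle\lim_{z\to1}(1-z)^{1+\alpha}h'(z)$ exists, is finite and is different from zero. For $h\in\Sigma[1]$ the maps $F_t(z)=h^{-1}(h(z)+t)$, $t\ge0$, form a one-parameter continuous semigroup $S$ of holomorphic self-mappings of $\Delta$. That $F_t(z)$ extends to the whole real axis means $h(z)+t\in h(\Delta)$ for all $t\in\mathbb{R}$. A nonempty simply connected domain $\Omega\subset\Delta$ is a backward flow invariant domain for $S$ if $S$ extends to a group on $\Omega$ (each $F_t|_\Omega$ is an automorphism of $\Omega$). If $\varphi:\Delta\to\Omega$ is a Riemann map, then $G_t=\varphi^{-1}\circ F_t\circ\varphi$, $t\in\mathbb{R}$, is a group of automorphisms of $\Delta$; $\Omega$ is of $p$-type if this group is parabolic. In this case $\varphi$ may be normalized so that the common boundary fixed point of the $G_t$ is $1$, and then $\varphi$ has angular limit $\varphi(1)=1$; the corner of $\partial\Omega$ at $1$ is understood at this boundary point $\varphi(1)$. $\partial\Omega$ has a Dini-smooth corner of opening $\pi\gamma$ ($0<\gamma\le2$)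 at $\varphi(1)=1$ if there are closed arcs $A^\pm\subset\partial\Delta$ ending at $1$ and lying on opposite sides of $1$ that are mapped by (the extension of) $\varphi$ onto Dini-smooth Jordan arcs $C^\pm$ forming the angle $\pi\gamma$ at the point $1$. A Jordan arc is Dini-smooth if it has a parametrization $w(\tau)$ with $w'(\tau)\ne0$ continuous whose modulus of continuity $\omega$ satisfies $\int_0^{\delta}\omega(s)s^{-1}\,ds<\infty$ for some $\delta>0$. *)

theory Defs
  imports "HOL-Complex_Analysis.Complex_Analysis"
begin

abbreviation unit_disk :: "complex set" where
  "unit_disk \<equiv> ball 0 1"

(* Angular limit at the boundary point 1: the limit inside every Stolz region. *)
definition has_angular_limit :: "(complex \<Rightarrow> complex) \<Rightarrow> complex \<Rightarrow> bool" where
  "has_angular_limit f l \<longleftrightarrow>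
     (\<forall>M::real. (f \<longlongrightarrow> l) (at 1 within {z \<in> unit_disk. cmod (1 - z) \<le> M * (1 - cmod z)}))"

(* flow h t z is only meaningful if h z + t lies in h ` unit_disk.  For h in Sigma1 this holds
   for every t \<ge> 0; for t < 0 it is required explicitly wherever the flow is used. *)
definition flow :: "(complex \<Rightarrow> complex) \<Rightarrow> real \<Rightarrow> complex \<Rightarrow> complex" where
  "flow h t z = inv_into unit_disk h (h z + of_real t)"

definition extends_to_line :: "(complex \<Rightarrow> complex) \<Rightarrow> complex \<Rightarrow> bool" where
  "extends_to_line h z \<longleftrightarrow> (\<forall>t::real. h z + of_real t \<in> h ` unit_disk)"

definition Sigma1 :: "(complex \<Rightarrow> complex) set" where
  "Sigma1 = {h. h holomorphic_on unit_disk \<and> inj_on h unit_disk \<and> h 0 = 0 \<and>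
       (\<forall>z\<in>unit_disk. \<forall>t\<ge>0. h z + of_real t \<in> h ` unit_disk) \<and>
       (\<forall>z\<in>unit_disk. ((\<lambda>t. flow h t z) \<longlongrightarrow> 1) at_top)}"

definition Sigma1_A :: "real \<Rightarrow> (complex \<Rightarrow> complex) set" where
  "Sigma1_A \<alpha> = {h \<in> Sigma1. 0 \<le> \<alpha> \<and>
       (\<exists>\<mu>. \<mu> \<noteq> 0 \<and>
          has_angular_limit (\<lambda>z. (1 - z) powr (of_real (1 + \<alpha>)) * deriv h z) \<mu>)}"

definition automorphism_of :: "complex set \<Rightarrow> (complex \<Rightarrow> complex) \<Rightarrow> bool" where
  "automorphism_of U f \<longleftrightarrow> f holomorphic_on U \<and> bij_betw f U U"

definition backward_flow_invariant :: "(complex \<Rightarrow> complex) \<Rightarrow> complex set \<Rightarrow> bool" where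
  "backward_flow_invariant h \<Omega> \<longleftrightarrow>
     \<Omega> \<noteq> {} \<and> open \<Omega> \<and> connected \<Omega> \<and> simply_connected \<Omega> \<and> \<Omega> \<subseteq> unit_disk \<and>
     (\<forall>z\<in>\<Omega>. extends_to_line h z) \<and> (\<forall>t. automorphism_of \<Omega> (flow h t))"

definition riemann_map :: "(complex \<Rightarrow> complex) \<Rightarrow> complex set \<Rightarrow> bool" where
  "riemann_map \<phi> \<Omega> \<longleftrightarrow> \<phi> holomorphic_on unit_disk \<and> bij_betw \<phi> unit_disk \<Omega>"

definition conj_flow ::
    "(complex \<Rightarrow> complex) \<Rightarrow> (complex \<Rightarrow> complex) \<Rightarrow> real \<Rightarrow> complex \<Rightarrow> complex" where
  "conj_flow h \<phi> t z = inv_into unit_disk \<phi> (flow h t (\<phi> z))"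

(* A disk automorphism is parabolic if its continuous extension to the closed disk has exactly
   one fixed point and this point lies on the unit circle.  The identity is excluded. *)
definition parabolic_automorphism :: "(complex \<Rightarrow> complex) \<Rightarrow> complex \<Rightarrow> bool" where
  "parabolic_automorphism f \<tau> \<longleftrightarrow>
     automorphism_of unit_disk f \<and> cmod \<tau> = 1 \<and>
     (\<exists>g. continuous_on (cball 0 1) g \<and> (\<forall>z\<in>unit_disk. g z = f z) \<and>
          {z \<in> cball 0 1. g z = z} = {\<tau>})"

definition parabolic_group :: "(real \<Rightarrow> complex \<Rightarrow> complex) \<Rightarrow> complex \<Rightarrow> bool" where
  "parabolic_group G \<tau> \<longleftrightarrow> (\<forall>t. t \<noteq> 0 \<longrightarrow> parabolic_automorphism (G t) \<tau>)"

definition p_type :: "(complex \<Rightarrow> complex) \<Rightarrow> complex set \<Rightarrow> bool" where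
  "p_type h \<Omega> \<longleftrightarrow> backward_flow_invariant h \<Omega> \<and>
     (\<exists>\<phi> \<tau>. riemann_map \<phi> \<Omega> \<and> parabolic_group (conj_flow h \<phi>) \<tau>)"

definition modulus_of_continuity :: "(real \<Rightarrow> complex) \<Rightarrow> real \<Rightarrow> real" where
  "modulus_of_continuity f s =
     Sup {cmod (f x - f y) | x y. x \<in> {0..1} \<and> y \<in> {0..1} \<and> \<bar>x - y\<bar> \<le> s}"

definition dini_smooth_arc :: "(real \<Rightarrow> complex) \<Rightarrow> bool" where
  "dini_smooth_arc c \<longleftrightarrow> arc c \<and>
     (\<exists>c'. (\<forall>t\<in>{0..1}. (c has_vector_derivative c' t) (at t within {0..1}) \<and> c' t \<noteq> 0) \<and>
           continuous_on {0..1} c' \<and>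
           (\<exists>\<delta>>0. set_integrable lborel {0<..\<delta>} (\<lambda>s. modulus_of_continuity c' s / s)))"

(* The boundary of \<phi> ` unit_disk has a Dini-smooth corner of opening pi * \<gamma> at the boundary
   point p corresponding to 1 under \<phi>.  Here \<psi> is the extension of \<phi> to the two circular
   arcs adjacent to 1, and Im L is a continuous branch of arg (\<psi> - p).  Measuring the angle with
   a branch that is continuous on the disk gives the interior angle as a real number; the tangent
   directions alone determine it only modulo 2 * pi and would not tell an inward cusp (opening
   2 * pi) from an outward one (opening 0). *)
definition dini_smooth_corner :: "(complex \<Rightarrow> complex) \<Rightarrow> complex \<Rightarrow> real \<Rightarrow> bool" where
  "dini_smooth_corner \<phi> p \<gamma> \<longleftrightarrow> 0 < \<gamma> \<and> \<gamma> \<le> 2 \<and>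
     (\<exists>a b A\<^sub>p A\<^sub>m \<psi> c\<^sub>p c\<^sub>m L \<beta>.
        0 < a \<and> a < pi \<and> A\<^sub>p = cis ` {0..a} \<and>
        0 < b \<and> b < pi \<and> A\<^sub>m = cis ` {-b..0} \<and>
        continuous_on (unit_disk \<union> A\<^sub>p \<union> A\<^sub>m) \<psi> \<and> (\<forall>z\<in>unit_disk. \<psi> z = \<phi> z) \<and> \<psi> 1 = p \<and>
        dini_smooth_arc c\<^sub>p \<and> pathstart c\<^sub>p = p \<and> \<psi> ` A\<^sub>p = path_image c\<^sub>p \<and>
        dini_smooth_arc c\<^sub>m \<and> pathstart c\<^sub>m = p \<and> \<psi> ` A\<^sub>m = path_image c\<^sub>m \<and>
        continuous_on ((unit_disk \<union> A\<^sub>p \<union> A\<^sub>m) - {1}) L \<and>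
        (\<forall>z \<in> (unit_disk \<union> A\<^sub>p \<union> A\<^sub>m) - {1}. exp (L z) = \<psi> z - p) \<and>
        ((\<lambda>t. Im (L (cis t))) \<longlongrightarrow> \<beta>) (at_right 0) \<and>
        ((\<lambda>t. Im (L (cis t))) \<longlongrightarrow> \<beta> + pi * \<gamma>) (at_left 0))"

end

theory Submission
  imports Defs
begin

text \<open>
  The Berkson--Porta inequality \<open>Re ((1 - z)\<^sup>2 h' z) \<ge> 0\<close> follows from Wolff's lemma for the
  semigroup.  The parabolic group consists of translations in the coordinate \<open>1 / (1 - z)\<close>, whence
  \<open>(h \<circ> \<phi>)' = c / (1 - z)\<^sup>2\<close>.  It remains to understand \<open>\<phi>\<close> on a radius.  In the half-plane
  coordinate \<open>w\<close> put \<open>f w = 1 - \<phi>\<close> and \<open>\<Phi> w = Ln (f w) - \<gamma> Ln w - \<i> \<kappa>\<close>.  On the two boundary arcs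
  \<open>\<bar>Im \<Phi>\<bar>\<close> is at most the Dini modulus at \<open>\<bar>f w\<bar>\<close>; a harmonic majorant composed with \<open>f\<close> carries this
  bound into the half-plane, and summing the resulting oscillation bounds over dyadic scales shows
  that \<open>\<Phi>\<close> has a finite radial limit.

  Hence \<open>Ln ((1 - z)\<^sup>2 h' z) + (\<alpha> - 1) Ln (1 - z)\<close>, whose imaginary part is bounded, converges along
  the \<open>\<phi>\<close>-image of the radius, and by Lindeloef's theorem it converges in every sector at 1.
  Comparing arguments on the extreme rays bounds \<open>\<alpha>\<close> and \<open>Arg \<mu>\<close>, and integrating along rays gives
  the Visser--Ostrovskii quotient.
\<close>

subsection \<open>Wolff's lemma and the Berkson--Porta inequality\<close>

text \<open>The exponent is forced by scaling. If \<open>f w\<close> is of size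
  \<open>w powr \<gamma>\<close>, then \<open>(1 - z)\<^sup>2 * deriv h z\<close> at z = 1 - f x is
  of size \<open>x powr (\<gamma> - 1)\<close>, that is, \<open>1 - z\<close> to the power 1 - 1 /
  \<gamma>; the factor \<open>(1 - z) powr (\<alpha> - 1)\<close> with \<alpha> = 1 / \<gamma>
  compensates exactly this. The obstacle is that Dini smoothness concerns some parametrization of
  the boundary arcs, whereas nothing is known about the speed of the boundary values of \<phi>.
  Hence boundary estimates are phrased through the distance \<open>cmod (f w)\<close> to the corner.
  Dyadic summation then needs geometric decay of that distance, and this is bootstrapped:
  \<open>f\<close> tending to 0 makes the oscillation of \<Phi> small, smallness gives the decay,
  and decay with the Dini condition makes the oscillations summable. Only one curve is controlled in
  this way. It approaches 1 along the bisector of the corner. As 1 - \<phi> has positive real part,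
  its arguments stay in [-pi/2, pi/2]; this yields \<gamma> \<le> 1 and makes the bisector
  nontangential, as Lindeloef's theorem requires.\<close>

lemma one_minus_cnj_mult_nonzero:
  fixes a b :: complex
  assumes "cmod a < 1" "cmod b \<le> 1"
  shows "1 - cnj a * b \<noteq> 0"
proof
  assume "1 - cnj a * b = 0"
  then have "cmod (cnj a * b) = 1" by simp
  moreover have "cmod (cnj a * b) \<le> cmod a * 1"
    unfolding norm_mult complex_mod_cnj using assms by (intro mult_left_mono) auto
  ultimately show False using assms by simp
qed

lemma one_minus_Moebius_norm:
  assumes "cmod b < 1" "cmod a < 1"
  shows "1 - (cmod (Moebius_function 0 b a))\<^sup>2
       = (1 - (cmod b)\<^sup>2) * (1 - (cmod a)\<^sup>2) / (cmod (1 - cnj b * a))\<^sup>2"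
proof -
  have nz: "1 - cnj b * a \<noteq> 0" using one_minus_cnj_mult_nonzero[of b a] assms by simp
  have "(cmod (1 - cnj b * a))\<^sup>2 - (cmod (a - b))\<^sup>2 = (1 - (cmod b)\<^sup>2) * (1 - (cmod a)\<^sup>2)"
    unfolding cmod_power2 by (simp add: power2_eq_square algebra_simps)
  then show ?thesis using nz
    by (simp add: Moebius_function_simple norm_divide power_divide field_simps)
qed

text \<open>The Schwarz lemma for \<open>F\<close> conjugated by the disk automorphisms that move
  \<open>b\<close> and \<open>F b\<close> to 0. The product form keeps
  \<open>1 - (cmod b)\<^sup>2\<close> and \<open>1 - (cmod (F b))\<^sup>2\<close> as separate
  factors, so that they can be compared and cancelled while \<open>b\<close> tends to the
  circle.\<close>

lemma Schwarz_Pick: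
  assumes hol: "F holomorphic_on ball 0 1" and im: "F ` ball 0 1 \<subseteq> ball 0 1"
    and a: "cmod a < 1" and b: "cmod b < 1"
  shows "(1 - (cmod a)\<^sup>2) * (1 - (cmod b)\<^sup>2) / (cmod (1 - cnj b * a))\<^sup>2
       \<le> (1 - (cmod (F a))\<^sup>2) * (1 - (cmod (F b))\<^sup>2) / (cmod (1 - cnj (F b) * F a))\<^sup>2"
proof -
  have Fb: "cmod (F b) < 1" and Fa: "cmod (F a) < 1" using im a b by (auto simp: image_subset_iff)
  define T where "T = (\<lambda>u. Moebius_function 0 (F b) (F (Moebius_function 0 (-b) u)))"
  define u where "u = Moebius_function 0 b a"
  have u1: "cmod u < 1" unfolding u_def by (rule Moebius_function_norm_lt_1[OF b a])
  have Mim: "Moebius_function 0 (-b) ` ball 0 1 \<subseteq> ball 0 1"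
    using Moebius_function_norm_lt_1[of "-b"] b by auto
  have "Moebius_function 0 (F b) \<circ> (F \<circ> Moebius_function 0 (-b)) holomorphic_on ball 0 1"
    by (intro holomorphic_on_compose_gen[where t="ball 0 1"] hol Moebius_function_holomorphic)
       (use b Fb Mim im in auto)
  then have "T holomorphic_on ball 0 1" by (simp add: T_def o_def)
  moreover have "T 0 = 0"
    by (simp add: T_def Moebius_function_of_zero Moebius_function_eq_zero)
  moreover have "cmod (T z) < 1" if "cmod z < 1" for z
    unfolding T_def
    using im Moebius_function_norm_lt_1[of "-b" z 0] that b Fb
    by (intro Moebius_function_norm_lt_1) (auto simp: image_subset_iff)
  ultimately have "cmod (T u) \<le> cmod u" using Schwarz_Lemma(1) u1 by blast
  moreover have "T u = Moebius_function 0 (F b) (F a)"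
    using Moebius_function_compose[of "-b" b a] a b by (simp add: T_def u_def)
  ultimately have "(cmod (Moebius_function 0 (F b) (F a)))\<^sup>2 \<le> (cmod (Moebius_function 0 b a))\<^sup>2"
    by (simp add: u_def)
  then show ?thesis
    using one_minus_Moebius_norm[OF b a] one_minus_Moebius_norm[OF Fb Fa]
    by (simp only: mult.commute)
qed

text \<open>Otherwise the sequence decreases from some N on, and its limit is at most
  \<open>a N\<close>, which lies below \<open>L\<close>.\<close>

lemma frequently_increasing_if_tendsto_sup:
  fixes a :: "nat \<Rightarrow> real"
  assumes lim: "a \<longlonglongrightarrow> L" and lt: "\<And>n. a n < L"
  shows "\<exists>\<^sub>F n in sequentially. a n \<le> a (Suc n)"
proof (rule ccontr)
  assume "\<not> ?thesis"
  then obtain N where N: "\<And>n. n \<ge> N \<Longrightarrow> a (Suc n) < a n"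
    unfolding frequently_def eventually_sequentially not_le not_not by blast
  have le: "a n \<le> a N" if "n \<ge> N" for n
    using that
  proof (induction n rule: dec_induct)
    case (step n)
    then show ?case using N[of n] by simp
  qed simp
  have "L \<le> a N"
    by (rule LIMSEQ_le_const2[OF lim]) (intro exI[of _ N] allI impI le)
  with lt[of N] show False by simp
qed

text \<open>Orbits come back closer to the circle infinitely often; at such times the
  Schwarz--Pick inequality between \<^term>\<open>z\<close> and the orbit loses the factors belonging
  to the orbit, and passing to the limit leaves the Julia inequality at 1.\<close>
lemma Wolff_horodisk:
  assumes hol: "F holomorphic_on ball 0 1" and im: "F ` ball 0 1 \<subseteq> ball 0 1"
    and orb: "\<And>n. cmod (x n) < 1" "\<And>n. x (Suc n) = F (x n)" and lim: "x \<longlonglongrightarrow> 1"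
    and z: "cmod z < 1"
  shows "Re ((1 + z) / (1 - z)) \<le> Re ((1 + F z) / (1 - F z))"
proof -
  have Fz: "cmod (F z) < 1" using im z by (auto simp: image_subset_iff)
  note orb1 = orb(1)
  have n1: "(\<lambda>n. cmod (x n)) \<longlonglongrightarrow> 1" using tendsto_norm[OF lim] by simp
  have fr: "\<exists>\<^sub>F n in sequentially. cmod (x n) \<le> cmod (x (Suc n))"
    by (rule frequently_increasing_if_tendsto_sup[OF n1 orb1])
  have lim': "(\<lambda>n. x (Suc n)) \<longlonglongrightarrow> 1" by (rule LIMSEQ_Suc[OF lim])
  have nz: "1 - z \<noteq> 0" "1 - F z \<noteq> 0" using z Fz by auto
  have L1: "(\<lambda>n. (1 - (cmod z)\<^sup>2) / (cmod (1 - cnj (x n) * z))\<^sup>2)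
      \<longlonglongrightarrow> (1 - (cmod z)\<^sup>2) / (cmod (1 - cnj 1 * z))\<^sup>2"
    by (intro tendsto_intros lim) (use nz in auto)
  have L2: "(\<lambda>n. (1 - (cmod (F z))\<^sup>2) / (cmod (1 - cnj (x (Suc n)) * F z))\<^sup>2)
      \<longlonglongrightarrow> (1 - (cmod (F z))\<^sup>2) / (cmod (1 - cnj 1 * F z))\<^sup>2"
    by (intro tendsto_intros lim') (use nz in auto)
  have step: "(1 - (cmod z)\<^sup>2) / (cmod (1 - cnj (x n) * z))\<^sup>2
      \<le> (1 - (cmod (F z))\<^sup>2) / (cmod (1 - cnj (x (Suc n)) * F z))\<^sup>2"
    if "cmod (x n) \<le> cmod (x (Suc n))" for n
  proof -
    define p where "p = 1 - (cmod (x n))\<^sup>2"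
    define q where "q = 1 - (cmod (x (Suc n)))\<^sup>2"
    have pos: "0 < p" "0 < q" unfolding p_def q_def using orb(1)[of n] orb(1)[of "Suc n"]
      by (simp_all only: abs_square_less_1 abs_norm_cancel diff_gt_0_iff_gt)
    have qp: "q \<le> p" unfolding p_def q_def using that by (simp add: power_mono)
    have Fpos: "0 \<le> 1 - (cmod (F z))\<^sup>2" using Fz by (simp add: abs_square_le_1)
    have "(1 - (cmod z)\<^sup>2) * p / (cmod (1 - cnj (x n) * z))\<^sup>2
       \<le> (1 - (cmod (F z))\<^sup>2) * q / (cmod (1 - cnj (x (Suc n)) * F z))\<^sup>2"
      using Schwarz_Pick[OF hol im z orb(1)[of n]] by (simp add: p_def q_def orb(2))
    also have "\<dots> \<le> (1 - (cmod (F z))\<^sup>2) * p / (cmod (1 - cnj (x (Suc n)) * F z))\<^sup>2"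
      by (intro divide_right_mono mult_left_mono qp Fpos) auto
    finally have "(1 - (cmod z)\<^sup>2) / (cmod (1 - cnj (x n) * z))\<^sup>2 * p
       \<le> (1 - (cmod (F z))\<^sup>2) / (cmod (1 - cnj (x (Suc n)) * F z))\<^sup>2 * p"
      by (simp only: times_divide_eq_left)
    then show ?thesis using pos(1) by (simp only: mult_le_cancel_right_pos)
  qed
  have "(1 - (cmod z)\<^sup>2) / (cmod (1 - z))\<^sup>2 \<le> (1 - (cmod (F z))\<^sup>2) / (cmod (1 - F z))\<^sup>2"
  proof (rule ccontr)
    assume "\<not> ?thesis"
    then have "(1 - (cmod (F z))\<^sup>2) / (cmod (1 - cnj 1 * F z))\<^sup>2 < (1 - (cmod z)\<^sup>2) / (cmod (1 - cnj 1 * z))\<^sup>2"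
      by simp
    from order_tendstoD(2)[OF tendsto_diff[OF L2 L1], of 0] this
    have "\<forall>\<^sub>F n in sequentially. (1 - (cmod (F z))\<^sup>2) / (cmod (1 - cnj (x (Suc n)) * F z))\<^sup>2
       - (1 - (cmod z)\<^sup>2) / (cmod (1 - cnj (x n) * z))\<^sup>2 < 0" by simp
    then have "\<forall>\<^sub>F n in sequentially. \<not> cmod (x n) \<le> cmod (x (Suc n))"
      by (rule eventually_mono) (use step in force)
    with fr show False by (simp add: frequently_def)
  qed
  moreover have "Re ((1 + w) / (1 - w)) = (1 - (cmod w)\<^sup>2) / (cmod (1 - w))\<^sup>2" for w
    unfolding Re_divide cmod_power2 by (simp add: power2_eq_square algebra_simps)
  ultimately show ?thesis by simp
qed

text \<open>The inverse of \<open>k\<close> turns translation into a motion whose velocity at time 0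
  is read off from the inverse function. It is applied both to \<open>h\<close> and to
  \<open>h \<circ> \<phi>\<close>.\<close>

lemma inv_into_translation_derivative:
  assumes hol: "k holomorphic_on U" and op: "open U" and inj: "inj_on k U" and z: "z \<in> U"
  shows "((\<lambda>t. inv_into U k (k z + of_real t)) has_vector_derivative 1 / deriv k z) (at 0)"
    and "deriv k z \<noteq> 0"
proof -
  obtain g where g: "g holomorphic_on (k ` U)" "\<And>z. z \<in> U \<Longrightarrow> deriv k z * deriv g (k z) = 1"
    "\<And>z. z \<in> U \<Longrightarrow> g (k z) = z"
    using holomorphic_has_inverse[OF hol op inj] by blast
  show nz: "deriv k z \<noteq> 0" using g(2)[OF z] by auto
  have ok: "open (k ` U)" by (rule open_mapping_thm3[OF hol op inj])
  \<comment> \<open>Only for these t does \<open>inv_into\<close> invert anything; T is an open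
    neighbourhood of 0, which suffices for a derivative at 0.\<close>
  define T where "T = {t::real. k z + of_real t \<in> k ` U}"
  have "open T" unfolding T_def
    unfolding vimage_def[symmetric, of "\<lambda>t. k z + of_real t"]
    by (intro open_vimage ok continuous_intros)
  moreover have "0 \<in> T" using z by (simp add: T_def)
  moreover have eq: "inv_into U k (k z + of_real t) = g (k z + of_real t)" if "t \<in> T" for t
    using that g(3) inj by (auto simp: T_def)
  moreover have "((\<lambda>t. g (k z + of_real t)) has_vector_derivative 1 / deriv k z) (at 0)"
  proof -
    have "(g has_field_derivative deriv g (k z)) (at (k z + of_real 0))"
      using holomorphic_derivI[OF g(1) ok] z by simp
    moreover have "((\<lambda>t. k z + of_real t) has_vector_derivative 1) (at (0::real))"
      by (auto intro!: derivative_eq_intros)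
    ultimately have "((g \<circ> (\<lambda>t. k z + of_real t)) has_vector_derivative 1 * deriv g (k z)) (at 0)"
      by (intro field_vector_diff_chain_at) auto
    moreover have "deriv g (k z) = 1 / deriv k z" using g(2)[OF z] nz by (simp add: field_simps)
    ultimately show ?thesis by (simp add: o_def)
  qed
  ultimately show "((\<lambda>t. inv_into U k (k z + of_real t)) has_vector_derivative 1 / deriv k z) (at 0)"
    by (metis (no_types, lifting) has_vector_derivative_transform_within_open)
qed

lemma Sigma1D:
  assumes "h \<in> Sigma1"
  shows "h holomorphic_on unit_disk" "inj_on h unit_disk" "h 0 = 0"
    "\<And>z t. z \<in> unit_disk \<Longrightarrow> 0 \<le> t \<Longrightarrow> h z + of_real t \<in> h ` unit_disk"
    "\<And>z. z \<in> unit_disk \<Longrightarrow> ((\<lambda>t. flow h t z) \<longlongrightarrow> 1) at_top"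
  using assms unfolding Sigma1_def by (elim CollectE conjE; simp only: ball_simps)+

lemma flow_in_disk:
  assumes "h \<in> Sigma1" "z \<in> unit_disk" "0 \<le> t"
  shows "flow h t z \<in> unit_disk" "h (flow h t z) = h z + of_real t"
proof -
  have "h z + of_real t \<in> h ` unit_disk" by (rule Sigma1D(4)[OF assms])
  then show "flow h t z \<in> unit_disk" "h (flow h t z) = h z + of_real t"
    unfolding flow_def by (rule inv_into_into, rule f_inv_into_f)
qed

lemma flow_holomorphic:
  assumes h: "h \<in> Sigma1" and t: "0 \<le> t"
  shows "flow h t holomorphic_on unit_disk"
proof -
  note hol = Sigma1D(1)[OF h] and inj = Sigma1D(2)[OF h]
  have tr: "(\<lambda>z. h z + of_real t) ` unit_disk \<subseteq> h ` unit_disk"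
    by (rule image_subsetI) (rule Sigma1D(4)[OF h _ t])
  obtain g where g: "g holomorphic_on (h ` unit_disk)" "\<And>z. z \<in> unit_disk \<Longrightarrow> g (h z) = z"
    by (rule holomorphic_has_inverse[OF hol open_ball inj]) metis
  have "g \<circ> (\<lambda>z. h z + of_real t) holomorphic_on unit_disk"
    by (rule holomorphic_on_compose_gen[OF _ g(1) tr]) (intro holomorphic_intros hol)
  moreover have "(g \<circ> (\<lambda>z. h z + of_real t)) z = flow h t z" if "z \<in> unit_disk" for z
    using g(2)[OF flow_in_disk(1)[OF h that t]] flow_in_disk(2)[OF h that t] by simp
  ultimately show ?thesis by (rule holomorphic_transform)
qed

lemma flow_add:
  assumes h: "h \<in> Sigma1" and z: "z \<in> unit_disk" and "0 \<le> s" "0 \<le> t"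
  shows "flow h (s + t) z = flow h s (flow h t z)"
  unfolding flow_def[of h s] flow_def[of h "s + t"] flow_in_disk(2)[OF h z \<open>0 \<le> t\<close>]
  by (simp add: add_ac)

lemma Sigma1_deriv_nonzero:
  assumes "h \<in> Sigma1" "z \<in> unit_disk"
  shows "deriv h z \<noteq> 0"
  by (rule inv_into_translation_derivative(2)[OF Sigma1D(1)[OF assms(1)] open_ball Sigma1D(2)[OF assms(1)] assms(2)])

text \<open>Each \<open>flow h t\<close> has an orbit tending to 1, so by Wolff's lemma
  \<open>Re ((1 + w) / (1 - w))\<close> does not decrease when \<open>w\<close> moves from
  \<open>z\<close> to \<open>flow h t z\<close>. Its derivative at t = 0 is the real part of
  \<open>2 / ((1 - z)\<^sup>2 * deriv h z)\<close>, and a nonzero number and its reciprocal have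
  real parts of the same sign.\<close>

lemma Sigma1_Berkson_Porta:
  assumes h: "h \<in> Sigma1" and z: "z \<in> unit_disk"
  shows "0 \<le> Re ((1 - z)\<^sup>2 * deriv h z)"
proof -
  note hol = Sigma1D(1)[OF h] and inj = Sigma1D(2)[OF h]
  have nz: "deriv h z \<noteq> 0" by (rule Sigma1_deriv_nonzero[OF h z])
  have z1: "1 - z \<noteq> 0" using z by auto
  define u where "u = (\<lambda>t. (1 + flow h t z) / (1 - flow h t z))"
  have u0: "u 0 = (1 + z) / (1 - z)" "flow h 0 z = z"
    using inj z by (simp_all add: u_def flow_def)
  have mono: "Re (u 0) \<le> Re (u t)" if t: "0 < t" for t
  proof -
    define x where "x = (\<lambda>n. flow h (real n * t) 0)"
    have "cmod (x n) < 1" for n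
      using flow_in_disk(1)[OF h, of 0 "real n * t"] t by (simp add: x_def)
    moreover have "x (Suc n) = flow h t (x n)" for n
      using flow_add[OF h, of 0 t "real n * t"] t by (simp add: x_def algebra_simps)
    moreover have "filterlim (\<lambda>n. real n * t) at_top sequentially"
      using t by (intro filterlim_at_top_mult_tendsto_pos[OF tendsto_const] filterlim_real_sequentially)
    then have "x \<longlonglongrightarrow> 1"
      unfolding x_def by (intro filterlim_compose[OF Sigma1D(5)[OF h]]) simp
    moreover have "flow h t ` unit_disk \<subseteq> unit_disk"
      using flow_in_disk(1)[OF h] t by auto
    ultimately have "Re ((1 + z) / (1 - z)) \<le> Re ((1 + flow h t z) / (1 - flow h t z))"
      using Wolff_horodisk[of "flow h t" x z] flow_holomorphic[OF h] t z by simp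
    then show ?thesis by (simp add: u_def u0)
  qed
  have fl: "((\<lambda>t. flow h t z) has_vector_derivative 1 / deriv h z) (at 0)"
    unfolding flow_def by (rule inv_into_translation_derivative[OF hol open_ball inj z])
  have "((\<lambda>w. (1 + w) / (1 - w)) has_field_derivative 2 / (1 - z)\<^sup>2) (at (flow h 0 z))"
    unfolding u0 using z1 by (auto intro!: derivative_eq_intros simp: field_simps power2_eq_square)
  from field_vector_diff_chain_at[OF fl this]
  have "(u has_vector_derivative 1 / deriv h z * (2 / (1 - z)\<^sup>2)) (at 0)"
    by (simp add: u_def o_def)
  then have "((\<lambda>t. Re (u t)) has_real_derivative Re (2 / ((1 - z)\<^sup>2 * deriv h z))) (at 0)"
    by (drule_tac has_field_derivative_Re) (simp add: mult.commute)
  \<comment> \<open>Monotonicity is available to the right of 0 only; a negative derivative would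
    force a decrease on that side.\<close>
  then have "0 \<le> Re (2 / ((1 - z)\<^sup>2 * deriv h z))"
  proof (rule_tac ccontr)
    assume D: "((\<lambda>t. Re (u t)) has_real_derivative Re (2 / ((1 - z)\<^sup>2 * deriv h z))) (at 0)"
      and "\<not> 0 \<le> Re (2 / ((1 - z)\<^sup>2 * deriv h z))"
    then obtain d where "d > 0" "\<And>t. 0 < t \<Longrightarrow> t < d \<Longrightarrow> Re (u t) < Re (u 0)"
      using DERIV_neg_dec_right[OF D] by force
    from this(1) this(2)[of "d / 2"] mono[of "d / 2"] show False by simp
  qed
  moreover have "Re (2 / w) = 2 * Re w / (cmod w)\<^sup>2" for w
    unfolding Re_divide cmod_power2 by simp
  ultimately show ?thesis using nz z1 by (simp add: zero_le_divide_iff)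
qed

subsection \<open>Parabolic groups of disk automorphisms\<close>

text \<open>After the zero \<open>p\<close> of \<open>G\<close> is moved to the origin, the Schwarz
  lemma applies to the map and to its inverse. Equality of moduli at one nonzero point, here 1/2,
  makes the map a rotation.\<close>

lemma disk_automorphism_formula:
  assumes "automorphism_of unit_disk G"
  obtains p \<mu> where "cmod p < 1" "cmod \<mu> = 1"
    "\<And>z. z \<in> unit_disk \<Longrightarrow> G z = \<mu> * (z - p) / (1 - cnj p * z)"
proof -
  have hol: "G holomorphic_on unit_disk" and bij: "bij_betw G unit_disk unit_disk"
    using assms by (auto simp: automorphism_of_def)
  have G1: "cmod (G z) < 1" if "cmod z < 1" for z
    using bij that by (auto simp: bij_betw_def)
  obtain p where p: "p \<in> unit_disk" "G p = 0"
    using bij by (metis bij_betw_imp_surj_on centre_in_ball imageE zero_less_one)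
  then have p1: "cmod p < 1" "cmod (-p) < 1" by auto
  define T where "T = G \<circ> Moebius_function 0 (-p)"
  have M: "Moebius_function 0 (-p) ` unit_disk \<subseteq> unit_disk"
    using Moebius_function_norm_lt_1[OF p1(2)] by auto
  have T: "T holomorphic_on unit_disk" unfolding T_def
    by (rule holomorphic_on_compose_gen[OF Moebius_function_holomorphic[OF p1(2)] hol M])
  have T1: "cmod (T z) < 1" if "cmod z < 1" for z
    using G1 Moebius_function_norm_lt_1[OF p1(2) that] by (simp add: T_def)
  have T0: "T 0 = 0" using p by (simp add: T_def Moebius_function_of_zero)
  have TG: "T (Moebius_function 0 p z) = G z" if "cmod z < 1" for z
    using Moebius_function_compose[of "-p" p z] that p1 by (simp add: T_def)
  have injM: "inj_on (Moebius_function 0 (-p)) unit_disk"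
    by (rule inj_on_inverseI[where g="Moebius_function 0 p"])
       (use Moebius_function_compose[of p "-p"] p1 in auto)
  have injT: "inj_on T unit_disk" unfolding T_def
    using bij injM inj_on_subset[OF _ M] by (intro comp_inj_on) (auto simp: bij_betw_def)
  have surT: "T ` unit_disk = unit_disk"
  proof
    show "unit_disk \<subseteq> T ` unit_disk"
    proof
      fix w assume "w \<in> unit_disk"
      then obtain z where z: "z \<in> unit_disk" "G z = w"
        using bij by (metis bij_betw_imp_surj_on imageE)
      then show "w \<in> T ` unit_disk"
        using TG[of z] Moebius_function_norm_lt_1[OF p1(1), of z] by (metis imageI mem_ball_0)
    qed
  qed (use T1 in auto)
  obtain g where g: "g holomorphic_on unit_disk" "\<And>z. z \<in> unit_disk \<Longrightarrow> g (T z) = z"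
    using holomorphic_has_inverse[OF T open_ball injT] surT by metis
  have g0: "g 0 = 0" using g(2)[of 0] T0 by simp
  have g1: "cmod (g z) < 1" if "cmod z < 1" for z
  proof -
    from that surT have "z \<in> T ` unit_disk" by simp
    then show ?thesis using g(2) by auto
  qed
  have "cmod (T (1/2)) = cmod (1/2)"
    using Schwarz_Lemma(1)[OF T T0 T1, of "1/2"] Schwarz_Lemma(1)[OF g(1) g0 g1, of "T (1/2)"]
      g(2)[of "1/2"] T1[of "1/2"] by simp
  then obtain \<mu> where l: "\<And>z. cmod z < 1 \<Longrightarrow> T z = \<mu> * z" "cmod \<mu> = 1"
    using Schwarz_Lemma(3)[OF T T0 T1, of 0]
    by (force intro!: exI[of _ "1/2"])
  show thesis
  proof (rule that[OF p1(1) l(2)])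
    fix z assume z: "z \<in> unit_disk"
    then show "G z = \<mu> * (z - p) / (1 - cnj p * z)"
      using TG[of z] l(1)[of "Moebius_function 0 p z"] Moebius_function_norm_lt_1[OF p1(1), of z 0]
      by (simp add: Moebius_function_simple)
  qed
qed

text \<open>The coordinate \<open>1 / (1 - z)\<close> puts the point 1 at infinity, and a Moebius
  map whose only fixed point is infinity is a translation.\<close>

lemma parabolic_automorphism_translation:
  assumes "parabolic_automorphism G 1"
  obtains \<tau> where "\<And>z. z \<in> unit_disk \<Longrightarrow> 1 / (1 - G z) = 1 / (1 - z) + \<tau>"
proof -
  from assms obtain g where aut: "automorphism_of unit_disk G" and cg: "continuous_on (cball 0 1) g"
    and gG: "\<And>z. z \<in> unit_disk \<Longrightarrow> g z = G z" and fp: "{z \<in> cball 0 1. g z = z} = {1}"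
    unfolding parabolic_automorphism_def by blast
  obtain p \<mu> where p: "cmod p < 1" and l: "cmod \<mu> = 1"
    and G: "\<And>z. z \<in> unit_disk \<Longrightarrow> G z = \<mu> * (z - p) / (1 - cnj p * z)"
    using disk_automorphism_formula[OF aut] by metis
  have nz: "1 - cnj p * z \<noteq> 0" if "cmod z \<le> 1" for z
    by (rule one_minus_cnj_mult_nonzero[OF p that])
  define m where "m = (\<lambda>z. \<mu> * (z - p) / (1 - cnj p * z))"
  \<comment> \<open>By density the continuous extension is given by the Moebius formula on the
    closed disk too, so its fixed points can be found algebraically.\<close>
  have "continuous_on (closure (ball 0 1)) (\<lambda>z. g z - m z)"
    unfolding m_def using nz by (auto intro!: continuous_intros cg)
  then have gm: "g z - m z = 0" if "cmod z \<le> 1" for z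
    by (rule continuous_constant_on_closure) (use gG G that in \<open>auto simp: m_def\<close>)
  have fix_iff: "m z = z \<longleftrightarrow> z = 1" if "cmod z \<le> 1" for z
  proof -
    have "z \<in> {z \<in> cball 0 1. g z = z} \<longleftrightarrow> z \<in> {1}" by (simp only: fp)
    moreover have "g z = m z" using gm[OF that] by simp
    ultimately show ?thesis using that by simp
  qed
  \<comment> \<open>Otherwise the origin would be a fixed point.\<close>
  have p0: "p \<noteq> 0"
    using fix_iff[of 0] by (auto simp: m_def)
  have "m 1 = 1" using fix_iff[of 1] by simp
  then have one: "\<mu> * (1 - p) = 1 - cnj p" using nz[of 1] by (simp add: m_def divide_simps)
  define r where "r = - \<mu> * p / cnj p"
  have r1: "cmod r = 1" using l p0 by (simp add: r_def norm_mult norm_divide)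
  \<comment> \<open>The fixed point equation is quadratic with root product of modulus one, so 1 is a double root.\<close>
  have A: "cnj p * r = - (\<mu> * p)" using p0 by (simp add: r_def)
  have "r * (\<mu> * (1 - p)) = r - cnj p * r" by (simp only: one) (simp add: algebra_simps)
  also have "\<dots> = r + \<mu> * p" by (simp only: A) simp
  finally have "\<mu> * (r - p) = r * (1 + \<mu> * p)" by (simp add: algebra_simps)
  then have "\<mu> * (r - p) = r * (1 - cnj p * r)" by (simp only: A) simp
  then have "m r = r" using nz[of r] r1 by (simp add: m_def divide_eq_eq)
  then have "r = 1" using fix_iff r1 by simp
  then have lp: "\<mu> * p = - cnj p" using A by simp
  have "\<mu> = \<mu> * (1 - p) + \<mu> * p" by (simp add: algebra_simps)
  also have "\<dots> = 1 - 2 * cnj p" by (simp only: one lp) simp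
  finally have lam: "\<mu> = 1 - 2 * cnj p" .
  have "1 / (1 - G z) = 1 / (1 - z) + cnj p / (1 - cnj p)" if z: "z \<in> unit_disk" for z
  proof -
    have z1: "1 - z \<noteq> 0" "1 - cnj p \<noteq> 0" using z nz[of 1] by auto
    have d: "1 - cnj p * z \<noteq> 0" using nz[of z] z by simp
    have "\<mu> * (z - p) = \<mu> * z - \<mu> * p" by (simp add: algebra_simps)
    also have "\<dots> = (1 - 2 * cnj p) * z + cnj p" by (simp only: lp) (simp add: lam)
    finally have "1 - G z = (1 - cnj p * z - ((1 - 2 * cnj p) * z + cnj p)) / (1 - cnj p * z)"
      using d by (simp add: G[OF z] diff_divide_distrib)
    also have "1 - cnj p * z - ((1 - 2 * cnj p) * z + cnj p) = (1 - z) * (1 - cnj p)"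
      by (simp add: algebra_simps)
    finally have "1 / (1 - G z) = (1 - cnj p * z) / ((1 - z) * (1 - cnj p))" by simp
    also have "1 - cnj p * z = (1 - cnj p) + cnj p * (1 - z)" by (simp add: algebra_simps)
    also have "\<dots> / ((1 - z) * (1 - cnj p)) = 1 / (1 - z) + cnj p / (1 - cnj p)"
      using z1 by (simp add: add_divide_distrib)
    finally show ?thesis .
  qed
  then show thesis by (rule that)
qed

text \<open>In the coordinate \<open>k = h \<circ> \<phi>\<close> the group is translation by t,
  while \<open>1 / (1 - z)\<close> moves by an amount depending on t alone. Comparing velocities at
  t = 0 shows that \<open>1 / (deriv k z * (1 - z)\<^sup>2)\<close> is the same for all z; how that
  amount depends on t never has to be computed.\<close>

lemma parabolic_group_model_derivative:
  assumes h: "h \<in> Sigma1" and bfi: "backward_flow_invariant h \<Omega>"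
    and \<phi>: "riemann_map \<phi> \<Omega>" and par: "parabolic_group (conj_flow h \<phi>) 1"
  obtains c where "c \<noteq> 0" "\<And>z. z \<in> unit_disk \<Longrightarrow> deriv h (\<phi> z) * deriv \<phi> z = c / (1 - z)\<^sup>2"
proof -
  note hol = Sigma1D(1)[OF h] and inj = Sigma1D(2)[OF h]
  have \<phi>h: "\<phi> holomorphic_on unit_disk" and bij: "bij_betw \<phi> unit_disk \<Omega>"
    using \<phi> by (auto simp: riemann_map_def)
  have sub: "\<Omega> \<subseteq> unit_disk" using bfi by (auto simp: backward_flow_invariant_def)
  define k where "k = h \<circ> \<phi>"
  have kh: "k holomorphic_on unit_disk" unfolding k_def
    by (rule holomorphic_on_compose_gen[OF \<phi>h hol]) (use bij sub in \<open>auto simp: bij_betw_def\<close>)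
  have kinj: "inj_on k unit_disk" unfolding k_def
    using bij sub inj by (intro comp_inj_on) (auto simp: bij_betw_def intro: inj_on_subset)
  define G where "G = conj_flow h \<phi>"
  have Gk: "G t z = inv_into unit_disk k (k z + of_real t)" and kG: "k (G t z) = k z + of_real t"
    and Gin: "G t z \<in> unit_disk" if z: "z \<in> unit_disk" for t z
  proof -
    have "\<phi> z \<in> \<Omega>" using bij z by (auto simp: bij_betw_def)
    moreover have "bij_betw (flow h t) \<Omega> \<Omega>" and "\<forall>z\<in>\<Omega>. \<forall>t. h z + of_real t \<in> h ` unit_disk"
      using bfi by (simp_all add: backward_flow_invariant_def automorphism_of_def extends_to_line_def)
    ultimately have fl: "flow h t (\<phi> z) \<in> \<Omega>" and ext: "h (\<phi> z) + of_real t \<in> h ` unit_disk"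
      by (simp_all add: bij_betw_apply)
    from ext have "h (flow h t (\<phi> z)) = k z + of_real t" by (simp add: flow_def f_inv_into_f k_def)
    moreover have in\<phi>: "flow h t (\<phi> z) \<in> \<phi> ` unit_disk" using fl bij by (auto simp: bij_betw_def)
    then have "\<phi> (G t z) = flow h t (\<phi> z)" by (simp add: G_def conj_flow_def f_inv_into_f)
    ultimately show kG: "k (G t z) = k z + of_real t" by (simp add: k_def)
    show Gin: "G t z \<in> unit_disk" unfolding G_def conj_flow_def by (rule inv_into_into[OF in\<phi>])
    show "G t z = inv_into unit_disk k (k z + of_real t)"
      using kinj Gin by (simp flip: kG)
  qed
  \<comment> \<open>\<open>parabolic_group\<close> says nothing about t = 0, yet that value enters
    the derivative there; hence the case distinction.\<close>
  have tr: "1 / (1 - G t z) - 1 / (1 - z) = 1 / (1 - G t 0) - 1" if z: "z \<in> unit_disk" for t z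
  proof (cases "t = 0")
    case True
    then show ?thesis using Gk[of z 0] Gk[of 0 0] z kinj by simp
  next
    case False
    then have "parabolic_automorphism (G t) 1" using par by (simp add: parabolic_group_def G_def)
    then obtain \<tau> where "\<And>z. z \<in> unit_disk \<Longrightarrow> 1 / (1 - G t z) = 1 / (1 - z) + \<tau>"
      using parabolic_automorphism_translation by metis
    from this[OF z] this[of 0] show ?thesis by simp
  qed
  have D: "((\<lambda>t. 1 / (1 - G t z) - 1 / (1 - z)) has_vector_derivative 1 / deriv k z * (1 / (1 - z)\<^sup>2)) (at 0)"
    if z: "z \<in> unit_disk" for z
  proof -
    have z1: "1 - z \<noteq> 0" using z by auto
    have G0: "G 0 z = z" using Gk[OF z, of 0] kinj z by simp
    have "((\<lambda>t. G t z) has_vector_derivative 1 / deriv k z) (at 0)"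
      unfolding Gk[OF z] by (rule inv_into_translation_derivative[OF kh open_ball kinj z])
    moreover have "((\<lambda>w. 1 / (1 - w) - 1 / (1 - z)) has_field_derivative 1 / (1 - z)\<^sup>2) (at (G 0 z))"
      unfolding G0 using z1 by (auto intro!: derivative_eq_intros simp: power2_eq_square)
    ultimately show ?thesis by (drule_tac field_vector_diff_chain_at) (auto simp: o_def mult.commute)
  qed
  define c where "c = deriv k 0"
  have k0: "deriv k z \<noteq> 0" if "z \<in> unit_disk" for z
    by (rule inv_into_translation_derivative(2)[OF kh open_ball kinj that])
  show thesis
  proof (rule that)
    show "c \<noteq> 0" using k0[of 0] by (simp add: c_def)
    fix z assume z: "z \<in> unit_disk"
    have z1: "1 - z \<noteq> 0" using z by auto
    have "((\<lambda>t. 1 / (1 - G t z) - 1 / (1 - z)) has_vector_derivative 1 / c) (at 0)"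
      using D[of 0] tr[OF z] by (simp add: c_def)
    from vector_derivative_unique_at[OF this D[OF z]]
    have "deriv k z = c / (1 - z)\<^sup>2" using k0[OF z] k0[of 0] z1 by (simp add: c_def field_simps)
    moreover have "deriv k z = deriv h (\<phi> z) * deriv \<phi> z"
      unfolding k_def using bij z sub
      by (intro deriv_chain) (auto intro!: holomorphic_on_imp_differentiable_at[of _ unit_disk] hol \<phi>h simp: bij_betw_def)
    ultimately show "deriv h (\<phi> z) * deriv \<phi> z = c / (1 - z)\<^sup>2" by simp
  qed
qed

subsection \<open>Maximum principle and oscillation bounds\<close>

text \<open>\<open>G\<close> vanishes at the centre and maps into the half-plane of real part below
  \<open>A\<close>. The map sending v to \<open>v / (2 * A - v)\<close> takes this half-plane to the
  disk and fixes 0, so the Schwarz lemma applies to the composition \<open>T\<close>.\<close>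

lemma Borel_Caratheodory_Im:
  assumes hol: "F holomorphic_on ball x R" and R: "0 < R" and s: "0 < s"
    and im: "\<And>w. w \<in> ball x R \<Longrightarrow> \<bar>Im (F w)\<bar> \<le> s"
    and r: "r < 1" and w: "cmod (w - x) \<le> r * R"
  shows "cmod (F w - F x) \<le> 6 * s * r / (1 - r)"
proof -
  define G where "G = (\<lambda>u. - \<i> * (F (x + of_real R * u) - F x))"
  \<comment> \<open>The real part of \<open>G\<close> is at most \<open>2 * s\<close>; the larger
    constant makes the inequality strict.\<close>
  define A where "A = 3 * s"
  define T where "T = (\<lambda>u. G u / (2 * of_real A - G u))"
  have inb: "x + of_real R * u \<in> ball x R" if "cmod u < 1" for u
    using that R by (simp add: dist_norm norm_mult)
  have holG: "G holomorphic_on ball 0 1"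
  proof -
    have "F \<circ> (\<lambda>u. x + of_real R * u) holomorphic_on ball 0 1"
      by (rule holomorphic_on_compose_gen[OF _ hol]) (use inb in \<open>auto intro!: holomorphic_intros\<close>)
    then show ?thesis unfolding G_def o_def by (intro holomorphic_intros)
  qed
  have ReG: "Re (G u) < A" if "cmod u < 1" for u
    using im[OF inb[OF that]] im[of x] R s by (simp add: G_def A_def)
  have nz: "2 * of_real A - G u \<noteq> 0" if "cmod u < 1" for u
  proof
    assume "2 * of_real A - G u = 0"
    then have "Re (2 * of_real A - G u) = 0" by simp
    then show False using ReG[OF that] s by (simp add: A_def)
  qed
  have lt: "cmod (G u) < cmod (2 * of_real A - G u)" if "cmod u < 1" for u
  proof -
    have "(cmod (2 * of_real A - G u))\<^sup>2 - (cmod (G u))\<^sup>2 = 4 * A * (A - Re (G u))"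
      unfolding cmod_power2 by (simp add: power2_eq_square algebra_simps)
    also have "\<dots> > 0" using ReG[OF that] s by (simp add: A_def)
    finally show ?thesis by (simp add: power2_less_imp_less)
  qed
  have T1: "cmod (T u) < 1" if "cmod u < 1" for u
    using lt[OF that] nz[OF that] by (simp add: T_def norm_divide)
  have holT: "T holomorphic_on ball 0 1"
    unfolding T_def using nz by (auto intro!: holomorphic_intros holG)
  have T0: "T 0 = 0" by (simp add: T_def G_def)
  define u where "u = (w - x) / of_real R"
  have ur: "cmod u \<le> r" using w R by (simp add: u_def norm_divide divide_le_eq)
  have u1: "cmod u < 1" using ur r by simp
  have Tr: "cmod (T u) \<le> r" using Schwarz_Lemma(1)[OF holT T0 T1 u1] ur by simp
  have "G u = T u * (2 * of_real A - G u)" using nz[OF u1] by (simp add: T_def)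
  then have "cmod (G u) = cmod (T u) * cmod (2 * of_real A - G u)" by (metis norm_mult)
  also have "\<dots> \<le> r * (2 * A + cmod (G u))"
  proof (rule mult_mono)
    show "cmod (2 * of_real A - G u) \<le> 2 * A + cmod (G u)"
      using norm_triangle_ineq4[of "2 * of_real A" "G u"] s by (simp add: norm_mult A_def)
  qed (use Tr order_trans[OF norm_ge_zero Tr] in auto)
  finally have "cmod (G u) * (1 - r) \<le> 2 * A * r" by (simp add: algebra_simps)
  then have "cmod (G u) \<le> 6 * s * r / (1 - r)" using r by (simp add: pos_le_divide_eq A_def)
  moreover have "G u = - \<i> * (F w - F x)" using R by (simp add: G_def u_def)
  ultimately show ?thesis by (simp add: norm_mult)
qed

text \<open>Cauchy's inequality on the circle of radius \<open>R / 2\<close>, where the preceding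
  bound with r = 1/2 equals \<open>6 * s\<close>.\<close>

lemma deriv_bound_by_Im:
  assumes hol: "F holomorphic_on ball x R" and R: "0 < R" and s: "0 < s"
    and im: "\<And>w. w \<in> ball x R \<Longrightarrow> \<bar>Im (F w)\<bar> \<le> s"
  shows "cmod (deriv F x) \<le> 12 * s / R"
proof -
  have sub: "cball x (R / 2) \<subseteq> ball x R" using R by auto
  have "cmod ((deriv ^^ 1) (\<lambda>w. F w - F x) x) \<le> fact 1 * (6 * s) / (R / 2) ^ 1"
  proof (rule Cauchy_inequality)
    show "(\<lambda>w. F w - F x) holomorphic_on ball x (R / 2)"
      using sub by (intro holomorphic_intros holomorphic_on_subset[OF hol]) auto
    show "continuous_on (cball x (R / 2)) (\<lambda>w. F w - F x)"
      by (intro continuous_intros holomorphic_on_imp_continuous_on holomorphic_on_subset[OF hol sub])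
    show "cmod (F w - F x) \<le> 6 * s" if "cmod (x - w) = R / 2" for w
      using Borel_Caratheodory_Im[OF hol R s im, of "1/2" w] that by (simp add: norm_minus_commute)
  qed (use R in auto)
  moreover have "F field_differentiable at x"
    using holomorphic_on_imp_differentiable_at[OF hol open_ball] R by simp
  ultimately show ?thesis by (simp add: deriv_diff)
qed

text \<open>The exceptional point is removed by applying the maximum principle to \<open>E w ^ n * w\<close> for all \<open>n\<close>.\<close>
lemma maximum_modulus_punctured_frontier:
  assumes hol: "E holomorphic_on S" and S: "open S" "bounded S"
    and cont: "continuous_on (closure S - {0}) E"
    and bdd: "\<And>w. w \<in> closure S - {0} \<Longrightarrow> cmod (E w) \<le> M"
    and le: "\<And>w. w \<in> frontier S - {0} \<Longrightarrow> cmod (E w) \<le> 1"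
    and w: "w \<in> S" "w \<noteq> 0"
  shows "cmod (E w) \<le> 1"
proof (rule ccontr)
  assume gt: "\<not> cmod (E w) \<le> 1"
  obtain B where B: "0 < B" "\<And>z. z \<in> closure S \<Longrightarrow> cmod z \<le> B"
    using bounded_closure[OF S(2)] unfolding bounded_pos by blast
  have wc: "w \<in> closure S - {0}" using w closure_subset[of S] by auto
  have M0: "0 \<le> M" by (rule order_trans[OF norm_ge_zero bdd[OF wc]])
  have "cmod (E w) ^ n * cmod w \<le> B" for n
  proof -
    \<comment> \<open>As \<open>E\<close> is bounded, the value 0 is the limit at 0; so
      \<open>D\<close> is continuous on all of \<open>closure S\<close>, whether 0 lies in S or on
      its frontier.\<close>
    define D where "D = (\<lambda>z. if z = 0 then 0 else E z ^ n * z)"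
    have Dn: "cmod (D z) = (if z = 0 then 0 else cmod (E z) ^ n * cmod z)" for z
      by (simp add: D_def norm_mult norm_power)
    have cD: "continuous_on (closure S) D"
      unfolding continuous_on_eq_continuous_within
    proof
      fix z assume z: "z \<in> closure S"
      show "continuous (at z within closure S) D"
      proof (cases "z = 0")
        case True
        have "((\<lambda>z. M ^ n * cmod z) \<longlongrightarrow> M ^ n * cmod 0) (at 0 within closure S)"
          by (intro tendsto_intros)
        then have g0: "((\<lambda>z. M ^ n * cmod z) \<longlongrightarrow> 0) (at 0 within closure S)" by simp
        have "(D \<longlongrightarrow> 0) (at 0 within closure S)"
        proof (rule Lim_null_comparison[OF _ g0])
          show "\<forall>\<^sub>F z in at 0 within closure S. cmod (D z) \<le> M ^ n * cmod z"
            unfolding eventually_at_filter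
            by (intro always_eventually) (simp add: Dn mult_right_mono power_mono bdd M0)
        qed
        then show ?thesis using True by (simp add: continuous_within D_def)
      next
        case False
        have "continuous_on (closure S - {0}) D"
          by (rule continuous_on_eq[where f="\<lambda>z. E z ^ n * z"]) (auto intro!: continuous_intros cont simp: D_def)
        then have "continuous (at z within (closure S - {0})) D"
          using z False by (simp add: continuous_on_eq_continuous_within)
        moreover have "at z within (closure S - {0}) = at z within closure S"
          using False by (intro at_within_nhd[of _ "- {0}"]) auto
        ultimately show ?thesis by (simp add: continuous_within)
      qed
    qed
    have "cmod (D w) \<le> B"
    proof (rule maximum_modulus_frontier[of D S])
      have hD: "(\<lambda>z. E z ^ n * z) holomorphic_on S" by (intro holomorphic_intros hol)
      have "D holomorphic_on S - {0}"
        by (rule holomorphic_transform[OF holomorphic_on_subset[OF hD]]) (auto simp: D_def)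
      moreover have "continuous_on S D" using cD closure_subset continuous_on_subset by blast
      ultimately show "D holomorphic_on interior S"
        using no_isolated_singularity[of S D "{0}"] S(1) by (simp add: interior_open)
      fix z assume z: "z \<in> frontier S"
      then have zc: "z \<in> closure S" by (simp add: frontier_def)
      have "cmod (E z) ^ n * cmod z \<le> 1 * B" if "z \<noteq> 0"
        using le[of z] z zc that B(2) by (intro mult_mono power_le_one) auto
      then show "cmod (D z) \<le> B" using B(1) by (simp add: Dn)
    qed (use cD S w in auto)
    then show ?thesis using w by (simp add: Dn)
  qed
  then have "cmod (E w) ^ n \<le> B / cmod w" for n
    using w by (simp add: pos_le_divide_eq)
  moreover obtain n where "B / cmod w < cmod (E w) ^ n"
    using real_arch_pow[of "cmod (E w)" "B / cmod w"] gt by auto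
  ultimately show False by (metis not_le)
qed

text \<open>For \<sigma> = 1 and \<sigma> = -1 the exponential of - \<i> \<sigma> F - U has modulus
  \<open>exp (\<sigma> * Im (F z) - Re (U z))\<close>, which is at most 1 on the punctured frontier
  and at most \<open>exp K\<close> elsewhere. Nothing but boundedness is asked of
  \<open>Im F\<close> near 0.\<close>

lemma Im_le_Re_majorant:
  assumes F: "F holomorphic_on S" "continuous_on (closure S - {0}) F"
    and U: "U holomorphic_on S" "continuous_on (closure S - {0}) U"
    and S: "open S" "bounded S"
    and bdd: "\<And>w. w \<in> closure S - {0} \<Longrightarrow> \<bar>Im (F w)\<bar> \<le> K"
    and pos: "\<And>w. w \<in> closure S - {0} \<Longrightarrow> 0 \<le> Re (U w)"
    and le: "\<And>w. w \<in> frontier S - {0} \<Longrightarrow> \<bar>Im (F w)\<bar> \<le> Re (U w)"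
    and w: "w \<in> S" "w \<noteq> 0"
  shows "\<bar>Im (F w)\<bar> \<le> Re (U w)"
proof -
  have "\<sigma> * Im (F w) \<le> Re (U w)" if \<sigma>: "\<bar>\<sigma>\<bar> = 1" for \<sigma> :: real
  proof -
    define E where "E = (\<lambda>w. exp (- \<i> * of_real \<sigma> * F w - U w))"
    have nE: "cmod (E z) = exp (\<sigma> * Im (F z) - Re (U z))" for z
      by (simp add: E_def)
    have s: "\<sigma> * t \<le> \<bar>t\<bar>" for t using \<sigma> by (metis abs_ge_self abs_mult mult_1)
    have "cmod (E w) \<le> 1"
    proof (rule maximum_modulus_punctured_frontier[of E S "exp K"])
      show "E holomorphic_on S" unfolding E_def by (intro holomorphic_intros F U)
      show "continuous_on (closure S - {0}) E" unfolding E_def by (intro continuous_intros F U)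
      fix z
      show "cmod (E z) \<le> exp K" if "z \<in> closure S - {0}"
        using order_trans[OF s[of "Im (F z)"] bdd[OF that]] pos[OF that] by (simp add: nE)
      show "cmod (E z) \<le> 1" if "z \<in> frontier S - {0}"
        using order_trans[OF s[of "Im (F z)"] le[OF that]] by (simp add: nE)
    qed (use w S in auto)
    then show ?thesis by (simp add: nE)
  qed
  from this[of 1] this[of "-1"] show ?thesis by simp
qed

subsection \<open>Harmonic majorants at a Dini-smooth corner\<close>

text \<open>Bounds from above, at points \<zeta> of modulus x in the right half-plane, the harmonic
  function formed from the terms \<open>4 * d k * Re (\<zeta> / (\<zeta> + R))\<close> with
  \<open>R = (1/2) ^ (k + 1)\<close>. The minimum bounds the kernel of scale R; the factor 4
  compensates for its lower bound 1/4 at distance R or more from 0.\<close>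

definition log_majorant :: "(nat \<Rightarrow> real) \<Rightarrow> real \<Rightarrow> real" where
  "log_majorant d x = (\<Sum>k. 4 * d k * min 1 (x * 2 ^ (k + 1)))"

text \<open>A summand can be as large as 1 only until \<open>C * q ^ n\<close> has dropped below
  \<open>(1/2) ^ (k + 1)\<close>, which takes a number of steps linear in k; what remains is
  dominated by a geometric series.\<close>

lemma sum_min_geometric_le:
  fixes q C :: real
  assumes q: "0 < q" "q < 1" and C: "0 \<le> C"
  obtains D where "\<And>N k. (\<Sum>n<N. min 1 (C * q ^ n * 2 ^ (k + 1))) \<le> D * real (k + 1)"
proof -
  obtain p where p: "q ^ p < 1/2" using real_arch_pow_inv[of "1/2" q] q by auto
  obtain c where c: "C < 2 ^ c" using real_arch_pow[of 2 C] by auto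
  define D where "D = real p * (1 + real c) + 1 / (1 - q)"
  have "(\<Sum>n<N. min 1 (C * q ^ n * 2 ^ (k + 1))) \<le> D * real (k + 1)" for N k
  proof -
    \<comment> \<open>With \<open>q ^ p < 1/2\<close> and \<open>C < 2 ^ c\<close>, this many steps
      ensure \<open>C * q ^ M * 2 ^ (k + 1) \<le> 1\<close>.\<close>
    define M where "M = p * (k + 1 + c)"
    have le: "min 1 (C * q ^ n * 2 ^ (k + 1)) \<le> (if n < M then 1 else 0) + (if M \<le> n then q ^ (n - M) else 0)" for n
    proof (cases "n < M")
      case False
      then have n: "q ^ n = q ^ M * q ^ (n - M)" by (simp flip: power_add)
      have "q ^ M = (q ^ p) ^ (k + 1 + c)" unfolding M_def by (rule power_mult)
      also have "\<dots> \<le> (1/2) ^ (k + 1 + c)" using p q by (intro power_mono) auto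
      finally have qM: "q ^ M \<le> (1/2) ^ (k + 1 + c)" .
      have "C * q ^ M * 2 ^ (k + 1) \<le> 2 ^ c * (1/2) ^ (k + 1 + c) * 2 ^ (k + 1)"
        using C c qM q by (intro mult_mono) auto
      also have "\<dots> = 1" by (simp add: power_add power_divide)
      finally have "C * q ^ M * 2 ^ (k + 1) * q ^ (n - M) \<le> 1 * q ^ (n - M)"
        using q by (intro mult_right_mono) auto
      then show ?thesis using False n by (simp add: mult_ac)
    qed auto
    have "(\<Sum>n<N. min 1 (C * q ^ n * 2 ^ (k + 1)))
       \<le> (\<Sum>n<N. (if n < M then 1 else 0) + (if M \<le> n then q ^ (n - M) else 0))"
      by (rule sum_mono) (rule le)
    also have "\<dots> = real (card ({..<N} \<inter> {..<M})) + (\<Sum>n\<in>{M..<N}. q ^ (n - M))"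
    proof -
      have "(\<Sum>n<N. if n < M then 1 else (0::real)) = (\<Sum>n\<in>{..<N} \<inter> {..<M}. 1)"
        by (subst sum.inter_restrict) auto
      moreover have "(\<Sum>n<N. if M \<le> n then q ^ (n - M) else 0) = (\<Sum>n\<in>{..<N} \<inter> {M..}. q ^ (n - M))"
        by (subst sum.inter_restrict) auto
      moreover have "{..<N} \<inter> {M..} = {M..<N}" by auto
      ultimately show ?thesis by (simp add: sum.distrib)
    qed
    also have "(\<Sum>n\<in>{M..<N}. q ^ (n - M)) = (\<Sum>n<N - M. q ^ n)"
      by (rule sum.reindex_bij_witness[of _ "\<lambda>n. n + M" "\<lambda>n. n - M"]) auto
    also have "\<dots> \<le> (\<Sum>n. q ^ n)"
      using q by (intro sum_le_suminf summable_geometric) auto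
    also have "\<dots> = 1 / (1 - q)" using q by (intro suminf_geometric) auto
    also have "real (card ({..<N} \<inter> {..<M})) \<le> real M"
      using card_mono[of "{..<M}" "{..<N} \<inter> {..<M}"] by simp
    also have "real M + 1 / (1 - q) \<le> D * real (k + 1)"
    proof -
      have "M \<le> p * ((1 + c) * (k + 1))" by (simp add: M_def)
      then have "real M \<le> real p * (1 + real c) * real (k + 1)"
        by (metis (mono_tags) mult.assoc of_nat_1 of_nat_add of_nat_le_iff of_nat_mult)
      moreover have "1 / (1 - q) * 1 \<le> 1 / (1 - q) * real (k + 1)" using q by (intro mult_left_mono) auto
      ultimately show ?thesis by (simp add: D_def distrib_right)
    qed
    finally show ?thesis by simp
  qed
  then show thesis by (rule that)
qed

context
  fixes d :: "nat \<Rightarrow> real"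
  assumes d0: "\<And>k. 0 \<le> d k" and sd: "summable (\<lambda>k. real (k + 1) * d k)"
begin

lemma summable_weight: "summable d"
  by (rule summable_comparison_test'[OF sd, of 0]) (use d0 in \<open>auto simp: algebra_simps\<close>)

lemma summable_log_majorant: "0 \<le> x \<Longrightarrow> summable (\<lambda>k. 4 * d k * min 1 (x * 2 ^ (k + 1)))"
  by (rule summable_comparison_test'[OF summable_mult[OF summable_weight, of 4], of 0])
     (use d0 in \<open>auto simp: abs_mult intro!: mult_left_le\<close>)

lemma log_majorant_nonneg: "0 \<le> x \<Longrightarrow> 0 \<le> log_majorant d x"
  unfolding log_majorant_def by (intro suminf_nonneg summable_log_majorant) (auto simp: d0)

lemma log_majorant_mono: "0 \<le> x \<Longrightarrow> x \<le> y \<Longrightarrow> log_majorant d x \<le> log_majorant d y"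
  unfolding log_majorant_def
  by (intro suminf_le summable_log_majorant mult_left_mono min.mono mult_right_mono) (auto simp: d0)

text \<open>After the sums are interchanged, \<open>d k\<close> is counted at most a multiple of k +
  1 times. This is the origin of the weight k + 1 in the Dini condition \<open>sd\<close>.\<close>

lemma summable_log_majorant_geometric:
  assumes q: "0 < q" "q < 1" and C: "0 \<le> C"
  shows "summable (\<lambda>n. log_majorant d (C * q ^ n))"
proof -
  obtain D where D: "\<And>N k. (\<Sum>n<N. min 1 (C * q ^ n * 2 ^ (k + 1))) \<le> D * real (k + 1)"
    using sum_min_geometric_le[OF q C] by metis
  have Cq: "0 \<le> C * q ^ n" for n using C q by simp
  show ?thesis
  proof (rule summableI_nonneg_bounded)
    show "0 \<le> log_majorant d (C * q ^ n)" for n using log_majorant_nonneg[OF Cq] .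
    show "(\<Sum>n<N. log_majorant d (C * q ^ n)) \<le> (\<Sum>k. 4 * D * (real (k + 1) * d k))" for N
    proof -
      have "(\<Sum>n<N. log_majorant d (C * q ^ n))
          = (\<Sum>k. \<Sum>n<N. 4 * d k * min 1 (C * q ^ n * 2 ^ (k + 1)))"
        unfolding log_majorant_def by (rule suminf_sum[symmetric]) (rule summable_log_majorant[OF Cq])
      also have "\<dots> \<le> (\<Sum>k. 4 * D * (real (k + 1) * d k))"
      proof (rule suminf_le)
        show "summable (\<lambda>k. \<Sum>n<N. 4 * d k * min 1 (C * q ^ n * 2 ^ (k + 1)))"
          by (intro summable_sum summable_log_majorant Cq)
        show "summable (\<lambda>k. 4 * D * (real (k + 1) * d k))" by (rule summable_mult[OF sd])
        fix k
        have "(\<Sum>n<N. 4 * d k * min 1 (C * q ^ n * 2 ^ (k + 1)))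
            = 4 * d k * (\<Sum>n<N. min 1 (C * q ^ n * 2 ^ (k + 1)))" by (rule sum_distrib_left[symmetric])
        also have "\<dots> \<le> 4 * d k * (D * real (k + 1))"
          using d0[of k] by (intro mult_left_mono D) auto
        finally show "(\<Sum>n<N. 4 * d k * min 1 (C * q ^ n * 2 ^ (k + 1))) \<le> 4 * D * (real (k + 1) * d k)"
          by (simp add: mult_ac)
      qed
      finally show ?thesis .
    qed
  qed
qed

lemma log_majorant_small:
  assumes e: "0 < e"
  obtains t where "0 < t" "\<And>x. 0 \<le> x \<Longrightarrow> x \<le> t \<Longrightarrow> log_majorant d x < e"
proof -
  have "(\<lambda>n. log_majorant d (1 * (1/2) ^ n)) \<longlonglongrightarrow> 0"
    by (intro summable_LIMSEQ_zero summable_log_majorant_geometric) auto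
  then obtain n where "log_majorant d (1 * (1/2) ^ n) < e"
    using e by (metis (no_types, lifting) eventually_happens order_tendstoD(2) sequentially_bot)
  then show thesis
    using log_majorant_mono by (intro that[of "(1/2) ^ n"]) (auto intro: order_le_less_trans)
qed

end

text \<open>The real part of \<open>\<zeta> / (\<zeta> + R)\<close> is a harmonic substitute, on the
  right half-plane, for the indicator function of the exterior of the disk of radius R.\<close>

lemma Moebius_kernel_bounds:
  fixes \<zeta> :: complex and R :: real
  assumes "0 \<le> Re \<zeta>" "0 < R"
  shows "\<zeta> + of_real R \<noteq> 0" "0 \<le> Re (\<zeta> / (\<zeta> + of_real R))"
    "R \<le> cmod \<zeta> \<Longrightarrow> 1/4 \<le> Re (\<zeta> / (\<zeta> + of_real R))"
    "Re (\<zeta> / (\<zeta> + of_real R)) \<le> min 1 (cmod \<zeta> / R)"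
proof -
  define a b where "a = Re \<zeta>" and "b = Im \<zeta>"
  have z: "\<zeta> = Complex a b" by (simp add: a_def b_def)
  have a: "0 \<le> a" using assms by (simp add: a_def)
  have n: "0 < (a + R)\<^sup>2 + b\<^sup>2" using a assms(2) by (intro add_pos_nonneg) auto
  have Re: "Re (\<zeta> / (\<zeta> + of_real R)) = (a\<^sup>2 + b\<^sup>2 + a * R) / ((a + R)\<^sup>2 + b\<^sup>2)"
    by (simp add: Re_divide z power2_eq_square algebra_simps)
  show nz: "\<zeta> + of_real R \<noteq> 0" using a assms(2) by (auto simp: z complex_eq_iff)
  show "0 \<le> Re (\<zeta> / (\<zeta> + of_real R))" unfolding Re using a n assms(2) by (intro divide_nonneg_pos) auto
  show "1/4 \<le> Re (\<zeta> / (\<zeta> + of_real R))" if "R \<le> cmod \<zeta>"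
  proof -
    have "R\<^sup>2 \<le> (cmod \<zeta>)\<^sup>2" using that assms(2) by (intro power_mono) auto
    then have r: "R\<^sup>2 \<le> a\<^sup>2 + b\<^sup>2" by (simp add: z cmod_power2)
    have "0 \<le> a * R" using a assms(2) by simp
    then have "(a + R)\<^sup>2 + b\<^sup>2 \<le> 4 * (a\<^sup>2 + b\<^sup>2 + a * R)"
    proof -
      \<comment> \<open>With squares and products replaced by variables the inequality is linear: p,
        q, r, s, t stand for the squares of a, b, R, for a R, and for the square of a + R.\<close>
      have lin: "t + q \<le> 4 * (p + q + s)"
        if "t = p + 2 * s + r" "r \<le> p + q" "0 \<le> s" "0 \<le> p" "0 \<le> q" for t p q r s :: real
        using that by argo
      show ?thesis
        by (rule lin[OF _ r \<open>0 \<le> a * R\<close>]) (simp_all add: power2_sum)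
    qed
    then show ?thesis unfolding Re using n by (simp add: pos_le_divide_eq)
  qed
  have "Re (\<zeta> / (\<zeta> + of_real R)) \<le> cmod (\<zeta> / (\<zeta> + of_real R))" by (rule complex_Re_le_cmod)
  also have "\<dots> \<le> cmod \<zeta> / R"
  proof -
    have "R \<le> Re (\<zeta> + of_real R)" using assms by simp
    also have "\<dots> \<le> cmod (\<zeta> + of_real R)" by (rule complex_Re_le_cmod)
    finally show ?thesis using assms(2) by (simp add: norm_divide frac_le)
  qed
  finally show "Re (\<zeta> / (\<zeta> + of_real R)) \<le> min 1 (cmod \<zeta> / R)"
    unfolding Re using a assms(2) n by (simp add: power2_sum)
qed

lemma dyadic_shell:
  fixes x :: real
  assumes "0 < x" "x \<le> 1"
  obtains m where "(1/2) ^ (m + 1) < x" "x \<le> (1/2) ^ m"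
proof -
  define n where "n = (LEAST n. (1/2) ^ n < x)"
  obtain k where "(1/2) ^ k < x" using real_arch_pow_inv[of x "1/2"] assms by auto
  then have n: "(1/2) ^ n < x" unfolding n_def by (rule LeastI)
  with assms have "n \<noteq> 0" by (cases n) auto
  then obtain m where m: "n = Suc m" using not0_implies_Suc by blast
  then have "\<not> (1/2) ^ m < x" using not_less_Least[of m "\<lambda>n. (1/2) ^ n < x"] by (simp add: n_def)
  then show thesis using n m by (intro that[of m]) auto
qed

text \<open>Here \<open>f = 1 - \<phi>\<close> in the half-plane coordinate, \<open>\<kappa>\<close> is the direction of the bisector of the corner,
  and the \<open>d k\<close> are the increments of the Dini modulus over dyadic scales, so that the tail sums
  of \<open>d\<close> bound the deviation of the argument and \<open>\<Sum> (k + 1) d k < \<infinity>\<close> is the Dini condition.\<close>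
locale dini_corner =
  fixes f :: "complex \<Rightarrow> complex" and \<gamma> \<kappa> \<rho> :: real and d :: "nat \<Rightarrow> real"
  assumes hol: "f holomorphic_on {w. 0 < Re w}"
    and cont: "continuous_on ({w. 0 < Re w} \<union> {w. Re w = 0 \<and> cmod w \<le> \<rho>}) f"
    and zero: "f 0 = 0"
    and Re_pos: "0 < Re w \<Longrightarrow> 0 < Re (f w)"
    and edge: "Re w = 0 \<Longrightarrow> w \<noteq> 0 \<Longrightarrow> cmod w \<le> \<rho> \<Longrightarrow> 0 \<le> Re (f w) \<and> f w \<noteq> 0 \<and> cmod (f w) \<le> 1"
    and \<rho>: "0 < \<rho>" and \<gamma>: "0 < \<gamma>"
    and d0: "0 \<le> d k" and sd: "summable (\<lambda>k. real (k + 1) * d k)"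
    and edge_arg: "Re w = 0 \<Longrightarrow> w \<noteq> 0 \<Longrightarrow> cmod w \<le> \<rho> \<Longrightarrow> cmod (f w) \<le> (1/2) ^ m \<Longrightarrow>
      \<bar>Im (Ln (f w)) - \<gamma> * Im (Ln w) - \<kappa>\<bar> \<le> (\<Sum>k. d (k + m))"
begin

definition \<Phi> :: "complex \<Rightarrow> complex" where
  "\<Phi> w = Ln (f w) - of_real \<gamma> * Ln w - \<i> * of_real \<kappa>"

text \<open>An a priori bound for \<open>Im \<Phi>\<close> that uses no boundary information. It
  supplies boundedness near 0, the estimate on the outer circle, and a first Harnack
  inequality.\<close>

definition K :: real where "K = pi * (1 + \<gamma>) + \<bar>\<kappa>\<bar>"

lemma K_pos: "0 < K" unfolding K_def using \<gamma> by (intro add_pos_nonneg mult_pos_pos) auto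

lemma slit_plane:
  assumes "0 < Re w \<or> (Re w = 0 \<and> w \<noteq> 0 \<and> cmod w \<le> \<rho>)"
  shows "w \<notin> \<real>\<^sub>\<le>\<^sub>0" "f w \<notin> \<real>\<^sub>\<le>\<^sub>0" "0 \<le> Re (f w)" "f w \<noteq> 0"
proof -
  have *: "z \<notin> \<real>\<^sub>\<le>\<^sub>0" if "0 \<le> Re z" "z \<noteq> 0" for z
    using that by (auto simp: complex_nonpos_Reals_iff complex_eq_iff)
  show "0 \<le> Re (f w)" "f w \<noteq> 0" using assms Re_pos[of w] edge[of w] by force+
  then show "f w \<notin> \<real>\<^sub>\<le>\<^sub>0" by (rule *)
  show "w \<notin> \<real>\<^sub>\<le>\<^sub>0" using assms by (intro *) auto
qed

lemma \<Phi>_holomorphic: "\<Phi> holomorphic_on {w. 0 < Re w}"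
  unfolding \<Phi>_def using slit_plane by (intro holomorphic_intros hol) auto

lemma exp_\<Phi>: "0 < Re w \<Longrightarrow> f w = exp (\<Phi> w) * exp (of_real \<gamma> * Ln w) * exp (\<i> * of_real \<kappa>)"
  using slit_plane(4)[of w] by (simp add: \<Phi>_def flip: exp_add)

lemma norm_f: "0 < Re w \<Longrightarrow> cmod (f w) = exp (Re (\<Phi> w)) * cmod w powr \<gamma>"
  by (subst exp_\<Phi>) (auto simp: norm_mult powr_def)

lemma \<Phi>_Im_bound:
  assumes "w \<noteq> 0" "f w \<noteq> 0" shows "\<bar>Im (\<Phi> w)\<bar> \<le> K"
proof -
  have "\<bar>Im (Ln (f w))\<bar> \<le> pi" "\<bar>Im (Ln w)\<bar> \<le> pi"
    using mpi_less_Im_Ln Im_Ln_le_pi assms by (smt (verit))+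
  then have "\<bar>\<gamma> * Im (Ln w)\<bar> \<le> \<gamma> * pi" using \<gamma> by (simp add: abs_mult)
  with \<open>\<bar>Im (Ln (f w))\<bar> \<le> pi\<close> show ?thesis by (simp add: \<Phi>_def K_def algebra_simps)
qed

text \<open>The boundary bound depends on \<open>w\<close> only through \<open>cmod (f w)\<close>.  Hence the harmonic majorant can be
  chosen in the image and composed with \<open>f\<close>, and no estimate of the boundary correspondence is
  needed.\<close>
lemma Im_\<Phi>_le_log_majorant:
  assumes w: "0 < Re w" "cmod w < \<rho>"
  shows "\<bar>Im (\<Phi> w)\<bar> \<le> log_majorant d (cmod (f w)) + 4 * K * cmod w / \<rho>"
proof -
  define S where "S = {w. 0 < Re w \<and> cmod w < \<rho>}"
  have oS: "open S" unfolding S_def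
    by (intro open_Collect_conj open_Collect_less continuous_intros)
  have bS: "bounded S" unfolding S_def by (rule bounded_subset[of "ball 0 \<rho>"]) auto
  have clS: "0 \<le> Re z \<and> cmod z \<le> \<rho>" if "z \<in> closure S" for z
  proof -
    have "closed {z. 0 \<le> Re z \<and> cmod z \<le> \<rho>}"
      by (intro closed_Collect_conj closed_Collect_le continuous_intros)
    then have "closure S \<subseteq> {z. 0 \<le> Re z \<and> cmod z \<le> \<rho>}"
      by (rule closure_minimal[rotated]) (auto simp: S_def)
    then show ?thesis using that by auto
  qed
  have dom: "0 < Re z \<or> (Re z = 0 \<and> z \<noteq> 0 \<and> cmod z \<le> \<rho>)" if "z \<in> closure S - {0}" for z
    using clS[of z] that by auto
  note slit = slit_plane[OF dom]
  have contf: "continuous_on (closure S - {0}) f"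
    by (rule continuous_on_subset[OF cont]) (use dom in auto)
  have holf: "f holomorphic_on S" by (rule holomorphic_on_subset[OF hol]) (auto simp: S_def)
  have sumd: "summable d" by (rule summable_weight[OF d0 sd])
  have bound: "\<bar>Im (\<Phi> w)\<bar> \<le> log_majorant d (cmod (f w)) + 4 * K * cmod w / \<rho> + (\<Sum>k. d (k + N))" for N
  proof -
    define tail where "tail = (\<Sum>k. d (k + N))"
    \<comment> \<open>A finite sum, so that holomorphy is immediate; the omitted scales are paid for
      by the constant \<open>tail\<close>, which vanishes as N grows. The last term dominates
      \<open>K\<close> on the circle of radius \<rho>, its kernel being at least 1/4 there.\<close>
    define U where "U = (\<lambda>z. (\<Sum>k<N. of_real (4 * d k) * (f z / (f z + of_real ((1/2) ^ (k + 1)))))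
      + of_real tail + of_real (4 * K) * (z / (z + of_real \<rho>)))"
    have tail0: "0 \<le> tail" unfolding tail_def
      using d0 summable_ignore_initial_segment[OF sumd] by (intro suminf_nonneg) auto
    have Re_of_real_mult: "Re (of_real x * z) = x * Re z" for x z by simp
    have ReU: "Re (U z) = (\<Sum>k<N. 4 * d k * Re (f z / (f z + of_real ((1/2) ^ (k + 1)))))
      + tail + 4 * K * Re (z / (z + of_real \<rho>))" for z
      by (simp only: U_def plus_complex.sel Re_sum Re_complex_of_real Re_of_real_mult)
    have fz: "f z + of_real ((1/2) ^ (k + 1)) \<noteq> 0" "0 \<le> Re (f z / (f z + of_real ((1/2) ^ (k + 1))))"
      if "z \<in> closure S - {0}" for z k
      by (rule Moebius_kernel_bounds; use slit(3)[OF that] in simp)+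
    have z\<rho>: "z + of_real \<rho> \<noteq> 0" "0 \<le> Re (z / (z + of_real \<rho>))" if "z \<in> closure S - {0}" for z
      by (rule Moebius_kernel_bounds; use clS[of z] \<rho> that in simp)+
    have SS: "S \<subseteq> closure S - {0}" using closure_subset[of S] by (auto simp: S_def)
    have posU: "0 \<le> Re (U z)" if "z \<in> closure S - {0}" for z
      unfolding ReU using fz(2)[OF that] z\<rho>(2)[OF that] d0 tail0 K_pos
      by (intro add_nonneg_nonneg sum_nonneg mult_nonneg_nonneg) auto
    have "\<bar>Im (\<Phi> w)\<bar> \<le> Re (U w)"
    proof (rule Im_le_Re_majorant[of \<Phi> S U K])
      show "\<Phi> holomorphic_on S" by (rule holomorphic_on_subset[OF \<Phi>_holomorphic]) (auto simp: S_def)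
      show "continuous_on (closure S - {0}) \<Phi>"
        unfolding \<Phi>_def by (intro continuous_intros contf) (use slit in auto)
      show "U holomorphic_on S"
        unfolding U_def by (intro holomorphic_intros holf fz(1) z\<rho>(1)) (use SS in auto)
      show "continuous_on (closure S - {0}) U"
        unfolding U_def by (intro continuous_intros contf ballI fz(1) z\<rho>(1)) auto
      show "\<bar>Im (\<Phi> z)\<bar> \<le> K" if "z \<in> closure S - {0}" for z
        using that slit(4)[OF that] by (intro \<Phi>_Im_bound) auto
      show "0 \<le> Re (U z)" if "z \<in> closure S - {0}" for z by (rule posU[OF that])
      show "\<bar>Im (\<Phi> z)\<bar> \<le> Re (U z)" if "z \<in> frontier S - {0}" for z
      proof -
        have zc: "z \<in> closure S - {0}" and "z \<notin> S"
          using that oS by (auto simp: frontier_def interior_open)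
        then consider "cmod z = \<rho>" | "Re z = 0" "z \<noteq> 0" "cmod z \<le> \<rho>"
          using clS[of z] by (auto simp: S_def)
        then show ?thesis
        proof cases
          case 1
          have "1/4 \<le> Re (z / (z + of_real \<rho>))"
            using Moebius_kernel_bounds(3)[of z \<rho>] clS[of z] zc \<rho> 1 by auto
          then have "K \<le> 4 * K * Re (z / (z + of_real \<rho>))" using K_pos by simp
          moreover have "0 \<le> (\<Sum>k<N. 4 * d k * Re (f z / (f z + of_real ((1/2) ^ (k + 1)))))"
            using fz(2)[OF zc] d0 by (intro sum_nonneg mult_nonneg_nonneg) auto
          moreover have "\<bar>Im (\<Phi> z)\<bar> \<le> K" using zc slit(4)[OF zc] by (intro \<Phi>_Im_bound) auto
          ultimately show ?thesis unfolding ReU using tail0 by linarith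
        next
          case 2
          \<comment> \<open>The upper bound selects the tail in \<open>edge_arg\<close>. The lower
            bound puts \<open>f z\<close> outside the radii of all kernels with index k \<ge> m, so
            that each of them contributes at least \<open>d k\<close>.\<close>
          obtain m where m: "(1/2) ^ (m + 1) < cmod (f z)" "cmod (f z) \<le> (1/2) ^ m"
            using dyadic_shell[of "cmod (f z)"] edge[OF 2] by auto
          have "\<bar>Im (\<Phi> z)\<bar> \<le> (\<Sum>k. d (k + m))"
            using edge_arg[OF 2 m(2)] by (simp add: \<Phi>_def)
          also have "\<dots> = (\<Sum>k. if k < m then 0 else d k)"
          proof -
            have "summable (\<lambda>k. if k < m then 0 else d k)"
              by (rule summable_comparison_test'[OF sumd, of 0]) (use d0 in auto)
            from suminf_split_initial_segment[OF this, of m] show ?thesis by simp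
          qed
          also have "\<dots> \<le> (\<Sum>k<N. if k < m then 0 else d k) + tail"
          proof -
            have s: "summable (\<lambda>k. if k < m then 0 else d k)"
              by (rule summable_comparison_test'[OF sumd, of 0]) (use d0 in auto)
            have "(\<Sum>k. if k + N < m then 0 else d (k + N)) \<le> tail" unfolding tail_def
              using summable_ignore_initial_segment[OF s, of N] summable_ignore_initial_segment[OF sumd]
              by (intro suminf_le) (use d0 in auto)
            then show ?thesis using suminf_split_initial_segment[OF s, of N] by simp
          qed
          also have "(\<Sum>k<N. if k < m then 0 else d k)
              \<le> (\<Sum>k<N. 4 * d k * Re (f z / (f z + of_real ((1/2) ^ (k + 1)))))"
          proof (rule sum_mono)
            fix k
            have "d k \<le> 4 * d k * Re (f z / (f z + of_real ((1/2) ^ (k + 1))))" if "m \<le> k"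
            proof -
              have km: "(1/2) ^ (k + 1) \<le> ((1/2) ^ (m + 1) :: real)" using that by (intro power_decreasing) auto
              then have "1/4 \<le> Re (f z / (f z + of_real ((1/2) ^ (k + 1))))"
                using order_trans[OF km less_imp_le[OF m(1)]] slit(3)[OF zc]
                by (intro Moebius_kernel_bounds(3)) auto
              then have "4 * d k * (1/4) \<le> 4 * d k * Re (f z / (f z + of_real ((1/2) ^ (k + 1))))"
                using d0[of k] by (intro mult_left_mono) auto
              then show ?thesis by simp
            qed
            then show "(if k < m then 0 else d k) \<le> 4 * d k * Re (f z / (f z + of_real ((1/2) ^ (k + 1))))"
              using fz(2)[OF zc, of k] d0[of k] by auto
          qed
          finally show ?thesis unfolding ReU using mult_nonneg_nonneg[OF _ z\<rho>(2)[OF zc], of "4 * K"] K_pos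
            by linarith
        qed
      qed
    qed (use oS bS w in \<open>auto simp: S_def\<close>)
    also have "Re (U w) \<le> (\<Sum>k<N. 4 * d k * min 1 (cmod (f w) * 2 ^ (k + 1))) + tail + 4 * K * (cmod w / \<rho>)"
      unfolding ReU
    proof (intro add_mono sum_mono mult_left_mono order_refl)
      fix k
      show "Re (f w / (f w + of_real ((1/2) ^ (k + 1)))) \<le> min 1 (cmod (f w) * 2 ^ (k + 1))"
        using Moebius_kernel_bounds(4)[of "f w" "(1/2) ^ (k + 1)"] Re_pos[OF w(1)]
        by (simp add: power_divide)
      show "Re (w / (w + of_real \<rho>)) \<le> cmod w / \<rho>"
        using Moebius_kernel_bounds(4)[of w \<rho>] w \<rho> by simp
    qed (use d0 K_pos in auto)
    also have "(\<Sum>k<N. 4 * d k * min 1 (cmod (f w) * 2 ^ (k + 1))) \<le> log_majorant d (cmod (f w))"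
      unfolding log_majorant_def using d0
      by (intro sum_le_suminf summable_log_majorant[OF d0 sd]) auto
    finally show ?thesis by (simp add: tail_def)
  qed
  have "(\<lambda>N. log_majorant d (cmod (f w)) + 4 * K * cmod w / \<rho> + (\<Sum>k. d (k + N)))
      \<longlonglongrightarrow> log_majorant d (cmod (f w)) + 4 * K * cmod w / \<rho> + 0"
  proof (intro tendsto_intros)
    have "(\<lambda>N. suminf d - sum d {..<N}) \<longlonglongrightarrow> suminf d - suminf d"
      by (intro tendsto_intros summable_LIMSEQ sumd)
    then show "(\<lambda>N. \<Sum>k. d (k + N)) \<longlonglongrightarrow> 0"
      by (simp add: suminf_minus_initial_segment[OF sumd])
  qed
  then show ?thesis using bound by (intro LIMSEQ_le_const[where X="\<lambda>N. log_majorant d (cmod (f w)) + 4 * K * cmod w / \<rho> + (\<Sum>k. d (k + N))"]) auto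
qed

end

section \<open>The finite radial limit of \<Phi>\<close>

context dini_corner
begin

text \<open>The Harnack constant for the ball of radius 3x/4 about x: \<open>18 * K\<close> is 6 K r
  / (1 - r) at r = 3/4, and \<open>2 powr \<gamma>\<close> comes from
  \<open>cmod w \<le> 2 * x\<close>.\<close>

definition C where "C = exp (18 * K) * 2 powr \<gamma>"

text \<open>A bound for \<open>Im \<Phi>\<close> on the whole ball of radius 3x/4 about x that
  involves only the value of \<open>f\<close> at the centre; 8 is 4 times 2, from
  \<open>cmod w \<le> 2 * x\<close>.\<close>

definition osc :: "real \<Rightarrow> real" where
  "osc x = log_majorant d (C * cmod (f (of_real x))) + 8 * K * x / \<rho>"

lemma C_pos: "0 < C" by (simp add: C_def)

lemma ball_right_half_plane: "0 < x \<Longrightarrow> R \<le> x \<Longrightarrow> ball (complex_of_real x) R \<subseteq> {w. 0 < Re w}"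
proof
  fix w assume x: "0 < x" "R \<le> x" and "w \<in> ball (complex_of_real x) R"
  then have "cmod (of_real x - w) < R" by (simp add: dist_norm)
  then have "x - Re w < R" using complex_Re_le_cmod[of "of_real x - w"] by simp
  with x show "w \<in> {w. 0 < Re w}" by simp
qed

lemma cmod_in_ball:
  assumes "w \<in> ball (complex_of_real x) R" "0 < x" shows "cmod w < x + R"
  using assms norm_triangle_sub[of w "of_real x"] by (simp add: dist_norm norm_minus_commute)

text \<open>The crude bound \<open>K\<close> already limits the variation of
  \<open>Re \<Phi>\<close> on a ball of fixed hyperbolic size, hence that of
  \<open>cmod (f w)\<close>. This allows the majorant at \<open>f w\<close> to be replaced by one at
  the centre.\<close>

lemma f_Harnack:
  assumes x: "0 < x" and w: "w \<in> ball (complex_of_real x) (3 * x / 4)"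
  shows "cmod (f w) \<le> C * cmod (f (of_real x))"
proof -
  have Rw: "0 < Re w" using ball_right_half_plane[OF x, of "3 * x / 4"] w x by auto
  have "cmod (\<Phi> w - \<Phi> (of_real x)) \<le> 6 * K * (3/4) / (1 - 3/4)"
  proof (rule Borel_Caratheodory_Im[where F=\<Phi> and R=x])
    show "\<Phi> holomorphic_on ball (of_real x) x"
      by (rule holomorphic_on_subset[OF \<Phi>_holomorphic ball_right_half_plane[OF x]]) simp
    show "\<bar>Im (\<Phi> z)\<bar> \<le> K" if "z \<in> ball (complex_of_real x) x" for z
    proof -
      have "0 < Re z" using ball_right_half_plane[OF x, of x] that by auto
      then show ?thesis using slit_plane(4)[of z] by (intro \<Phi>_Im_bound) auto
    qed
  qed (use x w K_pos in \<open>auto simp: dist_norm norm_minus_commute\<close>)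
  then have "Re (\<Phi> w) - Re (\<Phi> (of_real x)) \<le> 18 * K"
    using complex_Re_le_cmod[of "\<Phi> w - \<Phi> (of_real x)"] by simp
  then have "exp (Re (\<Phi> w)) \<le> exp (18 * K) * exp (Re (\<Phi> (of_real x)))"
    by (simp flip: exp_add)
  moreover have "cmod w powr \<gamma> \<le> (2 * x) powr \<gamma>"
    using cmod_in_ball[OF w x] x \<gamma> by (intro powr_mono2) auto
  ultimately have "cmod (f w) \<le> exp (18 * K) * exp (Re (\<Phi> (of_real x))) * (2 * x) powr \<gamma>"
    unfolding norm_f[OF Rw] by (intro mult_mono) auto
  also have "\<dots> = C * cmod (f (of_real x))"
    using x norm_f[of "of_real x"] by (simp add: C_def powr_mult)
  finally show ?thesis .
qed

lemma osc_pos: "0 < x \<Longrightarrow> 0 < osc x"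
  unfolding osc_def using K_pos \<rho> C_pos by (intro add_nonneg_pos log_majorant_nonneg[OF d0 sd]) auto

lemma Im_\<Phi>_le_osc:
  assumes x: "0 < x" "x \<le> \<rho> / 2" and w: "w \<in> ball (complex_of_real x) (3 * x / 4)"
  shows "\<bar>Im (\<Phi> w)\<bar> \<le> osc x"
proof -
  have Rw: "0 < Re w" using ball_right_half_plane[OF x(1), of "3 * x / 4"] w x by auto
  have wx: "cmod w \<le> 2 * x" "cmod w < \<rho>" using cmod_in_ball[OF w x(1)] x by auto
  have "\<bar>Im (\<Phi> w)\<bar> \<le> log_majorant d (cmod (f w)) + 4 * K * cmod w / \<rho>"
    by (rule Im_\<Phi>_le_log_majorant[OF Rw wx(2)])
  also have "\<dots> \<le> log_majorant d (C * cmod (f (of_real x))) + 4 * K * (2 * x) / \<rho>"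
    using f_Harnack[OF x(1) w] wx K_pos \<rho>
    by (intro add_mono log_majorant_mono[OF d0 sd] divide_right_mono mult_left_mono) auto
  finally show ?thesis by (simp add: osc_def)
qed

text \<open>The radius x / 2 just reaches the next dyadic point. It is 2/3 of 3x/4, and 6 r / (1 -
  r) at r = 2/3 is 12.\<close>

lemma \<Phi>_oscillation:
  assumes x: "0 < x" "x \<le> \<rho> / 2" and w: "cmod (w - of_real x) \<le> x / 2"
  shows "cmod (\<Phi> w - \<Phi> (of_real x)) \<le> 12 * osc x"
proof -
  have "cmod (\<Phi> w - \<Phi> (of_real x)) \<le> 6 * osc x * (2/3) / (1 - 2/3)"
  proof (rule Borel_Caratheodory_Im[where F=\<Phi> and R="3 * x / 4"])
    show "\<Phi> holomorphic_on ball (of_real x) (3 * x / 4)"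
      by (rule holomorphic_on_subset[OF \<Phi>_holomorphic ball_right_half_plane[OF x(1)]]) (use x in simp)
  qed (use x w osc_pos Im_\<Phi>_le_osc[OF x] in auto)
  then show ?thesis by simp
qed

text \<open>Since \<open>osc\<close> tends to 0, this makes x f' / f tend to \<gamma> on the radius,
  so the derivative of \<phi> is controlled along with \<phi> itself.\<close>

lemma \<Phi>_deriv_bound:
  assumes x: "0 < x" "x \<le> \<rho> / 2"
  shows "cmod (of_real x * deriv \<Phi> (of_real x)) \<le> 16 * osc x"
proof -
  have "cmod (deriv \<Phi> (of_real x)) \<le> 12 * osc x / (3 * x / 4)"
  proof (rule deriv_bound_by_Im[where F=\<Phi> and R="3 * x / 4" and s="osc x"])
    show "\<Phi> holomorphic_on ball (of_real x) (3 * x / 4)"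
      by (rule holomorphic_on_subset[OF \<Phi>_holomorphic ball_right_half_plane[OF x(1)]]) (use x in simp)
  qed (use x osc_pos Im_\<Phi>_le_osc[OF x] in auto)
  then show ?thesis using x by (simp add: norm_mult field_simps)
qed

lemma f_tendsto_0: "((\<lambda>x. f (of_real x)) \<longlongrightarrow> 0) (at_right (0::real))"
proof -
  have "continuous (at 0 within ({w. 0 < Re w} \<union> {w. Re w = 0 \<and> cmod w \<le> \<rho>})) f"
    using cont \<rho> by (simp add: continuous_on_eq_continuous_within)
  then have "(f \<longlongrightarrow> 0) (at 0 within ({w. 0 < Re w} \<union> {w. Re w = 0 \<and> cmod w \<le> \<rho>}))"
    by (simp add: continuous_within zero)
  then show ?thesis
  proof (rule filterlim_compose)
    have "((\<lambda>x. complex_of_real x) \<longlongrightarrow> of_real 0) (at_right (0::real))" by (intro tendsto_intros)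
    then show "LIM x at_right (0::real). complex_of_real x :> at 0 within ({w. 0 < Re w} \<union> {w. Re w = 0 \<and> cmod w \<le> \<rho>})"
      by (auto simp: filterlim_at eventually_at_right_less intro: eventually_mono[OF eventually_at_right_less])
  qed
qed

lemma osc_tendsto_0: "(osc \<longlongrightarrow> 0) (at_right 0)"
proof (rule order_tendstoI)
  fix e :: real assume "e < 0"
  then show "\<forall>\<^sub>F x in at_right 0. e < osc x"
    by (intro eventually_mono[OF eventually_at_right_less]) (use osc_pos in \<open>auto intro: less_trans\<close>)
next
  fix e :: real assume e: "0 < e"
  then obtain t where t: "0 < t" "\<And>x. 0 \<le> x \<Longrightarrow> x \<le> t \<Longrightarrow> log_majorant d x < e / 2"
    using log_majorant_small[OF d0 sd, of "e / 2"] by auto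
  have "((\<lambda>x. C * cmod (f (of_real x))) \<longlongrightarrow> C * cmod 0) (at_right 0)"
    by (intro tendsto_intros f_tendsto_0)
  then have 1: "\<forall>\<^sub>F x in at_right 0. C * cmod (f (of_real x)) < t"
    by (rule order_tendstoD(2)) (use t in simp)
  have "((\<lambda>x. 8 * K * x / \<rho>) \<longlongrightarrow> 8 * K * 0 / \<rho>) (at_right 0)"
    by (intro tendsto_intros) (use \<rho> in auto)
  then have 2: "\<forall>\<^sub>F x in at_right 0. 8 * K * x / \<rho> < e / 2"
    by (rule order_tendstoD(2)) (use e in simp)
  show "\<forall>\<^sub>F x in at_right 0. osc x < e"
    using 1 2
  proof eventually_elim
    case (elim x)
    have "log_majorant d (C * cmod (f (of_real x))) < e / 2"
      using elim(1) C_pos by (intro t(2)) auto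
    then show ?case using elim(2) by (simp add: osc_def)
  qed
qed

text \<open>Once \<open>osc\<close> is small, halving x changes \<open>Re \<Phi>\<close> so little
  that \<open>cmod f\<close> shrinks by a fixed factor q. Geometric decay makes \<open>osc\<close>
  summable along the points x0 / 2^n, so \<Phi> converges along them, and the oscillation bound
  covers the points in between. The limit is real because \<open>Im \<Phi>\<close> is itself bounded
  by \<open>osc\<close>.\<close>

lemma radial_limit:
  obtains l :: real where "((\<lambda>x. \<Phi> (of_real x)) \<longlongrightarrow> of_real l) (at_right 0)"
    "((\<lambda>x. of_real x * deriv \<Phi> (of_real x)) \<longlongrightarrow> 0) (at_right (0::real))"
proof -
  \<comment> \<open>Below this threshold the increment \<open>12 * osc x\<close> is at most half of
    \<open>\<gamma> * ln 2\<close>, the amount by which \<open>\<gamma> * ln x\<close> drops under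
    halving.\<close>
  have "0 < \<gamma> * ln 2 / 24" using \<gamma> by simp
  then have "\<forall>\<^sub>F x in at_right 0. osc x < \<gamma> * ln 2 / 24" by (rule order_tendstoD(2)[OF osc_tendsto_0])
  then obtain x1 where x1: "x1 > 0" "\<And>x. 0 < x \<Longrightarrow> x < x1 \<Longrightarrow> osc x < \<gamma> * ln 2 / 24"
    by (auto simp: eventually_at_right_field)
  define x0 where "x0 = min (x1 / 2) (\<rho> / 2)"
  have x0: "0 < x0" "x0 \<le> \<rho> / 2" "x0 < x1" using x1 \<rho> by (auto simp: x0_def)
  define X where "X = (\<lambda>n. x0 * (1/2) ^ n)"
  have X: "0 < X n" "X n \<le> x0" "X (Suc n) = X n / 2" for n
    using x0 by (auto simp: X_def mult_le_cancel_left1 power_le_one)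
  have X\<rho>: "X n \<le> \<rho> / 2" for n using X(2)[of n] x0 by simp
  \<comment> \<open>Half of the exponent in \<open>2 powr (- \<gamma>)\<close>, the contraction of
    the pure power, is given up to the increment of \<Phi>.\<close>
  define q where "q = 2 powr (- (\<gamma> / 2))"
  have q: "0 < q" "q < 1" using \<gamma> by (auto simp: q_def powr_less_one)
  have step: "cmod (\<Phi> (of_real (X (Suc n))) - \<Phi> (of_real (X n))) \<le> 12 * osc (X n)" for n
    using X[of n] X\<rho>[of n] by (intro \<Phi>_oscillation) (auto simp: norm_divide simp flip: of_real_diff)
  have contr: "cmod (f (of_real (X (Suc n)))) \<le> q * cmod (f (of_real (X n)))" for n
  proof -
    have "Re (\<Phi> (of_real (X (Suc n)))) - Re (\<Phi> (of_real (X n))) \<le> \<gamma> * ln 2 / 2"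
      using order_trans[OF complex_Re_le_cmod step[of n]] x1(2)[of "X n"] X(1,2)[of n] x0(3)
      by simp
    then have "exp (Re (\<Phi> (of_real (X (Suc n))))) \<le> exp (\<gamma> * ln 2 / 2) * exp (Re (\<Phi> (of_real (X n))))"
      by (simp flip: exp_add)
    then have "cmod (f (of_real (X (Suc n))))
        \<le> exp (\<gamma> * ln 2 / 2) * exp (Re (\<Phi> (of_real (X n)))) * X (Suc n) powr \<gamma>"
      using X(1)[of "Suc n"] norm_f[of "of_real (X (Suc n))"] by (simp add: mult_right_mono)
    also have "X (Suc n) powr \<gamma> = exp (- (\<gamma> * ln 2)) * X n powr \<gamma>"
      using X(1)[of n] by (simp add: X(3) powr_def ln_div algebra_simps flip: exp_add)
    also have "exp (\<gamma> * ln 2 / 2) * exp (Re (\<Phi> (of_real (X n)))) * (exp (- (\<gamma> * ln 2)) * X n powr \<gamma>)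
        = (exp (\<gamma> * ln 2 / 2) * exp (- (\<gamma> * ln 2))) * (exp (Re (\<Phi> (of_real (X n)))) * X n powr \<gamma>)"
      by (simp only: mult_ac)
    also have "exp (\<gamma> * ln 2 / 2) * exp (- (\<gamma> * ln 2)) = q"
      by (simp add: q_def powr_def flip: exp_add)
    also have "exp (Re (\<Phi> (of_real (X n)))) * X n powr \<gamma> = cmod (f (of_real (X n)))"
      using X(1)[of n] norm_f[of "of_real (X n)"] by simp
    finally show ?thesis .
  qed
  have geo: "cmod (f (of_real (X n))) \<le> cmod (f (of_real (X 0))) * q ^ n" for n
  proof (induction n)
    case (Suc n)
    have "q * cmod (f (of_real (X n))) \<le> q * (cmod (f (of_real (X 0))) * q ^ n)"
      using Suc q by (intro mult_left_mono) auto
    with contr[of n] show ?case by (simp add: mult_ac)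
  qed simp
  have sum_osc: "summable (\<lambda>n. 12 * osc (X n))"
  proof (rule summable_mult, rule summable_comparison_test')
    have "summable (\<lambda>n. log_majorant d ((C * cmod (f (of_real (X 0)))) * q ^ n))"
      using C_pos q by (intro summable_log_majorant_geometric[OF d0 sd]) auto
    moreover have "summable (\<lambda>n. (8 * K * x0 / \<rho>) * (1/2::real) ^ n)"
      by (intro summable_mult summable_geometric) auto
    ultimately show "summable (\<lambda>n. log_majorant d ((C * cmod (f (of_real (X 0)))) * q ^ n)
        + (8 * K * x0 / \<rho>) * (1/2) ^ n)" by (rule summable_add)
    fix n :: nat
    have "log_majorant d (C * cmod (f (of_real (X n)))) \<le> log_majorant d (C * (cmod (f (of_real (X 0))) * q ^ n))"
      using C_pos geo[of n] by (intro log_majorant_mono[OF d0 sd] mult_left_mono) auto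
    then show "norm (osc (X n)) \<le> log_majorant d ((C * cmod (f (of_real (X 0)))) * q ^ n)
        + (8 * K * x0 / \<rho>) * (1/2) ^ n"
      using osc_pos[OF X(1)[of n]] by (simp add: osc_def X_def mult_ac)
  qed
  have "summable (\<lambda>n. \<Phi> (of_real (X (Suc n))) - \<Phi> (of_real (X n)))"
    by (rule summable_comparison_test'[OF sum_osc]) (rule step)
  then have "convergent (\<lambda>n. \<Sum>i<n. \<Phi> (of_real (X (Suc i))) - \<Phi> (of_real (X i)))"
    by (simp add: summable_iff_convergent)
  then obtain L where "(\<lambda>n. \<Phi> (of_real (X n)) - \<Phi> (of_real (X 0))) \<longlonglongrightarrow> L"
    unfolding convergent_def sum_lessThan_telescope[of "\<lambda>n. \<Phi> (of_real (X n))"] by auto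
  then have "(\<lambda>n. \<Phi> (of_real (X n)) - \<Phi> (of_real (X 0)) + \<Phi> (of_real (X 0))) \<longlonglongrightarrow> L + \<Phi> (of_real (X 0))"
    by (intro tendsto_intros)
  then obtain l' where lim: "(\<lambda>n. \<Phi> (of_real (X n))) \<longlonglongrightarrow> l'" by auto
  have osc0: "(\<lambda>n. 12 * osc (X n)) \<longlonglongrightarrow> 0" by (rule summable_LIMSEQ_zero[OF sum_osc])
  have "(\<lambda>n. Im (\<Phi> (of_real (X n)))) \<longlonglongrightarrow> 0"
  proof (rule Lim_null_comparison[OF _ osc0])
    show "\<forall>\<^sub>F n in sequentially. norm (Im (\<Phi> (of_real (X n)))) \<le> 12 * osc (X n)"
    proof (rule always_eventually, rule allI)
      fix n show "norm (Im (\<Phi> (of_real (X n)))) \<le> 12 * osc (X n)"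
        using Im_\<Phi>_le_osc[of "X n" "of_real (X n)"] X(1)[of n] X\<rho>[of n] osc_pos[OF X(1)[of n]] by simp
    qed
  qed
  moreover have "(\<lambda>n. Im (\<Phi> (of_real (X n)))) \<longlonglongrightarrow> Im l'" by (intro tendsto_intros lim)
  ultimately have "Im l' = 0" using LIMSEQ_unique by blast
  then have l': "l' = of_real (Re l')" by (simp add: complex_eq_iff)
  have "((\<lambda>x. \<Phi> (of_real x)) \<longlongrightarrow> l') (at_right 0)"
  proof (rule tendstoI)
    fix e :: real assume e: "0 < e"
    have "\<forall>\<^sub>F n in sequentially. 12 * osc (X n) < e / 2"
      by (rule order_tendstoD(2)[OF osc0]) (use e in simp)
    moreover have "\<forall>\<^sub>F n in sequentially. dist (\<Phi> (of_real (X n))) l' < e / 2"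
      by (rule tendstoD[OF lim]) (use e in simp)
    ultimately have "\<forall>\<^sub>F n in sequentially. 12 * osc (X n) < e / 2 \<and> dist (\<Phi> (of_real (X n))) l' < e / 2"
      by (rule eventually_conj)
    then obtain N where N: "\<And>n. n \<ge> N \<Longrightarrow> 12 * osc (X n) < e / 2 \<and> dist (\<Phi> (of_real (X n))) l' < e / 2"
      by (auto simp: eventually_sequentially)
    show "\<forall>\<^sub>F x in at_right 0. dist (\<Phi> (of_real x)) l' < e"
      unfolding eventually_at_right_field
    proof (intro exI[of _ "X N"] conjI X allI impI)
      fix x assume x: "0 < x" "x < X N"
      have XN: "X N \<le> x0" by (rule X)
      obtain m where m: "(1/2) ^ (m + 1) < x / x0" "x / x0 \<le> (1/2) ^ m"
        using dyadic_shell[of "x / x0"] x x0 XN by auto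
      have xm: "X (Suc m) < x" "x \<le> X m" using m x0 by (auto simp: X_def field_simps)
      have "N \<le> m"
      proof (rule ccontr)
        assume "\<not> N \<le> m"
        then have "X N \<le> X (Suc m)" unfolding X_def using x0 by (intro mult_left_mono power_decreasing) auto
        then show False using x xm by simp
      qed
      have "\<bar>x - X m\<bar> \<le> X m / 2" using xm X(3)[of m] by simp
      then have "cmod (complex_of_real x - of_real (X m)) \<le> X m / 2" by (simp flip: of_real_diff)
      then have "dist (\<Phi> (of_real x)) (\<Phi> (of_real (X m))) \<le> 12 * osc (X m)"
        unfolding dist_norm using X(1)[of m] X\<rho>[of m] by (intro \<Phi>_oscillation)
      then show "dist (\<Phi> (of_real x)) l' < e"
        using N[OF \<open>N \<le> m\<close>] dist_triangle[of "\<Phi> (of_real x)" l' "\<Phi> (of_real (X m))"] by linarith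
    qed
  qed
  moreover have "((\<lambda>x. of_real x * deriv \<Phi> (of_real x)) \<longlongrightarrow> 0) (at_right (0::real))"
  proof (rule Lim_null_comparison)
    have "((\<lambda>x. 16 * osc x) \<longlongrightarrow> 16 * 0) (at_right 0)" by (intro tendsto_intros osc_tendsto_0)
    then show "((\<lambda>x. 16 * osc x) \<longlongrightarrow> 0) (at_right 0)" by simp
    show "\<forall>\<^sub>F x in at_right 0. cmod (of_real x * deriv \<Phi> (of_real x)) \<le> 16 * osc x"
      unfolding eventually_at_right_field
      using \<Phi>_deriv_bound \<rho> by (intro exI[of _ "\<rho> / 2"]) auto
  qed
  ultimately show thesis using that[of "Re l'"] l' by simp
qed

end

subsection \<open>Arguments along Dini-smooth arcs\<close>

text \<open>Summation by parts. It converts the dyadic values \<eta> of a Dini modulus into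
  increments whose tail sums telescope back to \<eta>.\<close>

lemma summable_weighted_differences:
  fixes \<eta> :: "nat \<Rightarrow> real"
  assumes dec: "\<And>k. \<eta> (Suc k) \<le> \<eta> k" and nn: "\<And>k. 0 \<le> \<eta> k" and sm: "summable \<eta>"
  shows "summable (\<lambda>k. real (k + 1) * (\<eta> k - \<eta> (Suc k)))"
    and "(\<Sum>k. \<eta> (k + m) - \<eta> (Suc (k + m))) = \<eta> m"
proof -
  have part: "(\<Sum>k<N. real (k + 1) * (\<eta> k - \<eta> (Suc k))) = (\<Sum>k<N. \<eta> k) - real N * \<eta> N" for N
    by (induction N) (simp_all add: algebra_simps)
  show "summable (\<lambda>k. real (k + 1) * (\<eta> k - \<eta> (Suc k)))"
  proof (rule summableI_nonneg_bounded)
    show "0 \<le> real (k + 1) * (\<eta> k - \<eta> (Suc k))" for k using dec[of k] by simp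
    show "(\<Sum>k<N. real (k + 1) * (\<eta> k - \<eta> (Suc k))) \<le> suminf \<eta>" for N
    proof -
      have "(\<Sum>k<N. \<eta> k) \<le> suminf \<eta>" by (intro sum_le_suminf sm) (auto simp: nn)
      moreover have "0 \<le> real N * \<eta> N" using nn by simp
      ultimately show ?thesis unfolding part by linarith
    qed
  qed
  have "(\<lambda>k. \<eta> (k + m)) \<longlonglongrightarrow> 0"
    by (rule LIMSEQ_ignore_initial_segment[OF summable_LIMSEQ_zero[OF sm]])
  from telescope_sums'[OF this] show "(\<Sum>k. \<eta> (k + m) - \<eta> (Suc (k + m))) = \<eta> m"
    by (simp add: sums_iff)
qed

text \<open>Continuity on a compact interval bounds the differences, so that the \<open>Sup\<close>
  in \<open>modulus_of_continuity\<close> is a genuine supremum.\<close>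

lemma modulus_of_continuity_facts:
  assumes "continuous_on {0..1} g"
  shows "x \<in> {0..1} \<Longrightarrow> y \<in> {0..1} \<Longrightarrow> \<bar>x - y\<bar> \<le> s \<Longrightarrow> cmod (g x - g y) \<le> modulus_of_continuity g s"
    and "0 \<le> s \<Longrightarrow> s \<le> t \<Longrightarrow> modulus_of_continuity g s \<le> modulus_of_continuity g t"
    and "0 \<le> s \<Longrightarrow> 0 \<le> modulus_of_continuity g s"
proof -
  obtain B where "\<forall>y\<in>g ` {0..1}. cmod y \<le> B"
    using compact_imp_bounded[OF compact_continuous_image[OF assms compact_Icc]]
    unfolding bounded_iff by blast
  then have B: "cmod (g x) \<le> B" if "x \<in> {0..1}" for x using that by simp
  have bdd: "bdd_above {cmod (g x - g y) | x y. x \<in> {0..1} \<and> y \<in> {0..1} \<and> \<bar>x - y\<bar> \<le> s}" for s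
  proof (rule bdd_aboveI[where M="B + B"])
    fix r assume "r \<in> {cmod (g x - g y) | x y. x \<in> {0..1} \<and> y \<in> {0..1} \<and> \<bar>x - y\<bar> \<le> s}"
    then obtain x y where "r = cmod (g x - g y)" "x \<in> {0..1}" "y \<in> {0..1}" by blast
    then show "r \<le> B + B" using norm_triangle_ineq4[of "g x" "g y"] B[of x] B[of y] by linarith
  qed
  show le: "cmod (g x - g y) \<le> modulus_of_continuity g s"
    if "x \<in> {0..1}" "y \<in> {0..1}" "\<bar>x - y\<bar> \<le> s" for x y s
    unfolding modulus_of_continuity_def by (rule cSup_upper[OF _ bdd]) (use that in blast)
  show "0 \<le> modulus_of_continuity g s" if "0 \<le> s" for s
    using le[of 0 0 s] that by simp
  show "modulus_of_continuity g s \<le> modulus_of_continuity g t" if "0 \<le> s" "s \<le> t" for s t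
    unfolding modulus_of_continuity_def
  proof (rule cSup_subset_mono[OF _ bdd])
    have "cmod (g 0 - g 0) \<in> {cmod (g x - g y) | x y. x \<in> {0..1} \<and> y \<in> {0..1} \<and> \<bar>x - y\<bar> \<le> s}"
      using that by (intro CollectI exI[of _ 0]) auto
    then show "{cmod (g x - g y) | x y. x \<in> {0..1} \<and> y \<in> {0..1} \<and> \<bar>x - y\<bar> \<le> s} \<noteq> {}" by blast
  qed (use that in force)
qed

text \<open>On the shell between \<open>a (Suc k)\<close> and \<open>a k\<close>, whose length is
  half of \<open>a k\<close>, the integrand is at least \<open>\<omega> (a (Suc k)) / a k\<close>.
  The shell therefore contributes at least half of \<open>\<omega> (a (Suc k))\<close> to the
  integral.\<close>

lemma Dini_dyadic_summable:
  fixes \<omega> :: "real \<Rightarrow> real"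
  assumes mono: "\<And>s t. 0 \<le> s \<Longrightarrow> s \<le> t \<Longrightarrow> \<omega> s \<le> \<omega> t" and nn: "\<And>s. 0 \<le> s \<Longrightarrow> 0 \<le> \<omega> s"
    and \<delta>: "0 < \<delta>" and int: "set_integrable lborel {0<..\<delta>} (\<lambda>s. \<omega> s / s)" and M: "0 \<le> M"
  shows "summable (\<lambda>k. \<omega> (M * (1/2) ^ k))"
proof -
  define a where "a = (\<lambda>k::nat. \<delta> * (1/2) ^ k)"
  have a: "0 < a k" "a (Suc k) = a k / 2" "a k \<le> \<delta>" for k
    using \<delta> by (auto simp: a_def mult_le_cancel_left1 power_le_one)
  have anti: "a j \<le> a i" if "i \<le> j" for i j
    unfolding a_def using that \<delta> by (intro mult_left_mono power_decreasing) auto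
  define T where "T = integral\<^sup>L lborel (\<lambda>s. indicator {0<..\<delta>} s *\<^sub>R (\<omega> s / s))"
  have "summable (\<lambda>k. \<omega> (a (Suc k)))"
  proof (rule summableI_nonneg_bounded)
    show "0 \<le> \<omega> (a (Suc k))" for k using nn a(1)[of "Suc k"] by simp
    fix N
    define L where "L = (\<lambda>s. \<Sum>k<N. indicator {a (Suc k)<..a k} s *\<^sub>R (\<omega> (a (Suc k)) / a k))"
    have iL: "integrable lborel L" unfolding L_def
      by (intro Bochner_Integration.integrable_sum integrable_scaleR_left)
         (use anti in \<open>auto simp: integrable_indicator_iff emeasure_lborel_Ioc\<close>)
    have "integral\<^sup>L lborel L = (\<Sum>k<N. (a k - a (Suc k)) * (\<omega> (a (Suc k)) / a k))"
      unfolding L_def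
    proof (subst Bochner_Integration.integral_sum)
      show "integrable lborel (\<lambda>s. indicator {a (Suc k)<..a k} s *\<^sub>R (\<omega> (a (Suc k)) / a k))" for k
        by (intro integrable_scaleR_left)
         (use anti in \<open>auto simp: integrable_indicator_iff emeasure_lborel_Ioc\<close>)
      show "(\<Sum>k<N. \<integral>s. indicator {a (Suc k)<..a k} s *\<^sub>R (\<omega> (a (Suc k)) / a k) \<partial>lborel)
          = (\<Sum>k<N. (a k - a (Suc k)) * (\<omega> (a (Suc k)) / a k))"
        using anti[of k "Suc k" for k] by (intro sum.cong refl) (simp add: measure_lborel_Ioc)
    qed
    also have "\<dots> = (\<Sum>k<N. \<omega> (a (Suc k)) / 2)"
    proof (intro sum.cong refl)
      fix k show "(a k - a (Suc k)) * (\<omega> (a (Suc k)) / a k) = \<omega> (a (Suc k)) / 2"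
        using a(1)[of k] by (simp add: a(2))
    qed
    finally have LI: "integral\<^sup>L lborel L = (\<Sum>k<N. \<omega> (a (Suc k))) / 2" by (simp add: sum_divide_distrib)
    have "L s \<le> indicator {0<..\<delta>} s *\<^sub>R (\<omega> s / s)" for s
    proof (cases "\<exists>k<N. s \<in> {a (Suc k)<..a k}")
      case True
      then obtain k where k: "k < N" "a (Suc k) < s" "s \<le> a k" by auto
      have "s \<notin> {a (Suc i)<..a i}" if "i \<noteq> k" for i
        using anti[of "Suc i" k] anti[of "Suc k" i] k that by (cases "i < k") auto
      then have "L s = (\<Sum>i<N. if i = k then \<omega> (a (Suc k)) / a k else 0)"
        unfolding L_def using k by (intro sum.cong refl) auto
      also have "\<dots> = \<omega> (a (Suc k)) / a k" using k by simp
      also have "\<dots> \<le> \<omega> s / s"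
        using k a(1)[of k] a(1)[of "Suc k"] nn[of "a (Suc k)"] by (intro frac_le nn mono) auto
      also have "\<dots> = indicator {0<..\<delta>} s *\<^sub>R (\<omega> s / s)"
        using k a(1)[of "Suc k"] a(3)[of k] by auto
      finally show ?thesis .
    next
      case False
      then have "L s = 0" unfolding L_def by (intro sum.neutral) auto
      moreover have "0 \<le> indicator {0<..\<delta>} s *\<^sub>R (\<omega> s / s)" by (auto simp: indicator_def nn)
      ultimately show ?thesis by simp
    qed
    then have "integral\<^sup>L lborel L \<le> T" unfolding T_def
      by (intro integral_mono iL) (use int in \<open>auto simp: set_integrable_def\<close>)
    then show "(\<Sum>k<N. \<omega> (a (Suc k))) \<le> 2 * T" using LI by simp
  qed
  \<comment> \<open>A shift by j scales absorbs the factor M; finitely many terms do not affect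
    summability.\<close>
  obtain j where j: "M * (1/2) ^ j \<le> \<delta> / 2"
  proof -
    have "(\<lambda>j. M * (1/2) ^ j) \<longlonglongrightarrow> M * 0" by (intro tendsto_intros LIMSEQ_power_zero) auto
    then have "\<forall>\<^sub>F j in sequentially. M * (1/2) ^ j < \<delta> / 2"
      by (rule order_tendstoD(2)) (use \<delta> in simp)
    then show thesis using that eventually_happens[of _ sequentially] by (auto intro: less_imp_le)
  qed
  have "summable (\<lambda>k. \<omega> (M * (1/2) ^ (k + j)))"
  proof (rule summable_comparison_test'[OF \<open>summable (\<lambda>k. \<omega> (a (Suc k)))\<close>])
    fix k :: nat
    have "M * (1/2) ^ (k + j) = M * (1/2) ^ j * (1/2) ^ k" by (simp add: power_add)
    also have "\<dots> \<le> \<delta> / 2 * (1/2) ^ k" using j by (intro mult_right_mono) auto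
    finally have le: "M * (1/2) ^ (k + j) \<le> a (Suc k)" by (simp add: a_def)
    then show "norm (\<omega> (M * (1/2) ^ (k + j))) \<le> \<omega> (a (Suc k))"
      using M nn[of "M * (1/2) ^ (k + j)"] mono[OF _ le] by simp
  qed
  then show ?thesis by (rule summable_iff_shift[THEN iffD1])
qed

text \<open>Dividing \<zeta> by s gives a vector within e of u; passing to unit vectors adds at most
  the difference of the two lengths, again at most e.\<close>

lemma unit_vector_diff_le:
  fixes \<zeta> u :: complex
  assumes "u \<noteq> 0" "\<zeta> \<noteq> 0" "0 < s" "cmod (\<zeta> - of_real s * u) \<le> s * e"
  shows "cmod (\<zeta> / of_real (cmod \<zeta>) - u / of_real (cmod u)) \<le> 2 * e / cmod u"
proof -
  define z where "z = \<zeta> / of_real s"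
  have z0: "z \<noteq> 0" using assms by (simp add: z_def)
  have "\<zeta> - of_real s * u = of_real s * (z - u)" using assms by (simp add: z_def algebra_simps)
  then have ze: "cmod (z - u) \<le> e" using assms(3,4) by (simp add: norm_mult)
  have \<zeta>z: "\<zeta> / of_real (cmod \<zeta>) = z / of_real (cmod z)" using assms by (simp add: z_def norm_divide)
  have "z / of_real (cmod z) - u / of_real (cmod u)
      = ((z - u) + z / of_real (cmod z) * of_real (cmod u - cmod z)) / of_real (cmod u)"
    using z0 assms(1) by (simp add: field_simps)
  then have "cmod (\<zeta> / of_real (cmod \<zeta>) - u / of_real (cmod u))
      = cmod ((z - u) + z / of_real (cmod z) * of_real (cmod u - cmod z)) / cmod u"
    unfolding \<zeta>z by (simp only: norm_divide norm_of_real abs_norm_cancel)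
  also have "\<dots> \<le> 2 * e / cmod u"
  proof (rule divide_right_mono)
    have "cmod (z / of_real (cmod z) * of_real (cmod u - cmod z)) = \<bar>cmod u - cmod z\<bar>"
      using z0 by (simp only: norm_mult norm_divide norm_of_real abs_norm_cancel) simp
    then show "cmod ((z - u) + z / of_real (cmod z) * of_real (cmod u - cmod z)) \<le> 2 * e"
      using norm_triangle_ineq[of "z - u" "z / of_real (cmod z) * of_real (cmod u - cmod z)"]
        norm_triangle_ineq3[of z u] ze by linarith
  qed simp
  finally show ?thesis .
qed

text \<open>Turns a distance between unit vectors into a difference of arguments, provided the
  arguments are known to be close. It rests on sin x / x tending to 1.\<close>

lemma abs_le_exp_i_minus_one:
  obtains r :: real where "0 < r" "\<And>x. \<bar>x\<bar> < r \<Longrightarrow> \<bar>x\<bar> \<le> 2 * cmod (exp (\<i> * of_real x) - 1)"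
proof -
  have "(sin has_field_derivative cos 0) (at (0::real))" by (rule DERIV_sin)
  then have "((\<lambda>x. sin x / x) \<longlongrightarrow> 1) (at (0::real))" by (simp add: has_field_derivative_iff)
  then have "\<forall>\<^sub>F x in at (0::real). 1/2 < sin x / x" by (rule order_tendstoD(1)) simp
  then obtain r where r: "0 < r" "\<And>x::real. x \<noteq> 0 \<Longrightarrow> \<bar>x\<bar> < r \<Longrightarrow> 1/2 < sin x / x"
    by (auto simp: eventually_at dist_real_def)
  show thesis
  proof (rule that[OF r(1)])
    fix x :: real assume x: "\<bar>x\<bar> < r"
    have "\<bar>x\<bar> \<le> 2 * \<bar>sin x\<bar>"
    proof (cases "x = 0")
      case False
      then have "1/2 < \<bar>sin x / x\<bar>" using r(2)[OF False x] by linarith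
      then show ?thesis using False by (simp add: abs_divide pos_less_divide_eq)
    qed simp
    also have "\<bar>sin x\<bar> \<le> cmod (exp (\<i> * of_real x) - 1)"
      using abs_Im_le_cmod[of "exp (\<i> * of_real x) - 1"] by (simp add: Im_exp)
    finally show "\<bar>x\<bar> \<le> 2 * cmod (exp (\<i> * of_real x) - 1)" by simp
  qed
qed

text \<open>By compactness and injectivity, parameters away from 0 stay at a positive distance from
  the starting point.\<close>

lemma arc_param_small:
  assumes c: "arc c" and \<epsilon>: "0 < \<epsilon>"
  obtains r where "0 < r" "\<And>s. s \<in> {0..1} \<Longrightarrow> cmod (c s - c 0) < r \<Longrightarrow> s < \<epsilon>"
proof (cases "\<epsilon> \<le> 1")
  case True
  have cont: "continuous_on {\<epsilon>..1} (\<lambda>s. cmod (c s - c 0))"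
    using c \<epsilon> by (intro continuous_intros) (auto simp: arc_def path_def intro: continuous_on_subset)
  obtain m where m: "m \<in> {\<epsilon>..1}" "\<And>s. s \<in> {\<epsilon>..1} \<Longrightarrow> cmod (c m - c 0) \<le> cmod (c s - c 0)"
    using continuous_attains_inf[OF compact_Icc _ cont] True by auto
  have "c m \<noteq> c 0"
    using c m \<epsilon> inj_onD[of c "{0..1}" m 0] by (auto simp: arc_def)
  then have "0 < cmod (c m - c 0)" by simp
  then show thesis using m(2) by (intro that[of "cmod (c m - c 0)"]) (force simp: not_less[symmetric])+
next
  case False
  then show thesis by (intro that[of 1]) auto
qed

text \<open>Let u = - c' 0. A point 1 - \<zeta> = c s near the corner satisfies \<zeta> = s u up to
  an error s \<omega>(s), and s is at most M times the modulus of \<zeta>. So the direction of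
  \<zeta> deviates from that of u by at most a multiple of \<omega> at M times that modulus, in
  whatever way s depends on t.\<close>

lemma dini_smooth_arc_arg:
  fixes \<zeta> :: "real \<Rightarrow> complex"
  assumes c: "dini_smooth_arc c" and p: "pathstart c = 1" and F: "F \<noteq> bot"
    and on: "\<forall>\<^sub>F t in F. \<zeta> t \<noteq> 0 \<and> 1 - \<zeta> t \<in> path_image c"
    and lim: "(\<zeta> \<longlongrightarrow> 0) F" and arg: "((\<lambda>t. Im (Ln (\<zeta> t))) \<longlongrightarrow> \<beta>) F"
  obtains \<eta> :: "nat \<Rightarrow> real" where "\<And>k. \<eta> (Suc k) \<le> \<eta> k" "\<And>k. 0 \<le> \<eta> k" "summable \<eta>"
    "\<forall>\<^sub>F t in F. \<forall>m. cmod (\<zeta> t) \<le> (1/2) ^ m \<longrightarrow> \<bar>Im (Ln (\<zeta> t)) - \<beta>\<bar> \<le> \<eta> m"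
proof -
  from c obtain c' \<delta> where arc: "arc c"
    and der: "\<And>t. t \<in> {0..1} \<Longrightarrow> (c has_vector_derivative c' t) (at t within {0..1}) \<and> c' t \<noteq> 0"
    and cont: "continuous_on {0..1} c'" and \<delta>: "0 < \<delta>"
    and int: "set_integrable lborel {0<..\<delta>} (\<lambda>s. modulus_of_continuity c' s / s)"
    unfolding dini_smooth_arc_def by blast
  define \<omega> where "\<omega> = modulus_of_continuity c'"
  note \<omega> = modulus_of_continuity_facts[OF cont, folded \<omega>_def]
  define u where "u = - c' 0"
  have u: "u \<noteq> 0" using der[of 0] by (simp add: u_def)
  have c0: "c 0 = 1" using p by (simp add: pathstart_def)
  have lin: "cmod (1 - c s - of_real s * u) \<le> s * \<omega> s" if s: "0 < s" "s \<le> 1" for s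
  proof -
    have "cmod (c s - c 0 - (s - 0) *\<^sub>R c' 0) \<le> norm (s - 0) * \<omega> s"
    proof (rule vector_differentiable_bound_linearization)
      fix x assume x: "x \<in> {0..s}"
      then show "(c has_vector_derivative c' x) (at x within {0..s})"
        using der[of x] s by (auto intro: has_vector_derivative_within_subset)
      show "cmod (c' x - c' 0) \<le> \<omega> s" using x s by (intro \<omega>(1)) auto
    qed (use s in \<open>auto simp: closed_segment_eq_real_ivl\<close>)
    also have "c s - c 0 - (s - 0) *\<^sub>R c' 0 = - (1 - c s - of_real s * u)"
      by (simp add: c0 u_def scaleR_conv_of_real)
    finally show ?thesis using s by (simp only: norm_minus_cancel) simp
  qed
  define M where "M = 2 / cmod u"
  have M: "0 < M" using u by (simp add: M_def)
  define \<theta> where "\<theta> = (\<lambda>k. \<omega> (M * (1/2) ^ k))"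
  have \<theta>: "\<theta> (Suc k) \<le> \<theta> k" "0 \<le> \<theta> k" for k
    unfolding \<theta>_def using M by (auto intro!: \<omega>(2,3) mult_left_mono)
  have s\<theta>: "summable \<theta>" unfolding \<theta>_def
    by (rule Dini_dyadic_summable[OF \<omega>(2) \<omega>(3) \<delta>]) (use int M in \<open>auto simp: \<omega>_def\<close>)
  have small: "\<exists>r>0. \<forall>s. 0 \<le> s \<longrightarrow> s < r \<longrightarrow> \<omega> s < e" if e: "0 < e" for e
  proof -
    obtain k where "\<theta> k < e"
      using order_tendstoD(2)[OF summable_LIMSEQ_zero[OF s\<theta>] e] eventually_happens[of _ sequentially] by auto
    then have "\<omega> s < e" if "0 \<le> s" "s < M * (1/2) ^ k" for s
      using \<omega>(2)[of s "M * (1/2) ^ k"] that by (simp add: \<theta>_def)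
    then show ?thesis using M by (intro exI[of _ "M * (1/2) ^ k"]) simp
  qed
  obtain r1 where r1: "0 < r1" "\<And>s. 0 \<le> s \<Longrightarrow> s < r1 \<Longrightarrow> \<omega> s < cmod u / 2"
    using small[of "cmod u / 2"] u by auto
  obtain r2 where r2: "0 < r2" "\<And>s. s \<in> {0..1} \<Longrightarrow> cmod (c s - c 0) < r2 \<Longrightarrow> s < r1"
    using arc_param_small[OF arc r1(1)] by metis
  have dir: "cmod (\<zeta> t / of_real (cmod (\<zeta> t)) - u / of_real (cmod u)) \<le> M * \<omega> (M * cmod (\<zeta> t))"
    if t: "\<zeta> t \<noteq> 0" "1 - \<zeta> t \<in> path_image c" "cmod (\<zeta> t) < r2" for t
  proof -
    obtain s where s: "s \<in> {0..1}" "1 - \<zeta> t = c s" using t(2) by (auto simp: path_image_def)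
    then have \<zeta>: "\<zeta> t = 1 - c s" by (simp add: algebra_simps)
    have s0: "0 < s" using s t(1) c0 \<zeta> by (cases "s = 0") auto
    have "s < r1" using r2(2)[OF s(1)] t(3) by (simp add: c0 \<zeta> norm_minus_commute)
    then have \<omega>s: "\<omega> s < cmod u / 2" using s0 by (intro r1(2)) auto
    have l: "cmod (\<zeta> t - of_real s * u) \<le> s * \<omega> s" using lin[OF s0] s by (simp add: \<zeta>)
    also have "\<dots> \<le> s * (cmod u / 2)" using \<omega>s s0 by simp
    finally have "s * cmod u \<le> cmod (\<zeta> t) + s * (cmod u / 2)"
      using norm_triangle_ineq2[of "of_real s * u" "\<zeta> t"] s0 by (simp add: norm_mult norm_minus_commute)
    then have sM: "s \<le> M * cmod (\<zeta> t)" using u by (simp add: M_def field_simps)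
    have "cmod (\<zeta> t / of_real (cmod (\<zeta> t)) - u / of_real (cmod u)) \<le> 2 * \<omega> s / cmod u"
      by (rule unit_vector_diff_le[OF u t(1) s0 l])
    also have "\<dots> \<le> 2 * \<omega> (M * cmod (\<zeta> t)) / cmod u"
      using \<omega>(2)[OF _ sM] s0 by (intro divide_right_mono) auto
    finally show ?thesis by (simp add: M_def)
  qed
  have expIm: "exp (\<i> * of_real (Im (Ln z))) = z / of_real (cmod z)" if "z \<noteq> 0" for z
  proof -
    have "Ln z = of_real (ln (cmod z)) + \<i> * of_real (Im (Ln z))"
      using that by (simp add: complex_eq_iff)
    then have "z = exp (of_real (ln (cmod z))) * exp (\<i> * of_real (Im (Ln z)))"
      using that exp_Ln[of z] by (metis exp_add)
    moreover have "exp (complex_of_real (ln (cmod z))) = of_real (cmod z)"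
      using that by (simp add: exp_of_real)
    ultimately show ?thesis using that by (metis nonzero_mult_div_cancel_left norm_eq_zero of_real_eq_0_iff)
  qed
  have near: "\<forall>\<^sub>F t in F. cmod (\<zeta> t) < r" if "0 < r" for r
    using order_tendstoD(2)[OF tendsto_norm_zero[OF lim] that] .
  have dir_ev: "\<forall>\<^sub>F t in F. cmod (exp (\<i> * of_real (Im (Ln (\<zeta> t)))) - u / of_real (cmod u)) \<le> M * \<omega> (M * cmod (\<zeta> t))"
    using on near[OF r2(1)] by eventually_elim (use dir expIm in auto)
  \<comment> \<open>Uniqueness of limits identifies the tangent direction of the arc with the
    assumed limit \<beta> of the argument.\<close>
  have u\<beta>: "u / of_real (cmod u) = exp (\<i> * of_real \<beta>)"
  proof (rule tendsto_unique[OF F])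
    show "((\<lambda>t. exp (\<i> * of_real (Im (Ln (\<zeta> t))))) \<longlongrightarrow> exp (\<i> * of_real \<beta>)) F"
      by (intro tendsto_intros arg)
    show "((\<lambda>t. exp (\<i> * of_real (Im (Ln (\<zeta> t))))) \<longlongrightarrow> u / of_real (cmod u)) F"
    proof (rule tendstoI)
      fix e :: real assume e: "0 < e"
      obtain r where r: "0 < r" "\<And>s. 0 \<le> s \<Longrightarrow> s < r \<Longrightarrow> \<omega> s < e / M"
        using small[of "e / M"] e M by auto
      have "\<forall>\<^sub>F t in F. cmod (\<zeta> t) < r / M" using r M by (intro near) auto
      with dir_ev show "\<forall>\<^sub>F t in F. dist (exp (\<i> * of_real (Im (Ln (\<zeta> t))))) (u / of_real (cmod u)) < e"
      proof eventually_elim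
        case (elim t)
        have "\<omega> (M * cmod (\<zeta> t)) < e / M" using elim(2) M by (intro r(2)) (auto simp: field_simps)
        then have "M * \<omega> (M * cmod (\<zeta> t)) < e" using M by (simp add: field_simps)
        with elim(1) show ?case by (simp add: dist_norm)
      qed
    qed
  qed
  \<comment> \<open>The argument eventually lies within r of \<beta>, which excludes a discrepancy
    by a multiple of 2 pi.\<close>
  obtain r where r: "0 < r" "\<And>x. \<bar>x\<bar> < r \<Longrightarrow> \<bar>x\<bar> \<le> 2 * cmod (exp (\<i> * of_real x) - 1)"
    using abs_le_exp_i_minus_one by metis
  have "\<forall>\<^sub>F t in F. \<bar>Im (Ln (\<zeta> t)) - \<beta>\<bar> < r"
    using tendstoD[OF arg r(1)] by (simp add: dist_real_def)
  with dir_ev have "\<forall>\<^sub>F t in F. \<forall>m. cmod (\<zeta> t) \<le> (1/2) ^ m \<longrightarrow> \<bar>Im (Ln (\<zeta> t)) - \<beta>\<bar> \<le> 2 * M * \<theta> m"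
  proof eventually_elim
    case (elim t)
    show ?case
    proof (intro allI impI)
      fix m assume m: "cmod (\<zeta> t) \<le> (1/2) ^ m"
      have "exp (\<i> * of_real (Im (Ln (\<zeta> t)))) - exp (\<i> * of_real \<beta>)
          = exp (\<i> * of_real \<beta>) * (exp (\<i> * of_real (Im (Ln (\<zeta> t)) - \<beta>)) - 1)"
        by (simp add: algebra_simps flip: exp_add)
      then have "cmod (exp (\<i> * of_real (Im (Ln (\<zeta> t)) - \<beta>)) - 1)
          = cmod (exp (\<i> * of_real (Im (Ln (\<zeta> t)))) - exp (\<i> * of_real \<beta>))"
        by (simp add: norm_mult)
      also have "\<dots> \<le> M * \<omega> (M * cmod (\<zeta> t))" using elim(1) by (simp add: u\<beta>)
      also have "\<dots> \<le> M * \<theta> m"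
        unfolding \<theta>_def using m M by (intro mult_left_mono \<omega>(2)) auto
      finally show "\<bar>Im (Ln (\<zeta> t)) - \<beta>\<bar> \<le> 2 * M * \<theta> m" using r(2)[OF elim(2)] by linarith
    qed
  qed
  then show thesis using \<theta> s\<theta> M
    by (intro that[of "\<lambda>k. 2 * M * \<theta> k"] summable_mult) (auto intro!: mult_left_mono)
qed

section \<open>Transfer of the corner to the right half-plane\<close>

definition cayley :: "complex \<Rightarrow> complex" where
  "cayley w = (1 - w) / (1 + w)"

lemma cayley_in_disk: "0 < Re w \<Longrightarrow> cayley w \<in> unit_disk"
proof -
  assume w: "0 < Re w"
  have "(cmod (1 + w))\<^sup>2 - (cmod (1 - w))\<^sup>2 = 4 * Re w"
    unfolding cmod_power2 by (simp add: power2_eq_square algebra_simps)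
  then have "(cmod (1 - w))\<^sup>2 < (cmod (1 + w))\<^sup>2" using w by linarith
  then have "cmod (1 - w) < cmod (1 + w)" by (rule power2_less_imp_less) simp
  then show ?thesis by (auto simp: cayley_def norm_divide divide_less_eq)
qed

lemma one_plus_nonzero: "0 \<le> Re w \<Longrightarrow> 1 + w \<noteq> 0"
proof
  assume "0 \<le> Re w" "1 + w = 0"
  then have "Re (1 + w) = 0" by simp
  with \<open>0 \<le> Re w\<close> show False by simp
qed

text \<open>The numerator 1 - \<i> y has argument - arctan y and is divided by its conjugate.
  Orientation is reversed: the upper half of the imaginary axis goes to the lower arc.\<close>

lemma cayley_imaginary: "cayley (\<i> * of_real y) = cis (- 2 * arctan y)"
proof -
  define r where "r = sqrt (1 + y\<^sup>2)"
  have r: "r\<^sup>2 = 1 + y\<^sup>2" "r \<noteq> 0"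
    using sum_power2_ge_zero[of 1 y] by (auto simp: r_def add_nonneg_eq_0_iff)
  have "cis (- arctan y) = (1 - \<i> * of_real y) / of_real r"
    by (simp add: complex_eq_iff cos_arctan sin_arctan r_def Re_divide_of_real Im_divide_of_real)
  moreover have "cis (- 2 * arctan y) = cis (- arctan y) ^ 2" by (simp add: Complex.DeMoivre)
  ultimately have "cis (- 2 * arctan y) = (1 - \<i> * of_real y)\<^sup>2 / of_real (r\<^sup>2)"
    by (simp add: power_divide)
  also have "complex_of_real (r\<^sup>2) = (1 - \<i> * of_real y) * (1 + \<i> * of_real y)"
    unfolding r(1) by (simp add: power2_eq_square algebra_simps)
  also have "(1 - \<i> * of_real y)\<^sup>2 / ((1 - \<i> * of_real y) * (1 + \<i> * of_real y)) = cayley (\<i> * of_real y)"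
  proof -
    have "1 - \<i> * of_real y \<noteq> 0" by (auto simp: complex_eq_iff)
    then show ?thesis by (simp add: cayley_def power2_eq_square)
  qed
  finally show ?thesis by simp
qed

lemma Im_Ln_imaginary:
  "0 < y \<Longrightarrow> Im (Ln (\<i> * of_real y)) = pi / 2" "y < 0 \<Longrightarrow> Im (Ln (\<i> * of_real y)) = - (pi / 2)"
proof -
  show "Im (Ln (\<i> * of_real y)) = pi / 2" if "0 < y"
    using Ln_times_of_real[OF that, of \<i>] Ln_of_real[OF that] by (simp add: mult.commute)
  show "Im (Ln (\<i> * of_real y)) = - (pi / 2)" if "y < 0"
  proof -
    have "Ln (of_real (- y) * (- \<i>)) = Ln (of_real (- y)) + Ln (- \<i>)"
      by (rule Ln_times_of_real) (use that in auto)
    moreover have "of_real (- y) * (- \<i>) = \<i> * of_real y" by simp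
    moreover have "Ln (of_real (- y)) = of_real (ln (- y))" using that by (intro Ln_of_real) simp
    ultimately show ?thesis by (simp only: Ln_minus_ii) simp
  qed
qed

text \<open>As \<phi> maps into the disk, 1 - \<psi> takes values in the closed right half-plane,
  and the principal logarithm is a continuous branch there. Both one-sided limits of its argument
  lie in [-pi/2, pi/2] and differ by pi \<gamma> > 0; hence \<gamma> \<le> 1, and their midpoint
  \<kappa> lies strictly inside.\<close>

lemma dini_smooth_corner_half_plane:
  assumes \<phi>: "\<phi> holomorphic_on unit_disk" "\<phi> ` unit_disk \<subseteq> unit_disk"
    and corner: "dini_smooth_corner \<phi> 1 \<gamma>"
  obtains f \<kappa> \<rho> d where "dini_corner f \<gamma> \<kappa> \<rho> d" "\<And>w. 0 < Re w \<Longrightarrow> f w = 1 - \<phi> (cayley w)"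
    "\<gamma> \<le> 1" "\<bar>\<kappa>\<bar> < pi / 2"
proof -
  from corner obtain a b Ap Am \<psi> cp cm L \<beta> where
    \<gamma>: "0 < \<gamma>" and a: "0 < a" "a < pi" and Ap: "Ap = cis ` {0..a}"
    and b: "0 < b" "b < pi" and Am: "Am = cis ` {-b..0}"
    and \<psi>c: "continuous_on (unit_disk \<union> Ap \<union> Am) \<psi>"
    and \<psi>\<phi>: "\<forall>z\<in>unit_disk. \<psi> z = \<phi> z" and \<psi>1: "\<psi> 1 = 1"
    and cp: "dini_smooth_arc cp" "pathstart cp = 1" "\<psi> ` Ap = path_image cp"
    and cm: "dini_smooth_arc cm" "pathstart cm = 1" "\<psi> ` Am = path_image cm"
    and Lc: "continuous_on ((unit_disk \<union> Ap \<union> Am) - {1}) L"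
    and L: "\<forall>z\<in>(unit_disk \<union> Ap \<union> Am) - {1}. exp (L z) = \<psi> z - 1"
    and Lr: "((\<lambda>t. Im (L (cis t))) \<longlongrightarrow> \<beta>) (at_right 0)"
    and Ll: "((\<lambda>t. Im (L (cis t))) \<longlongrightarrow> \<beta> + pi * \<gamma>) (at_left 0)"
    unfolding dini_smooth_corner_def by (elim conjE exE) (rule that; assumption)
  define Y where "Y = unit_disk \<union> Ap \<union> Am"
  define X where "X = Y - {1}"
  have one: "1 \<in> Ap" "1 \<in> Am" unfolding Ap Am using a b by (auto intro!: image_eqI[of _ _ 0])
  have YD: "unit_disk \<subseteq> Y" "Y \<subseteq> cball 0 1" by (auto simp: Y_def Ap Am)
  have DX: "unit_disk \<subseteq> X" by (auto simp: X_def Y_def)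
  have \<psi>Y: "continuous_on Y \<psi>" using \<psi>c by (simp add: Y_def)
  have \<psi>le: "cmod (\<psi> z) \<le> 1" if z: "z \<in> Y" for z
  proof -
    have "(\<psi> \<longlongrightarrow> \<psi> z) (at z within Y)" using \<psi>Y z by (simp add: continuous_on_def)
    then have "(\<psi> \<longlongrightarrow> \<psi> z) (at z within unit_disk)" by (rule tendsto_within_subset[OF _ YD(1)])
    moreover have "\<forall>\<^sub>F w in at z within unit_disk. \<psi> w \<in> cball 0 1"
      unfolding eventually_at_filter using \<psi>\<phi> \<phi>(2)
      by (intro always_eventually) (force simp: image_subset_iff)
    moreover have "at z within unit_disk \<noteq> bot"
      using z YD(2) by (auto simp: trivial_limit_within islimpt_ball)
    ultimately have "\<psi> z \<in> cball 0 1" using Lim_in_closed_set[OF closed_cball] by blast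
    then show ?thesis by simp
  qed
  have \<psi>ne: "\<psi> z \<noteq> 1" if "z \<in> X" for z
    using L that exp_not_eq_zero[of "L z"] by (auto simp: X_def Y_def)
  have half: "0 \<le> Re (1 - \<psi> z)" "1 - \<psi> z \<noteq> 0" "1 - \<psi> z \<notin> \<real>\<^sub>\<le>\<^sub>0" if z: "z \<in> X" for z
  proof -
    show "0 \<le> Re (1 - \<psi> z)" using complex_Re_le_cmod[of "\<psi> z"] \<psi>le[of z] z by (simp add: X_def)
    moreover show "1 - \<psi> z \<noteq> 0" using \<psi>ne[OF z] by simp
    ultimately show "1 - \<psi> z \<notin> \<real>\<^sub>\<le>\<^sub>0" by (auto simp: complex_nonpos_Reals_iff complex_eq_iff)
  qed
  define Q where "Q = (\<lambda>z. Ln (1 - \<psi> z))"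
  have QX: "continuous_on X Q" unfolding Q_def
    by (intro continuous_intros continuous_on_subset[OF \<psi>Y] half) (auto simp: X_def)
  have conX: "connected X"
  proof (rule connected_intermediate_closure[of unit_disk])
    show "X \<subseteq> closure unit_disk" using YD(2) by (auto simp: X_def)
  qed (use DX in auto)
  \<comment> \<open>\<open>L\<close> is a logarithm of \<psi> - 1 and \<open>Q\<close> one of 1 -
    \<psi>; the sign costs \<i> pi. The difference has discrete values on a connected set, hence is
    constant, so \<open>Q\<close> measures the same opening as \<open>L\<close>.\<close>
  have diff: "\<exists>n::int. L z - Q z = of_real (of_int (2 * n) * pi) * \<i> + \<i> * of_real pi" if z: "z \<in> X" for z
  proof -
    have "exp (L z) = exp (Q z + \<i> * of_real pi)"
      using z L half(2)[OF z] by (simp add: exp_add Q_def X_def Y_def)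
    then show ?thesis unfolding exp_eq by (auto simp: algebra_simps)
  qed
  have "(\<lambda>z. L z - Q z) constant_on X"
  proof (rule continuous_discrete_range_constant[OF conX])
    show "continuous_on X (\<lambda>z. L z - Q z)" using Lc QX by (intro continuous_intros) (auto simp: X_def Y_def)
    show "\<exists>e>0. \<forall>y. y \<in> X \<and> L y - Q y \<noteq> L x - Q x \<longrightarrow> e \<le> cmod (L y - Q y - (L x - Q x))" if x: "x \<in> X" for x
    proof (intro exI[of _ "2 * pi"] conjI allI impI)
      fix y assume y: "y \<in> X \<and> L y - Q y \<noteq> L x - Q x"
      obtain n where n: "L x - Q x = of_real (of_int (2 * n) * pi) * \<i> + \<i> * of_real pi" using diff[OF x] by blast
      obtain m where m: "L y - Q y = of_real (of_int (2 * m) * pi) * \<i> + \<i> * of_real pi" using diff y by blast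
      have "m \<noteq> n" using y n m by auto
      have "L y - Q y - (L x - Q x) = of_real (2 * pi * of_int (m - n)) * \<i>"
        unfolding n m by (simp add: algebra_simps)
      then have "cmod (L y - Q y - (L x - Q x)) = 2 * pi * \<bar>of_int (m - n)\<bar>"
        by (simp only: norm_mult norm_of_real) (simp add: abs_mult)
      also have "\<dots> \<ge> 2 * pi * 1"
        using \<open>m \<noteq> n\<close> by (intro mult_left_mono) (auto simp flip: of_int_abs)
      finally show "2 * pi \<le> cmod (L y - Q y - (L x - Q x))" by simp
    qed simp
  qed
  then obtain k where k: "\<And>z. z \<in> X \<Longrightarrow> L z - Q z = k" unfolding constant_on_def by blast
  define \<beta>0 where "\<beta>0 = \<beta> - Im k"
  have cisne: "cis t \<noteq> 1" if "t \<noteq> 0" "\<bar>t\<bar> < pi" for t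
  proof
    assume "cis t = 1"
    then have "cos t = cos 0" by (metis cis.sel(1) one_complex.sel(1) cos_zero)
    moreover have "cos \<bar>t\<bar> < cos 0" using that by (intro cos_monotone_0_pi) auto
    ultimately show False by simp
  qed
  have cp_in: "cis t \<in> X" "cis t \<in> Ap" if "0 < t" "t \<le> a" for t
    using cisne[of t] a that by (auto simp: X_def Y_def Ap)
  have cm_in: "cis t \<in> X" "cis t \<in> Am" if "t < 0" "- b \<le> t" for t
    using cisne[of t] b that by (auto simp: X_def Y_def Am)
  have evr: "\<forall>\<^sub>F t in at_right 0. 0 < t \<and> t < a"
    unfolding eventually_at_right_field using a by auto
  have evl: "\<forall>\<^sub>F t in at_left 0. t < 0 \<and> - b < t"
    unfolding eventually_at_left_field using b by (intro exI[of _ "-b"]) auto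
  have Qr: "((\<lambda>t. Im (Ln (1 - \<psi> (cis t)))) \<longlongrightarrow> \<beta>0) (at_right 0)"
  proof -
    have "((\<lambda>t. Im (L (cis t)) - Im k) \<longlongrightarrow> \<beta>0) (at_right 0)"
      unfolding \<beta>0_def by (intro tendsto_intros Lr)
    then show ?thesis
    proof (rule Lim_transform_eventually)
      show "\<forall>\<^sub>F t in at_right 0. Im (L (cis t)) - Im k = Im (Ln (1 - \<psi> (cis t)))"
        using evr by eventually_elim (use k cp_in in \<open>force simp: Q_def simp flip: minus_complex.sel\<close>)
    qed
  qed
  have Ql: "((\<lambda>t. Im (Ln (1 - \<psi> (cis t)))) \<longlongrightarrow> \<beta>0 + pi * \<gamma>) (at_left 0)"
  proof -
    have "((\<lambda>t. Im (L (cis t)) - Im k) \<longlongrightarrow> \<beta> + pi * \<gamma> - Im k) (at_left 0)"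
      by (intro tendsto_intros Ll)
    then have "((\<lambda>t. Im (L (cis t)) - Im k) \<longlongrightarrow> \<beta>0 + pi * \<gamma>) (at_left 0)"
      by (simp add: \<beta>0_def algebra_simps)
    then show ?thesis
    proof (rule Lim_transform_eventually)
      show "\<forall>\<^sub>F t in at_left 0. Im (L (cis t)) - Im k = Im (Ln (1 - \<psi> (cis t)))"
        using evl by eventually_elim (use k cm_in in \<open>force simp: Q_def simp flip: minus_complex.sel\<close>)
    qed
  qed
  have Qb: "\<bar>Im (Ln (1 - \<psi> z))\<bar> \<le> pi / 2" if "z \<in> X" for z
    using half[OF that] Re_Ln_pos_le[of "1 - \<psi> z"] by simp
  have \<beta>0: "- (pi / 2) \<le> \<beta>0"
  proof (rule tendsto_lowerbound[OF Qr])
    show "\<forall>\<^sub>F t in at_right 0. - (pi / 2) \<le> Im (Ln (1 - \<psi> (cis t)))"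
      using evr by eventually_elim (use Qb cp_in in force)
  qed simp
  have \<beta>1: "\<beta>0 + pi * \<gamma> \<le> pi / 2"
  proof (rule tendsto_upperbound[OF Ql])
    show "\<forall>\<^sub>F t in at_left 0. Im (Ln (1 - \<psi> (cis t))) \<le> pi / 2"
      using evl by eventually_elim (use Qb cm_in in force)
  qed simp
  define \<zeta> where "\<zeta> = (\<lambda>t. 1 - \<psi> (cis t))"
  have lim: "(\<zeta> \<longlongrightarrow> 0) (at_right 0)" "(\<zeta> \<longlongrightarrow> 0) (at_left 0)"
  proof -
    have "((\<lambda>w. 1 - \<psi> w) \<longlongrightarrow> 1 - \<psi> 1) (at 1 within Y)"
      using \<psi>Y one by (intro tendsto_intros) (auto simp: continuous_on_def Y_def)
    then have l: "((\<lambda>w. 1 - \<psi> w) \<longlongrightarrow> 0) (at 1 within Y)" by (simp add: \<psi>1)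
    have c: "(cis \<longlongrightarrow> 1) (at (0::real) within S)" for S
    proof -
      have "((\<lambda>t. exp (\<i> * of_real t)) \<longlongrightarrow> exp (\<i> * of_real 0)) (at (0::real) within S)"
        by (intro tendsto_intros)
      then show ?thesis by (simp add: cis_conv_exp[abs_def])
    qed
    show "(\<zeta> \<longlongrightarrow> 0) (at_right 0)" unfolding \<zeta>_def
      by (rule filterlim_compose[OF l])
         (use c cp_in in \<open>auto simp: filterlim_at X_def intro!: eventually_mono[OF evr]\<close>)
    show "(\<zeta> \<longlongrightarrow> 0) (at_left 0)" unfolding \<zeta>_def
      by (rule filterlim_compose[OF l])
         (use c cm_in in \<open>auto simp: filterlim_at X_def intro!: eventually_mono[OF evl]\<close>)
  qed
  have onr: "\<forall>\<^sub>F t in at_right 0. \<zeta> t \<noteq> 0 \<and> 1 - \<zeta> t \<in> path_image cp"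
    using evr
  proof eventually_elim
    case (elim t)
    then have "cis t \<in> X" "cis t \<in> Ap" using cp_in by auto
    then show ?case using half(2) cp(3) by (auto simp: \<zeta>_def)
  qed
  have onl: "\<forall>\<^sub>F t in at_left 0. \<zeta> t \<noteq> 0 \<and> 1 - \<zeta> t \<in> path_image cm"
    using evl
  proof eventually_elim
    case (elim t)
    then have "cis t \<in> X" "cis t \<in> Am" using cm_in by auto
    then show ?case using half(2) cm(3) by (auto simp: \<zeta>_def)
  qed
  have Q\<zeta>: "((\<lambda>t. Im (Ln (\<zeta> t))) \<longlongrightarrow> \<beta>0) (at_right 0)"
    "((\<lambda>t. Im (Ln (\<zeta> t))) \<longlongrightarrow> \<beta>0 + pi * \<gamma>) (at_left 0)"
    using Qr Ql by (simp_all add: \<zeta>_def)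
  obtain \<eta>p :: "nat \<Rightarrow> real" where p: "\<And>k. \<eta>p (Suc k) \<le> \<eta>p k" "\<And>k. 0 \<le> \<eta>p k" "summable \<eta>p"
    "\<forall>\<^sub>F t in at_right 0. \<forall>m. cmod (\<zeta> t) \<le> (1/2) ^ m \<longrightarrow> \<bar>Im (Ln (\<zeta> t)) - \<beta>0\<bar> \<le> \<eta>p m"
    by (rule dini_smooth_arc_arg[OF cp(1,2) trivial_limit_at_right_real onr lim(1) Q\<zeta>(1)]) (rule that; assumption)
  obtain \<eta>m :: "nat \<Rightarrow> real" where m: "\<And>k. \<eta>m (Suc k) \<le> \<eta>m k" "\<And>k. 0 \<le> \<eta>m k" "summable \<eta>m"
    "\<forall>\<^sub>F t in at_left 0. \<forall>m. cmod (\<zeta> t) \<le> (1/2) ^ m \<longrightarrow> \<bar>Im (Ln (\<zeta> t)) - (\<beta>0 + pi * \<gamma>)\<bar> \<le> \<eta>m m"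
    by (rule dini_smooth_arc_arg[OF cm(1,2) trivial_limit_at_left_real onl lim(2) Q\<zeta>(2)]) (rule that; assumption)
  have "\<forall>\<^sub>F t in at_right 0. cmod (\<zeta> t) < 1"
    using order_tendstoD(2)[OF tendsto_norm_zero[OF lim(1)], of 1] by simp
  from eventually_conj[OF this p(4)] obtain \<tau>1 where \<tau>1: "0 < \<tau>1"
    and P: "\<And>t. 0 < t \<Longrightarrow> t < \<tau>1 \<Longrightarrow> cmod (\<zeta> t) < 1 \<and> (\<forall>m. cmod (\<zeta> t) \<le> (1/2) ^ m \<longrightarrow> \<bar>Im (Ln (\<zeta> t)) - \<beta>0\<bar> \<le> \<eta>p m)"
    unfolding eventually_at_right_field by blast
  have "\<forall>\<^sub>F t in at_left 0. cmod (\<zeta> t) < 1"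
    using order_tendstoD(2)[OF tendsto_norm_zero[OF lim(2)], of 1] by simp
  from eventually_conj[OF this m(4)] obtain \<tau>2 where \<tau>2: "\<tau>2 < 0"
    and Mi: "\<And>t. \<tau>2 < t \<Longrightarrow> t < 0 \<Longrightarrow> cmod (\<zeta> t) < 1 \<and> (\<forall>m. cmod (\<zeta> t) \<le> (1/2) ^ m \<longrightarrow> \<bar>Im (Ln (\<zeta> t)) - (\<beta>0 + pi * \<gamma>)\<bar> \<le> \<eta>m m)"
    unfolding eventually_at_left_field by blast
  \<comment> \<open>A point \<i> y with y of modulus at most \<rho> goes to \<open>cis t\<close>
    with t = -2 arctan y, whose modulus is at most 2 \<rho> and so strictly below 3 \<rho>.\<close>
  define \<rho> where "\<rho> = min (min a b) (min \<tau>1 (- \<tau>2)) / 3"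
  have \<rho>: "0 < \<rho>" "3 * \<rho> \<le> a" "3 * \<rho> \<le> b" "3 * \<rho> \<le> \<tau>1" "3 * \<rho> \<le> - \<tau>2"
    using a b \<tau>1 \<tau>2 by (auto simp: \<rho>_def)
  \<comment> \<open>One modulus serves both arcs.\<close>
  define \<eta> where "\<eta> = (\<lambda>k. \<eta>p k + \<eta>m k)"
  have \<eta>: "\<And>k. \<eta> (Suc k) \<le> \<eta> k" "\<And>k. 0 \<le> \<eta> k" "summable \<eta>"
    unfolding \<eta>_def using p m by (auto intro: add_mono summable_add)
  define d where "d = (\<lambda>k. \<eta> k - \<eta> (Suc k))"
  \<comment> \<open>The direction of the bisector: on the two edges
    \<open>\<gamma> * Im (Ln w) + \<kappa>\<close> takes the values \<beta>0 and \<beta>0 + pi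
    \<gamma>.\<close>
  define \<kappa> where "\<kappa> = \<beta>0 + pi * \<gamma> / 2"
  define f where "f = (\<lambda>w. 1 - \<psi> (cayley w))"
  \<comment> \<open>Because \<open>cayley\<close> reverses orientation, negative y belongs to the
    arc with positive t.\<close>
  have edge_cases: thesis1 if w: "Re w = 0" "w \<noteq> 0" "cmod w \<le> \<rho>"
    and pos: "\<And>y t. w = \<i> * of_real y \<Longrightarrow> y < 0 \<Longrightarrow> 0 < t \<Longrightarrow> t < 3 * \<rho> \<Longrightarrow> cayley w = cis t \<Longrightarrow> thesis1"
    and neg: "\<And>y t. w = \<i> * of_real y \<Longrightarrow> 0 < y \<Longrightarrow> t < 0 \<Longrightarrow> - (3 * \<rho>) < t \<Longrightarrow> cayley w = cis t \<Longrightarrow> thesis1"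
    for w thesis1
  proof -
    define y where "y = Im w"
    have wy: "w = \<i> * of_real y" using w by (simp add: complex_eq_iff y_def)
    have y: "y \<noteq> 0" "\<bar>y\<bar> \<le> \<rho>" using w wy by (auto simp: norm_mult)
    have at: "\<bar>arctan y\<bar> \<le> \<bar>y\<bar>"
      using arctan_le_self[of y] arctan_le_self[of "-y"] by (cases "0 \<le> y") (auto simp: arctan_minus)
    have cy: "cayley w = cis (- 2 * arctan y)" unfolding wy by (rule cayley_imaginary)
    show thesis1
    proof (cases "y < 0")
      case True
      then have "arctan y < 0" by simp
      then show thesis1 using at y \<rho> by (intro pos[OF wy True _ _ cy]) auto
    next
      case False
      then have "0 < y" using y by simp
      moreover from this have "0 < arctan y" by simp
      ultimately show thesis1 using at y \<rho> by (intro neg[OF wy _ _ _ cy]) auto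
    qed
  qed
  have edgeX: "cayley w \<in> X \<and> cmod (f w) \<le> 1" if w: "Re w = 0" "w \<noteq> 0" "cmod w \<le> \<rho>" for w
    using w
  proof (rule edge_cases)
    fix y t assume "0 < t" "t < 3 * \<rho>" "cayley w = cis t"
    then show ?thesis using cp_in[of t] P[of t] \<rho> by (auto simp: f_def \<zeta>_def)
  next
    fix y t assume "t < 0" "- (3 * \<rho>) < t" "cayley w = cis t"
    then show ?thesis using cm_in[of t] Mi[of t] \<rho> by (auto simp: f_def \<zeta>_def)
  qed
  have f\<phi>: "f w = 1 - \<phi> (cayley w)" if "0 < Re w" for w
    using \<psi>\<phi> cayley_in_disk[OF that] by (simp add: f_def)
  have cY: "cayley ` ({w. 0 < Re w} \<union> {w. Re w = 0 \<and> cmod w \<le> \<rho>}) \<subseteq> Y"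
  proof
    fix z assume "z \<in> cayley ` ({w. 0 < Re w} \<union> {w. Re w = 0 \<and> cmod w \<le> \<rho>})"
    then obtain w where w: "z = cayley w" "0 < Re w \<or> Re w = 0 \<and> cmod w \<le> \<rho>" by auto
    show "z \<in> Y"
    proof (cases "w = 0")
      case True
      then show ?thesis using one w by (simp add: cayley_def Y_def)
    next
      case False
      then show ?thesis using w edgeX[of w] cayley_in_disk[of w] YD(1) by (auto simp: X_def)
    qed
  qed
  have holc: "cayley holomorphic_on {w. 0 < Re w}"
    unfolding cayley_def by (intro holomorphic_intros) (auto dest: one_plus_nonzero[OF less_imp_le] one_plus_nonzero[OF eq_refl[OF sym]])
  have "dini_corner f \<gamma> \<kappa> \<rho> d"
  proof
    have "(\<lambda>w. 1 - (\<phi> \<circ> cayley) w) holomorphic_on {w. 0 < Re w}"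
      by (intro holomorphic_intros holomorphic_on_compose_gen[OF holc \<phi>(1)]) (use cayley_in_disk in auto)
    then show "f holomorphic_on {w. 0 < Re w}"
      by (rule holomorphic_transform) (simp add: f\<phi>)
    show "continuous_on ({w. 0 < Re w} \<union> {w. Re w = 0 \<and> cmod w \<le> \<rho>}) f"
      unfolding f_def
    proof (intro continuous_intros continuous_on_compose2[OF \<psi>Y _ cY])
      show "continuous_on ({w. 0 < Re w} \<union> {w. Re w = 0 \<and> cmod w \<le> \<rho>}) cayley"
        unfolding cayley_def by (intro continuous_intros) (auto dest: one_plus_nonzero[OF less_imp_le] one_plus_nonzero[OF eq_refl[OF sym]])
    qed
    show "f 0 = 0" by (simp add: f_def cayley_def \<psi>1)
    show "0 < Re (f w)" if "0 < Re w" for w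
    proof -
      have "cmod (\<phi> (cayley w)) < 1" using \<phi>(2) cayley_in_disk[OF that] by (auto simp: image_subset_iff)
      then show ?thesis using complex_Re_le_cmod[of "\<phi> (cayley w)"] by (simp add: f\<phi>[OF that])
    qed
    show "0 \<le> Re (f w) \<and> f w \<noteq> 0 \<and> cmod (f w) \<le> 1" if "Re w = 0" "w \<noteq> 0" "cmod w \<le> \<rho>" for w
      using edgeX[OF that] half[of "cayley w"] by (simp add: f_def)
    show "0 < \<rho>" "0 < \<gamma>" by fact+
    show "0 \<le> d k" for k using \<eta>(1)[of k] by (simp add: d_def)
    show "summable (\<lambda>k. real (k + 1) * d k)"
      unfolding d_def by (rule summable_weighted_differences(1)[OF \<eta>])
    show "\<bar>Im (Ln (f w)) - \<gamma> * Im (Ln w) - \<kappa>\<bar> \<le> (\<Sum>k. d (k + m))"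
      if w: "Re w = 0" "w \<noteq> 0" "cmod w \<le> \<rho>" and fm: "cmod (f w) \<le> (1/2) ^ m" for w m
    proof -
      have "(\<Sum>k. d (k + m)) = \<eta> m" unfolding d_def by (rule summable_weighted_differences(2)[OF \<eta>])
      moreover have "\<bar>Im (Ln (f w)) - \<gamma> * Im (Ln w) - \<kappa>\<bar> \<le> \<eta> m"
        using w
      proof (rule edge_cases)
        fix y t assume "w = \<i> * of_real y" "y < 0" "0 < t" "t < 3 * \<rho>" "cayley w = cis t"
        then have "\<bar>Im (Ln (f w)) - \<beta>0\<bar> \<le> \<eta>p m" "Im (Ln w) = - (pi / 2)"
          using P[of t] \<rho> fm Im_Ln_imaginary(2) by (auto simp: f_def \<zeta>_def)
        then show ?thesis using \<open>\<And>k. 0 \<le> \<eta>m k\<close>[of m] by (simp add: \<kappa>_def \<eta>_def algebra_simps)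
      next
        fix y t assume "w = \<i> * of_real y" "0 < y" "t < 0" "- (3 * \<rho>) < t" "cayley w = cis t"
        then have *: "\<bar>Im (Ln (f w)) - (\<beta>0 + pi * \<gamma>)\<bar> \<le> \<eta>m m" "Im (Ln w) = pi / 2"
          using Mi[of t] \<rho> fm Im_Ln_imaginary(1) by (auto simp: f_def \<zeta>_def)
        have "Im (Ln (f w)) - \<gamma> * Im (Ln w) - \<kappa> = Im (Ln (f w)) - (\<beta>0 + pi * \<gamma>)"
          unfolding *(2) \<kappa>_def by (simp add: field_simps)
        then show ?thesis using \<open>\<And>k. 0 \<le> \<eta>p k\<close>[of m] *(1) by (simp add: \<eta>_def)
      qed
      ultimately show ?thesis by simp
    qed
  qed
  moreover have "\<gamma> \<le> 1"
  proof -
    have "pi * \<gamma> \<le> pi * 1" using \<beta>0 \<beta>1 by linarith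
    then show ?thesis by (simp only: mult_le_cancel_left_pos[OF pi_gt_zero])
  qed
  moreover have "\<bar>\<kappa>\<bar> < pi / 2" unfolding \<kappa>_def
    unfolding abs_less_iff using \<beta>0 \<beta>1 mult_pos_pos[OF pi_gt_zero \<gamma>] by argo
  ultimately show thesis using f\<phi> that by blast
qed

subsection \<open>Lindeloef's theorem\<close>

text \<open>Apart from z lying in the disk, these sectors restrict only the direction of 1 - z,
  unlike the regions in \<open>has_angular_limit\<close>; this suits rescaling at 1.\<close>

definition sector_limit :: "(complex \<Rightarrow> complex) \<Rightarrow> complex \<Rightarrow> bool" where
  "sector_limit F l \<longleftrightarrow>
     (\<forall>M::real. (F \<longlongrightarrow> l) (at 1 within {z \<in> unit_disk. cmod (1 - z) \<le> M * Re (1 - z)}))"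

lemma sector_limit_imp_angular:
  assumes "sector_limit F l" shows "has_angular_limit F l"
  unfolding has_angular_limit_def
proof
  fix M :: real
  have "{z \<in> unit_disk. cmod (1 - z) \<le> M * (1 - cmod z)} \<subseteq> {z \<in> unit_disk. cmod (1 - z) \<le> M * Re (1 - z)}"
  proof
    fix z assume "z \<in> {z \<in> unit_disk. cmod (1 - z) \<le> M * (1 - cmod z)}"
    then have z: "cmod z < 1" "cmod (1 - z) \<le> M * (1 - cmod z)" by auto
    have "0 \<le> M * (1 - cmod z)" using z(2) norm_ge_zero order_trans by blast
    then have "0 \<le> M" using z(1) by (simp add: zero_le_mult_iff)
    then have "M * (1 - cmod z) \<le> M * Re (1 - z)"
      using complex_Re_le_cmod[of z] by (intro mult_left_mono) auto
    then show "z \<in> {z \<in> unit_disk. cmod (1 - z) \<le> M * Re (1 - z)}" using z by auto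
  qed
  then show "(F \<longlongrightarrow> l) (at 1 within {z \<in> unit_disk. cmod (1 - z) \<le> M * (1 - cmod z)})"
    using assms unfolding sector_limit_def by (meson tendsto_within_subset)
qed

lemma one_minus_scaled_in_disk:
  assumes "0 < t" "\<delta> < Re w" "cmod w \<le> b" "t * b\<^sup>2 \<le> 2 * \<delta>"
  shows "1 - of_real t * w \<in> unit_disk"
proof -
  have "(cmod (1 - of_real t * w))\<^sup>2 = 1 - t * (2 * Re w - t * (cmod w)\<^sup>2)"
    unfolding cmod_power2 by (simp add: power2_eq_square algebra_simps)
  moreover have "t * (cmod w)\<^sup>2 \<le> t * b\<^sup>2" using assms by (intro mult_left_mono power_mono) auto
  then have "0 < 2 * Re w - t * (cmod w)\<^sup>2" using assms(2,4) by linarith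
  then have "0 < t * (2 * Re w - t * (cmod w)\<^sup>2)" using assms(1) by simp
  ultimately have "(cmod (1 - of_real t * w))\<^sup>2 < 1" by linarith
  then show ?thesis by (simp add: abs_square_less_1)
qed

text \<open>The ball about \<open>1 - of_real t * a\<close> of radius \<open>t * c\<close> lies in
  the disk for small t, and the perturbed point is displaced from its centre by a vanishing fraction
  of that radius. Borel-Caratheodory with the global bound \<open>B\<close> makes the difference of
  the values tend to 0.\<close>

lemma limit_along_ray_of_perturbed:
  fixes \<Lambda> :: "complex \<Rightarrow> complex"
  assumes hol: "\<Lambda> holomorphic_on unit_disk" and B: "0 < B" "\<And>z. z \<in> unit_disk \<Longrightarrow> \<bar>Im (\<Lambda> z)\<bar> \<le> B"
    and a: "0 < Re a" and p: "(p \<longlongrightarrow> 1) (at_right 0)"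
    and lim: "((\<lambda>t. \<Lambda> (1 - of_real t * (a * p t))) \<longlongrightarrow> l) (at_right 0)"
  shows "((\<lambda>t. \<Lambda> (1 - of_real t * a)) \<longlongrightarrow> l) (at_right 0)"
proof -
  define c where "c = Re a / 2"
  have c: "0 < c" using a by (simp add: c_def)
  define \<epsilon> where "\<epsilon> = (\<lambda>t. cmod a * cmod (p t - 1) / c)"
  have \<epsilon>: "(\<epsilon> \<longlongrightarrow> 0) (at_right 0)"
  proof -
    have "((\<lambda>t. cmod a * cmod (p t - 1) / c) \<longlongrightarrow> cmod a * cmod (1 - 1) / c) (at_right 0)"
      by (intro tendsto_intros p) (use c in auto)
    then show ?thesis by (simp add: \<epsilon>_def)
  qed
  have "((\<lambda>t. \<Lambda> (1 - of_real t * (a * p t)) - \<Lambda> (1 - of_real t * a)) \<longlongrightarrow> 0) (at_right 0)"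
  proof (rule Lim_null_comparison)
    have "((\<lambda>t. 6 * B * \<epsilon> t / (1 - \<epsilon> t)) \<longlongrightarrow> 6 * B * 0 / (1 - 0)) (at_right 0)"
      by (intro tendsto_intros \<epsilon>) auto
    then show "((\<lambda>t. 6 * B * \<epsilon> t / (1 - \<epsilon> t)) \<longlongrightarrow> 0) (at_right 0)" by simp
    have e1: "\<forall>\<^sub>F t in at_right 0. \<epsilon> t < 1" by (rule order_tendstoD(2)[OF \<epsilon>]) simp
    have e2: "\<forall>\<^sub>F t in at_right (0::real). t * (cmod a + c)\<^sup>2 < 2 * c"
    proof (rule order_tendstoD(2))
      show "((\<lambda>t. t * (cmod a + c)\<^sup>2) \<longlongrightarrow> 0 * (cmod a + c)\<^sup>2) (at_right 0)" by (intro tendsto_intros)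
    qed (use c in simp)
    show "\<forall>\<^sub>F t in at_right 0. cmod (\<Lambda> (1 - of_real t * (a * p t)) - \<Lambda> (1 - of_real t * a))
        \<le> 6 * B * \<epsilon> t / (1 - \<epsilon> t)"
      using e1 e2 eventually_at_right_less[of 0]
    proof eventually_elim
      case (elim t)
      have sub: "ball (1 - of_real t * a) (t * c) \<subseteq> unit_disk"
      proof
        fix z assume z: "z \<in> ball (1 - of_real t * a) (t * c)"
        define w where "w = (1 - z) / of_real t"
        have zw: "z = 1 - of_real t * w" using elim by (simp add: w_def)
        have "z - (1 - of_real t * a) = of_real t * (a - w)" by (simp add: zw algebra_simps)
        then have "t * cmod (a - w) < t * c" using z elim by (simp add: dist_norm norm_minus_commute norm_mult)
        then have aw: "cmod (a - w) < c" using elim by simp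
        have "c < Re w" using complex_Re_le_cmod[of "a - w"] aw by (simp add: c_def)
        moreover have "cmod w \<le> cmod a + c" using norm_triangle_ineq2[of w a] aw by (simp add: norm_minus_commute)
        ultimately show "z \<in> unit_disk" unfolding zw using elim
          by (intro one_minus_scaled_in_disk[where \<delta>=c and b="cmod a + c"]) auto
      qed
      show ?case
      proof (rule Borel_Caratheodory_Im[where F=\<Lambda> and R="t * c"])
        show "\<Lambda> holomorphic_on ball (1 - of_real t * a) (t * c)" by (rule holomorphic_on_subset[OF hol sub])
        show "\<bar>Im (\<Lambda> w)\<bar> \<le> B" if "w \<in> ball (1 - of_real t * a) (t * c)" for w
          using that sub by (intro B) auto
        have "1 - of_real t * (a * p t) - (1 - of_real t * a) = - (of_real t * (a * (p t - 1)))"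
          by (simp add: algebra_simps)
        then have "cmod (1 - of_real t * (a * p t) - (1 - of_real t * a)) = t * (cmod a * cmod (p t - 1))"
          using elim by (simp add: norm_mult)
        also have "\<dots> = \<epsilon> t * (t * c)" using c by (simp add: \<epsilon>_def)
        finally show "cmod (1 - of_real t * (a * p t) - (1 - of_real t * a)) \<le> \<epsilon> t * (t * c)" by simp
      qed (use elim c B in auto)
    qed
  qed
  from tendsto_diff[OF lim this] show ?thesis by simp
qed

text \<open>Lindeloef's theorem: rescaling at the boundary point gives a normal family on a part of the
  right half-plane, and every limit function equals \<open>l\<close> on a piece of the ray.\<close>
lemma ray_limit_imp_sector_limit:
  fixes \<Lambda> :: "complex \<Rightarrow> complex"
  assumes hol: "\<Lambda> holomorphic_on unit_disk" and B: "0 < B" "\<And>z. z \<in> unit_disk \<Longrightarrow> \<bar>Im (\<Lambda> z)\<bar> \<le> B"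
    and a: "0 < Re a" "cmod a = 1"
    and ray: "((\<lambda>t. \<Lambda> (1 - of_real t * a)) \<longlongrightarrow> l) (at_right 0)"
  shows "sector_limit \<Lambda> l"
  unfolding sector_limit_def tendsto_at_iff_sequentially
proof (intro allI impI)
  fix M :: real and X :: "nat \<Rightarrow> complex"
  assume Xin: "\<forall>i. X i \<in> {z \<in> unit_disk. cmod (1 - z) \<le> M * Re (1 - z)} - {1}" and Xlim: "X \<longlonglongrightarrow> 1"
  show "(\<Lambda> \<circ> X) \<longlonglongrightarrow> l"
  proof (rule ccontr)
    assume "\<not> (\<Lambda> \<circ> X) \<longlonglongrightarrow> l"
    then obtain \<epsilon> where \<epsilon>: "0 < \<epsilon>" and fr: "\<And>N. \<exists>n\<ge>N. \<epsilon> \<le> dist (\<Lambda> (X n)) l"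
      unfolding lim_sequentially by (auto simp: not_less)
    define M' where "M' = max M 1"
    \<comment> \<open>A lower bound for the real parts of all directions involved: 1 / M' for the
      sequence in the sector, \<open>Re a\<close> for the ray.\<close>
    define \<delta> where "\<delta> = min (1 / M') (Re a)"
    have \<delta>: "0 < \<delta>" "\<delta> \<le> 1 / M'" "\<delta> \<le> Re a" using a by (auto simp: \<delta>_def M'_def)
    have \<delta>1: "\<delta> \<le> 1" using \<delta>(3) complex_Re_le_cmod[of a] a(2) by linarith
    have rlim: "(\<lambda>n. cmod (1 - X n)) \<longlonglongrightarrow> 0"
      using tendsto_norm[OF tendsto_diff[OF tendsto_const[of 1] Xlim]] by simp
    \<comment> \<open>Small enough for \<open>r n * 3\<^sup>2 \<le> 2 * (\<delta> / 4)\<close>, so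
      that all rescaled points used below stay in the disk.\<close>
    have "\<forall>\<^sub>F n in sequentially. cmod (1 - X n) < \<delta> / 32"
      by (rule order_tendstoD(2)[OF rlim]) (use \<delta> in simp)
    then obtain N where N: "\<And>n. N \<le> n \<Longrightarrow> cmod (1 - X n) < \<delta> / 32" by (auto simp: eventually_sequentially)
    obtain pick where pick: "\<And>n. n + N \<le> pick n" "\<And>n. \<epsilon> \<le> dist (\<Lambda> (X (pick n))) l"
      using fr[of "n + N" for n] by metis
    define r where "r = (\<lambda>n. cmod (1 - X (pick n)))"
    define W where "W = (\<lambda>n. (1 - X (pick n)) / of_real (r n))"
    have "filterlim pick at_top sequentially"
      unfolding filterlim_at_top
    proof
      fix Z show "\<forall>\<^sub>F n in sequentially. Z \<le> pick n"
        unfolding eventually_sequentially using pick(1) by (meson add_leE order_trans)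
    qed
    then have r0: "r \<longlonglongrightarrow> 0" unfolding r_def by (rule filterlim_compose[OF rlim])
    have r: "0 < r n" "r n < \<delta> / 32" for n
    proof -
      have "cmod (X (pick n)) < 1" using Xin by auto
      then have "X (pick n) \<noteq> 1" by auto
      then show "0 < r n" "r n < \<delta> / 32" using N[of "pick n"] pick(1)[of n] by (auto simp: r_def)
    qed
    have XW: "X (pick n) = 1 - of_real (r n) * W n" for n using r(1)[of n] by (simp add: W_def)
    have W1: "cmod (W n) = 1" for n using r(1)[of n] by (simp add: W_def r_def norm_divide)
    have ReW: "\<delta> \<le> Re (W n)" for n
    proof -
      have "r n \<le> M * Re (1 - X (pick n))" and "X (pick n) \<in> unit_disk" using Xin by (auto simp: r_def)
      moreover from this have "0 < Re (1 - X (pick n))" using complex_Re_le_cmod[of "X (pick n)"] by simp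
      then have "M * Re (1 - X (pick n)) \<le> M' * Re (1 - X (pick n))" by (simp add: M'_def)
      moreover have "Re (1 - X (pick n)) = r n * Re (W n)" using r(1)[of n] by (simp add: W_def Re_divide_of_real)
      ultimately have "r n * 1 \<le> r n * (M' * Re (W n))" by (simp add: mult.left_commute)
      then have "1 \<le> M' * Re (W n)" using r(1)[of n] by (simp only: mult_le_cancel_left_pos)
      then have "1 / M' \<le> Re (W n)" by (simp add: M'_def divide_le_eq mult.commute max_def split: if_splits)
      then show ?thesis using \<delta> by simp
    qed
    \<comment> \<open>Contains the normalized points \<open>W n\<close> and the piece 1 \<le> s < 2
      of the ray, and leaves room for balls of radius \<delta> / 4 on which the rescaled functions
      are still holomorphic.\<close>
    define U where "U = {w. \<delta> / 2 < Re w} \<inter> ball 0 2"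
    have U: "open U" "convex U" unfolding U_def
      by (intro open_Int convex_Int open_halfspace_Re_gt convex_halfspace_Re_gt open_ball convex_ball)+
    define Lf where "Lf = (\<lambda>n w. \<Lambda> (1 - of_real (r n) * w))"
    have big: "1 - of_real (r n) * w \<in> unit_disk" if "\<delta> / 4 < Re w" "cmod w \<le> 3" for w n
    proof (rule one_minus_scaled_in_disk[OF r(1) that])
      show "r n * 3\<^sup>2 \<le> 2 * (\<delta> / 4)" using r[of n] by simp
    qed
    have nbhd: "\<delta> / 4 < Re v \<and> cmod v \<le> 3" if "w \<in> U" "v \<in> ball w (\<delta> / 4)" for v w
    proof -
      have "cmod (w - v) < \<delta> / 4" using that by (simp add: dist_norm)
      then show ?thesis
        using that(1) complex_Re_le_cmod[of "w - v"] norm_triangle_ineq3[of w v] \<delta> \<delta>1 by (auto simp: U_def)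
    qed
    have holL: "Lf n holomorphic_on ball w (\<delta> / 4)" if "w \<in> U" for n w
    proof -
      have "\<Lambda> \<circ> (\<lambda>v. 1 - of_real (r n) * v) holomorphic_on ball w (\<delta> / 4)"
        by (rule holomorphic_on_compose_gen[OF _ hol]) (use big nbhd[OF that] in \<open>auto intro!: holomorphic_intros\<close>)
      then show ?thesis by (simp add: Lf_def o_def)
    qed
    have dL: "cmod (deriv (Lf n) w) \<le> 12 * B / (\<delta> / 4)" if "w \<in> U" for n w
    proof (rule deriv_bound_by_Im[OF holL[OF that]])
      show "\<bar>Im (Lf n v)\<bar> \<le> B" if v: "v \<in> ball w (\<delta> / 4)" for v
        unfolding Lf_def by (intro B big) (use nbhd[OF \<open>w \<in> U\<close> v] in auto)
    qed (use \<delta> B in auto)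
    have DL: "(Lf n has_field_derivative deriv (Lf n) w) (at w)" if "w \<in> U" for n w
      using holomorphic_derivI[OF holL[OF that] open_ball] \<delta> by simp
    have holU: "Lf n holomorphic_on U" for n
      using DL by (auto simp: holomorphic_on_open[OF U(1)])
    have seg: "of_real s * a \<in> U" if "1 \<le> s" "s < 2" for s
    proof -
      have "Re a \<le> s * Re a" using that a by simp
      then have "\<delta> / 2 < s * Re a" using \<delta> by linarith
      then show ?thesis using that a(2) by (simp add: U_def norm_mult)
    qed
    have conv: "(\<lambda>n. Lf n (of_real s * a)) \<longlonglongrightarrow> l" if s: "1 \<le> s" for s
    proof -
      have "filterlim (\<lambda>n. r n * s) (at_right 0) sequentially"
        unfolding filterlim_at
      proof
        have "0 < r n * s" for n using r(1)[of n] s by simp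
        then show "\<forall>\<^sub>F n in sequentially. r n * s \<in> {0<..} \<and> r n * s \<noteq> 0"
          by (intro always_eventually allI) (metis greaterThan_iff less_irrefl)
        show "(\<lambda>n. r n * s) \<longlonglongrightarrow> 0"
          using tendsto_mult[OF r0 tendsto_const[of s]] by simp
      qed
      from filterlim_compose[OF ray this] show ?thesis by (simp add: Lf_def mult.assoc)
    qed
    have aU: "a \<in> U" using seg[of 1] by simp
    \<comment> \<open>Boundedness at the single point \<open>a\<close>, together with the uniform
      derivative bound, gives the uniform boundedness that Montel's theorem asks for.\<close>
    obtain C where C: "\<And>n. cmod (Lf n a) \<le> C"
    proof -
      have "(\<lambda>n. Lf n a) \<longlonglongrightarrow> l" using conv[of 1] by simp
      from convergent_imp_Bseq[OF convergentI[OF this]] show thesis using that by (auto simp: Bseq_def)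
    qed
    have bdd: "cmod (Lf n w) \<le> C + 12 * B / (\<delta> / 4) * 4" if w: "w \<in> U" for n w
    proof -
      have "cmod (Lf n w - Lf n a) \<le> 12 * B / (\<delta> / 4) * cmod (w - a)"
        by (rule field_differentiable_bound[OF U(2) has_field_derivative_at_within[OF DL] dL w aU])
      also have "\<dots> \<le> 12 * B / (\<delta> / 4) * 4"
        using norm_triangle_ineq4[of w a] w a(2) B \<delta> by (intro mult_left_mono) (auto simp: U_def)
      finally show ?thesis using norm_triangle_ineq2[of "Lf n w" "Lf n a"] C[of n] by linarith
    qed
    obtain g k where g: "g holomorphic_on U" and k: "strict_mono (k :: nat \<Rightarrow> nat)"
      and pt: "\<And>x. x \<in> U \<Longrightarrow> (\<lambda>n. Lf (k n) x) \<longlonglongrightarrow> g x"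
      and unif: "\<And>K. compact K \<Longrightarrow> K \<subseteq> U \<Longrightarrow> uniform_limit K (Lf \<circ> k) g sequentially"
    proof (rule Montel[of U "range Lf" Lf])
      show "\<exists>B. \<forall>h\<in>range Lf. \<forall>z\<in>K. cmod (h z) \<le> B" if "K \<subseteq> U" for K using bdd that by blast
    qed (use U holU that in auto)
    have gl: "g w - l = 0" if w: "w \<in> U" for w
    proof (rule analytic_continuation[where f="\<lambda>w. g w - l" and S=U and U="(\<lambda>s. of_real s * a) ` {1..<2}" and \<xi>=a])
      show "a islimpt (\<lambda>s. of_real s * a) ` {1..<2}"
        unfolding islimpt_approachable
      proof (intro allI impI)
        fix e :: real assume e: "0 < e"
        define s where "s = 1 + min (1/2) (e / 2)"
        have s: "1 < s" "s < 2" "s - 1 < e" using e by (auto simp: s_def min_def)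
        have "of_real s * a - a = of_real (s - 1) * a" by (simp add: algebra_simps)
        then have d: "dist (of_real s * a) a = s - 1" using a s by (simp add: dist_norm norm_mult del: of_real_diff)
        then have "of_real s * a \<noteq> a" using s by auto
        then show "\<exists>x'\<in>(\<lambda>s. of_real s * a) ` {1..<2}. x' \<noteq> a \<and> dist x' a < e"
          using s d by (intro bexI[of _ "of_real s * a"]) auto
      qed
      show "g z - l = 0" if zin: "z \<in> (\<lambda>s. of_real s * a) ` {1..<2}" for z
      proof -
        obtain s where s': "z = of_real s * a" "s \<in> {1..<2}" using zin by (rule imageE)
        then have s: "z = of_real s * a" "1 \<le> s" "s < 2" by simp_all
        have "(\<lambda>n. Lf (k n) z) \<longlonglongrightarrow> l"
          using LIMSEQ_subseq_LIMSEQ[OF conv[OF s(2)] k] s(1) by (simp add: o_def)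
        then show ?thesis using LIMSEQ_unique[OF pt[of z]] seg[of s] s by simp
      qed
    qed (use U g aU w seg in \<open>auto intro!: holomorphic_intros convex_connected\<close>)
    \<comment> \<open>A compact set containing all \<open>W n\<close>; uniform convergence on it
      permits evaluation at these moving points without a further subsequence.\<close>
    define Kc where "Kc = {w. \<delta> \<le> Re w} \<inter> sphere 0 1"
    have "compact Kc" unfolding Kc_def
      by (intro closed_Int_compact closed_halfspace_Re_ge compact_sphere)
    moreover have "Kc \<subseteq> U" using \<delta> by (auto simp: Kc_def U_def)
    ultimately have "uniform_limit Kc (Lf \<circ> k) g sequentially" by (rule unif)
    then have "\<forall>\<^sub>F n in sequentially. \<forall>x\<in>Kc. dist ((Lf \<circ> k) n x) (g x) < \<epsilon>"
      using \<epsilon> by (auto simp: uniform_limit_iff)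
    then obtain n where n: "\<And>x. x \<in> Kc \<Longrightarrow> dist (Lf (k n) x) (g x) < \<epsilon>"
      by (auto simp: eventually_sequentially)
    have WK: "W (k n) \<in> Kc" using ReW W1 by (simp add: Kc_def)
    then have "g (W (k n)) = l" using gl \<open>Kc \<subseteq> U\<close> by auto
    with n[OF WK] pick(2)[of "k n"] show False by (simp add: Lf_def XW)
  qed
qed

subsection \<open>Limits in sectors\<close>

lemma norm_powr_of_real: "z \<noteq> 0 \<Longrightarrow> cmod (z powr of_real x) = cmod z powr x"
  by (simp add: powr_def)

lemma Re_one_minus_pos: "z \<in> unit_disk \<Longrightarrow> 0 < Re (1 - z)"
  using complex_Re_le_cmod[of z] by simp

lemma sector_limit_along_ray:
  assumes "sector_limit F l" and a: "0 < Re a" "cmod a = 1"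
  shows "((\<lambda>t. F (1 - of_real t * a)) \<longlongrightarrow> l) (at_right 0)"
proof -
  have "(F \<longlongrightarrow> l) (at 1 within {z \<in> unit_disk. cmod (1 - z) \<le> (1 / Re a) * Re (1 - z)})"
    using assms(1) by (simp only: sector_limit_def)
  then show ?thesis
  proof (rule filterlim_compose)
    have "((\<lambda>t. 1 - of_real t * a) \<longlongrightarrow> 1 - of_real 0 * a) (at_right (0::real))" by (intro tendsto_intros)
    moreover have "\<forall>\<^sub>F t in at_right (0::real). 1 - of_real t * a \<in> {z \<in> unit_disk. cmod (1 - z) \<le> (1 / Re a) * Re (1 - z)}
        \<and> 1 - of_real t * a \<noteq> 1"
      unfolding eventually_at_right_field
    proof (intro exI[of _ "Re a"] conjI allI impI a(1))
      fix t :: real assume t: "0 < t" "t < Re a"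
      have "1 - of_real t * a \<in> unit_disk"
        by (rule one_minus_scaled_in_disk[where \<delta>="Re a / 2" and b=1]) (use t a in auto)
      then show "1 - of_real t * a \<in> {z \<in> unit_disk. cmod (1 - z) \<le> (1 / Re a) * Re (1 - z)}"
        using t a by (simp add: norm_mult)
      show "1 - of_real t * a \<noteq> 1" using t a by auto
    qed
    ultimately show "LIM t at_right 0. 1 - of_real t * a :>
        at 1 within {z \<in> unit_disk. cmod (1 - z) \<le> (1 / Re a) * Re (1 - z)}"
      by (simp add: filterlim_at)
  qed
qed

text \<open>Along the ray of angle \<theta> the argument of 1 - z equals \<theta>, so
  \<open>Im (Ln (q z))\<close> tends to \<open>Im l - \<beta> * \<theta>\<close> while staying in
  [-pi/2, pi/2]. Letting \<theta> tend to pi/2 and to -pi/2 gives two inequalities that combine into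
  the claim.\<close>

lemma sector_limit_arg_bound:
  assumes q: "\<And>z. z \<in> unit_disk \<Longrightarrow> 0 \<le> Re (q z) \<and> q z \<noteq> 0" and \<beta>: "0 \<le> \<beta>"
    and lim: "sector_limit (\<lambda>z. Ln (q z) + of_real \<beta> * Ln (1 - z)) l"
  shows "\<bar>Im l\<bar> + \<beta> * (pi / 2) \<le> pi / 2"
proof -
  have ray: "\<bar>Im l - \<beta> * \<theta>\<bar> \<le> pi / 2" if \<theta>: "- (pi / 2) < \<theta>" "\<theta> < pi / 2" for \<theta>
  proof -
    have a: "0 < Re (cis \<theta>)" "cmod (cis \<theta>) = 1" using \<theta> cos_gt_zero_pi[of \<theta>] by auto
    have "((\<lambda>t. \<bar>Im (Ln (q (1 - of_real t * cis \<theta>)) + of_real \<beta> * Ln (1 - (1 - of_real t * cis \<theta>))) - \<beta> * \<theta>\<bar>)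
        \<longlongrightarrow> \<bar>Im l - \<beta> * \<theta>\<bar>) (at_right 0)"
      by (intro tendsto_intros sector_limit_along_ray[OF lim a])
    then show ?thesis
    proof (rule tendsto_upperbound)
      show "\<forall>\<^sub>F t in at_right 0. \<bar>Im (Ln (q (1 - of_real t * cis \<theta>)) + of_real \<beta> * Ln (1 - (1 - of_real t * cis \<theta>))) - \<beta> * \<theta>\<bar> \<le> pi / 2"
        unfolding eventually_at_right_field
      proof (intro exI[of _ "cos \<theta>"] conjI allI impI)
        fix t assume t: "0 < t" "t < cos \<theta>"
        have "1 - of_real t * cis \<theta> \<in> unit_disk"
          by (rule one_minus_scaled_in_disk[where \<delta>="cos \<theta> / 2" and b=1]) (use t a in auto)
        then have "\<bar>Im (Ln (q (1 - of_real t * cis \<theta>)))\<bar> \<le> pi / 2"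
          using q Re_Ln_pos_le by blast
        moreover have "Ln (cis \<theta>) = \<i> * of_real \<theta>"
          using \<theta> unfolding cis_conv_exp by (intro Ln_exp) auto
        then have "Ln (of_real t * cis \<theta>) = of_real (ln t) + \<i> * of_real \<theta>"
          using Ln_times_of_real[OF t(1), of "cis \<theta>"] Ln_of_real[OF t(1)] by simp
        ultimately show "\<bar>Im (Ln (q (1 - of_real t * cis \<theta>)) + of_real \<beta> * Ln (1 - (1 - of_real t * cis \<theta>))) - \<beta> * \<theta>\<bar> \<le> pi / 2"
          by simp
      qed (use a in simp)
    qed simp
  qed
  have "\<bar>Im l - \<beta> * (pi / 2)\<bar> \<le> pi / 2"
  proof (rule tendsto_upperbound)
    show "((\<lambda>\<theta>. \<bar>Im l - \<beta> * \<theta>\<bar>) \<longlongrightarrow> \<bar>Im l - \<beta> * (pi / 2)\<bar>) (at_left (pi / 2))" by (intro tendsto_intros)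
    show "\<forall>\<^sub>F \<theta> in at_left (pi / 2). \<bar>Im l - \<beta> * \<theta>\<bar> \<le> pi / 2"
      unfolding eventually_at_left_field using ray by (intro exI[of _ 0]) auto
  qed simp
  moreover have "\<bar>Im l - \<beta> * (- (pi / 2))\<bar> \<le> pi / 2"
  proof (rule tendsto_upperbound)
    show "((\<lambda>\<theta>. \<bar>Im l - \<beta> * \<theta>\<bar>) \<longlongrightarrow> \<bar>Im l - \<beta> * (- (pi / 2))\<bar>) (at_right (- (pi / 2)))" by (intro tendsto_intros)
    show "\<forall>\<^sub>F \<theta> in at_right (- (pi / 2)). \<bar>Im l - \<beta> * \<theta>\<bar> \<le> pi / 2"
      unfolding eventually_at_right_field using ray by (intro exI[of _ 0]) auto
  qed simp
  ultimately show ?thesis by (simp add: abs_le_iff) argo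
qed

text \<open>Subtracting the exact primitive of the leading term leaves a function \<open>k\<close>
  on the ray whose derivative is at most \<open>\<epsilon> * s powr (- \<alpha> - 1)\<close>.
  Integration from t to the fixed radius \<open>r1\<close> bounds it by a constant plus a small
  multiple of \<open>t powr (- \<alpha>)\<close>, and \<alpha> > 0 makes the constant negligible.
  Compactness of the set \<open>A\<close> of directions makes this uniform in the sector.\<close>

lemma sector_limit_integrate:
  assumes h: "h holomorphic_on unit_disk" and \<alpha>: "0 < \<alpha>"
    and lim: "sector_limit (\<lambda>z. (1 - z) powr of_real (1 + \<alpha>) * deriv h z) \<mu>"
  shows "sector_limit (\<lambda>z. (1 - z) powr of_real \<alpha> * h z) (\<mu> / of_real \<alpha>)"
  unfolding sector_limit_def
proof
  fix M0 :: real
  define M where "M = max M0 1"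
  have M: "1 \<le> M" by (simp add: M_def)
  define g where "g = (\<lambda>z. (1 - z) powr of_real (1 + \<alpha>) * deriv h z)"
  have "((\<lambda>z. (1 - z) powr of_real \<alpha> * h z) \<longlongrightarrow> \<mu> / of_real \<alpha>)
      (at 1 within {z \<in> unit_disk. cmod (1 - z) \<le> M * Re (1 - z)})"
  proof (rule tendstoI)
    fix e :: real assume e: "0 < e"
    \<comment> \<open>Makes the final error \<open>\<epsilon> / \<alpha>\<close> equal to half of
      e.\<close>
    define \<epsilon> where "\<epsilon> = e * \<alpha> / 2"
    have \<epsilon>: "0 < \<epsilon>" using e \<alpha> by (simp add: \<epsilon>_def)
    have "(g \<longlongrightarrow> \<mu>) (at 1 within {z \<in> unit_disk. cmod (1 - z) \<le> M * Re (1 - z)})"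
      using lim by (simp add: sector_limit_def g_def)
    then have "\<forall>\<^sub>F z in at 1 within {z \<in> unit_disk. cmod (1 - z) \<le> M * Re (1 - z)}. dist (g z) \<mu> < \<epsilon>"
      using \<epsilon> by (rule tendstoD)
    then obtain r0 where r0: "0 < r0" "\<And>z. z \<in> unit_disk \<Longrightarrow> cmod (1 - z) \<le> M * Re (1 - z) \<Longrightarrow> z \<noteq> 1 \<Longrightarrow>
        cmod (1 - z) < r0 \<Longrightarrow> cmod (g z - \<mu>) < \<epsilon>"
      by (auto simp: eventually_at dist_norm norm_minus_commute)
    define r1 where "r1 = min (r0 / 2) (1 / M)"
    have r1: "0 < r1" "r1 < r0" "r1 \<le> 1 / M" using r0 M by (auto simp: r1_def min_def)
    define A where "A = {a. 1 / M \<le> Re a} \<inter> sphere (0::complex) 1"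
    have disk: "1 - of_real s * a \<in> unit_disk" if "a \<in> A" "0 < s" "s \<le> r1" for s a
    proof (rule one_minus_scaled_in_disk[where \<delta>="1 / (2 * M)" and b=1])
      have "1 / (2 * M) < 1 / M" using M by (simp add: field_simps)
      then show "1 / (2 * M) < Re a" using that by (simp add: A_def)
      show "s * 1\<^sup>2 \<le> 2 * (1 / (2 * M))" using that r1 by simp
    qed (use that in \<open>auto simp: A_def\<close>)
    have "compact A" unfolding A_def by (intro closed_Int_compact closed_halfspace_Re_ge compact_sphere)
    then have "compact (h ` ((\<lambda>a. 1 - of_real r1 * a) ` A))"
      by (intro compact_continuous_image continuous_intros continuous_on_subset[OF holomorphic_on_imp_continuous_on[OF h]])
         (use disk r1 in auto)
    then have "bounded (h ` ((\<lambda>a. 1 - of_real r1 * a) ` A))" by (rule compact_imp_bounded)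
    then obtain C where "\<forall>y\<in>h ` ((\<lambda>a. 1 - of_real r1 * a) ` A). cmod y \<le> C"
      unfolding bounded_iff by blast
    then have C: "cmod (h (1 - of_real r1 * a)) \<le> C" if "a \<in> A" for a using that by simp
    define C' where "C' = C + cmod \<mu> / \<alpha> * r1 powr (- \<alpha>)"
    have main: "cmod ((of_real t * a) powr of_real \<alpha> * h (1 - of_real t * a) - \<mu> / of_real \<alpha>) \<le> C' * t powr \<alpha> + \<epsilon> / \<alpha>"
      if a: "a \<in> A" and t: "0 < t" "t < r1" for a t
    proof -
      have a1: "cmod a = 1" and Ra: "0 < Re a" using a M by (auto simp: A_def intro: less_le_trans[of 0 "1 / M"])
      have a0: "a \<noteq> 0" using a1 by auto
      have slit: "of_real s * a \<notin> \<real>\<^sub>\<le>\<^sub>0" if "0 < s" for s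
        using mult_pos_pos[OF that Ra] by (auto simp: complex_nonpos_Reals_iff)
      define k where "k = (\<lambda>s. h (1 - of_real s * a) - \<mu> / of_real \<alpha> * (of_real s * a) powr of_real (- \<alpha>))"
      define k' where "k' = (\<lambda>s. - a * (of_real s * a) powr of_real (- \<alpha> - 1) * (g (1 - of_real s * a) - \<mu>))"
      have kd: "(k has_vector_derivative k' s) (at s)" if s: "0 < s" "s \<le> r1" for s
      proof -
        have d1: "(h has_field_derivative deriv h (1 - of_real s * a)) (at (1 - of_real s * a))"
          by (rule holomorphic_derivI[OF h open_ball disk[OF a s]])
        have l1: "((\<lambda>s. 1 - of_real s * a) has_vector_derivative - a) (at s)"
          by (auto intro!: derivative_eq_intros)
        have d2: "((\<lambda>w. w powr of_real (- \<alpha>)) has_field_derivative of_real (- \<alpha>) * (of_real s * a) powr (of_real (- \<alpha>) - 1)) (at (of_real s * a))"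
          using slit[OF s(1)] by (intro has_field_derivative_powr)
        have l2: "((\<lambda>s. of_real s * a) has_vector_derivative a) (at s)"
          by (auto intro!: derivative_eq_intros)
        have "(k has_vector_derivative - a * deriv h (1 - of_real s * a)
            - \<mu> / of_real \<alpha> * (a * (of_real (- \<alpha>) * (of_real s * a) powr (of_real (- \<alpha>) - 1)))) (at s)"
          unfolding k_def using field_vector_diff_chain_at[OF l1 d1] field_vector_diff_chain_at[OF l2 d2]
          by (intro has_vector_derivative_diff has_vector_derivative_mult_right) (simp_all add: o_def)
        also have "- a * deriv h (1 - of_real s * a) - \<mu> / of_real \<alpha> * (a * (of_real (- \<alpha>) * (of_real s * a) powr (of_real (- \<alpha>) - 1))) = k' s"
        proof -
          have sa: "of_real s * a \<noteq> 0" using s a0 by simp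
          have "(of_real s * a) powr of_real (- \<alpha> - 1) * g (1 - of_real s * a)
              = ((of_real s * a) powr of_real (- \<alpha> - 1) * (of_real s * a) powr of_real (1 + \<alpha>)) * deriv h (1 - of_real s * a)"
            by (simp add: g_def)
          also have "(of_real s * a) powr of_real (- \<alpha> - 1) * (of_real s * a) powr of_real (1 + \<alpha>) = 1"
            using sa by (simp add: powr_def flip: exp_add) (simp add: algebra_simps)
          finally have "(of_real s * a) powr of_real (- \<alpha> - 1) * g (1 - of_real s * a) = deriv h (1 - of_real s * a)" by simp
          then have "k' s = - a * deriv h (1 - of_real s * a) + a * \<mu> * (of_real s * a) powr of_real (- \<alpha> - 1)"
            by (simp add: k'_def algebra_simps)
          then show ?thesis using \<alpha> by simp
        qed
        finally show ?thesis .
      qed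
      have nk: "cmod (k' s) \<le> \<epsilon> * s powr (- \<alpha> - 1)" if s: "0 < s" "s < r1" for s
      proof -
        have "cmod (1 - (1 - of_real s * a)) = s" using s a1 by (simp add: norm_mult)
        moreover have "s \<le> M * Re (1 - (1 - of_real s * a))"
        proof -
          have "1 / M \<le> Re a" using a by (simp add: A_def)
          then have "1 \<le> M * Re a" using M by (simp add: divide_le_eq mult.commute)
          then have "s * 1 \<le> s * (M * Re a)" using s by (intro mult_left_mono) auto
          then show ?thesis by (simp add: mult_ac)
        qed
        ultimately have "cmod (g (1 - of_real s * a) - \<mu>) < \<epsilon>"
          using disk[OF a s(1)] s r1 a0 by (intro r0(2)) auto
        moreover have "cmod ((of_real s * a) powr of_real (- \<alpha> - 1)) = s powr (- \<alpha> - 1)"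
          using s a0 a1 by (subst norm_powr_of_real) (auto simp: norm_mult)
        ultimately show ?thesis unfolding k'_def norm_mult using a1 s
          by (simp add: mult.commute mult_left_mono)
      qed
      have "cmod (k r1 - k t) \<le> - (\<epsilon> / \<alpha>) * r1 powr (- \<alpha>) - (- (\<epsilon> / \<alpha>) * t powr (- \<alpha>))"
      proof (rule differentiable_bound_general[OF t(2)])
        show "continuous_on {t..r1} k"
          by (rule continuous_at_imp_continuous_on) (use t in \<open>auto intro!: has_vector_derivative_continuous[OF kd]\<close>)
        show "continuous_on {t..r1} (\<lambda>s. - (\<epsilon> / \<alpha>) * s powr (- \<alpha>))"
          using t by (intro continuous_intros) auto
        show "(k has_vector_derivative k' s) (at s)" if "t < s" "s < r1" for s using kd[of s] that t by simp
        show "((\<lambda>s. - (\<epsilon> / \<alpha>) * s powr (- \<alpha>)) has_vector_derivative \<epsilon> * s powr (- \<alpha> - 1)) (at s)"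
          if "t < s" "s < r1" for s
        proof -
          have "((\<lambda>s. s powr (- \<alpha>)) has_real_derivative - \<alpha> * s powr (- \<alpha> - 1)) (at s)"
            using that t by (intro has_real_derivative_powr) auto
          from DERIV_cmult[OF this, of "- (\<epsilon> / \<alpha>)"] show ?thesis
            using \<alpha> by (simp add: has_real_derivative_iff_has_vector_derivative)
        qed
        show "cmod (k' s) \<le> \<epsilon> * s powr (- \<alpha> - 1)" if "t < s" "s < r1" for s using nk[of s] that t by simp
      qed
      also have "\<dots> \<le> \<epsilon> / \<alpha> * t powr (- \<alpha>)" using \<epsilon> \<alpha> by simp
      finally have "cmod (k t) \<le> cmod (k r1) + \<epsilon> / \<alpha> * t powr (- \<alpha>)"
        using norm_triangle_ineq2[of "k t" "k r1"] by (simp add: norm_minus_commute)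
      moreover have "cmod (k r1) \<le> C'"
      proof -
        have "cmod ((of_real r1 * a) powr of_real (- \<alpha>)) = r1 powr (- \<alpha>)"
          using r1 a0 a1 by (subst norm_powr_of_real) (auto simp: norm_mult)
        then have "cmod (\<mu> / of_real \<alpha> * (of_real r1 * a) powr of_real (- \<alpha>)) = cmod \<mu> / \<alpha> * r1 powr (- \<alpha>)"
          using \<alpha> by (simp add: norm_mult norm_divide)
        then show ?thesis
          using norm_triangle_ineq4[of "h (1 - of_real r1 * a)" "\<mu> / of_real \<alpha> * (of_real r1 * a) powr of_real (- \<alpha>)"] C[OF a]
          unfolding k_def C'_def by linarith
      qed
      ultimately have kt: "cmod (k t) \<le> C' + \<epsilon> / \<alpha> * t powr (- \<alpha>)" by linarith
      have ta: "of_real t * a \<noteq> 0" using t a0 by simp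
      have "(of_real t * a) powr of_real \<alpha> * (of_real t * a) powr of_real (- \<alpha>) = 1"
        using ta by (simp add: powr_def flip: exp_add)
      then have "(of_real t * a) powr of_real \<alpha> * h (1 - of_real t * a) - \<mu> / of_real \<alpha> = (of_real t * a) powr of_real \<alpha> * k t"
        by (simp add: k_def algebra_simps)
      moreover have np: "cmod ((of_real t * a) powr of_real \<alpha>) = t powr \<alpha>"
        using ta t a1 by (subst norm_powr_of_real) (auto simp: norm_mult)
      ultimately have "cmod ((of_real t * a) powr of_real \<alpha> * h (1 - of_real t * a) - \<mu> / of_real \<alpha>) = t powr \<alpha> * cmod (k t)"
        using np by (simp only: norm_mult)
      also have "\<dots> \<le> t powr \<alpha> * (C' + \<epsilon> / \<alpha> * t powr (- \<alpha>))" using kt by (intro mult_left_mono) auto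
      also have "\<dots> = C' * t powr \<alpha> + \<epsilon> / \<alpha>"
      proof -
        have "t powr \<alpha> * t powr (- \<alpha>) = 1" using t by (simp flip: powr_add)
        then have "\<epsilon> / \<alpha> * (t powr \<alpha> * t powr (- \<alpha>)) = \<epsilon> / \<alpha>" by simp
        then show ?thesis by (simp only: distrib_left mult_ac)
      qed
      finally show ?thesis .
    qed
    have "((\<lambda>t. C' * t powr \<alpha> + \<epsilon> / \<alpha>) \<longlongrightarrow> C' * 0 + \<epsilon> / \<alpha>) (at_right 0)"
    proof (intro tendsto_intros)
      show "((\<lambda>t. t powr \<alpha>) \<longlongrightarrow> 0) (at_right (0::real))"
      proof -
        have "\<forall>\<^sub>F t in at_right 0. 0 \<le> (t::real)"
          by (rule eventually_mono[OF eventually_at_right_less]) simp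
        then show ?thesis
          using tendsto_powr'[of "\<lambda>t. t" 0 "at_right (0::real)" "\<lambda>_. \<alpha>" \<alpha>] \<alpha> by simp
      qed
    qed
    then have "\<forall>\<^sub>F t in at_right 0. C' * t powr \<alpha> + \<epsilon> / \<alpha> < e"
      by (rule order_tendstoD(2)) (use e \<alpha> in \<open>simp add: \<epsilon>_def\<close>)
    then obtain r2 where r2: "0 < r2" "\<And>t. 0 < t \<Longrightarrow> t < r2 \<Longrightarrow> C' * t powr \<alpha> + \<epsilon> / \<alpha> < e"
      unfolding eventually_at_right_field by blast
    show "\<forall>\<^sub>F z in at 1 within {z \<in> unit_disk. cmod (1 - z) \<le> M * Re (1 - z)}.
        dist ((1 - z) powr of_real \<alpha> * h z) (\<mu> / of_real \<alpha>) < e"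
      unfolding eventually_at
    proof (intro exI[of _ "min r1 r2"] conjI ballI impI)
      show "0 < min r1 r2" using r1 r2 by simp
      fix z assume z: "z \<in> {z \<in> unit_disk. cmod (1 - z) \<le> M * Re (1 - z)}" "z \<noteq> 1 \<and> dist z 1 < min r1 r2"
      define t where "t = cmod (1 - z)"
      define a where "a = (1 - z) / of_real t"
      have t: "0 < t" "t < r1" "t < r2" using z by (auto simp: t_def dist_norm norm_minus_commute)
      have za: "of_real t * a = 1 - z" using t by (simp add: a_def)
      have "t \<le> M * Re (1 - z)" using z by (simp add: t_def)
      then have "1 / M \<le> Re a" using t M by (simp add: a_def Re_divide_of_real field_simps)
      moreover have "cmod a = 1" using t by (simp add: a_def t_def norm_divide)
      ultimately have "a \<in> A" by (simp add: A_def)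
      from main[OF this t(1,2)] r2(2)[OF t(1,3)] show "dist ((1 - z) powr of_real \<alpha> * h z) (\<mu> / of_real \<alpha>) < e"
        by (simp add: za dist_norm)
    qed
  qed
  then show "((\<lambda>z. (1 - z) powr of_real \<alpha> * h z) \<longlongrightarrow> \<mu> / of_real \<alpha>)
      (at 1 within {z \<in> unit_disk. cmod (1 - z) \<le> M0 * Re (1 - z)})"
  proof (rule tendsto_within_subset)
    show "{z \<in> unit_disk. cmod (1 - z) \<le> M0 * Re (1 - z)} \<subseteq> {z \<in> unit_disk. cmod (1 - z) \<le> M * Re (1 - z)}"
    proof
      fix z assume z: "z \<in> {z \<in> unit_disk. cmod (1 - z) \<le> M0 * Re (1 - z)}"
      have "M0 * Re (1 - z) \<le> M * Re (1 - z)"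
        using Re_one_minus_pos[of z] z by (intro mult_right_mono) (auto simp: M_def)
      then show "z \<in> {z \<in> unit_disk. cmod (1 - z) \<le> M * Re (1 - z)}" using z by auto
    qed
  qed
qed

subsection \<open>The semigroup model at the corner\<close>

context dini_corner
begin

lemma f_powr_asymptotics:
  assumes "0 < x" shows "f (of_real x) = exp (\<Phi> (of_real x) + \<i> * of_real \<kappa>) * of_real (x powr \<gamma>)"
proof -
  have "exp (of_real \<gamma> * Ln (of_real x)) = complex_of_real (x powr \<gamma>)"
    using assms by (simp add: Ln_of_real powr_def exp_of_real[symmetric])
  then show ?thesis using exp_\<Phi>[of "of_real x"] assms by (simp add: exp_add mult_ac)
qed

lemma f_has_derivative:
  assumes x: "0 < x"
  shows "of_real x * deriv f (of_real x) = f (of_real x) * (of_real \<gamma> + of_real x * deriv \<Phi> (of_real x))"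
proof -
  have op: "open {w. 0 < Re w}" by (rule open_halfspace_Re_gt)
  have D\<Phi>: "(\<Phi> has_field_derivative deriv \<Phi> (of_real x)) (at (of_real x))"
    using holomorphic_derivI[OF \<Phi>_holomorphic op] x by simp
  have nx: "complex_of_real x \<notin> \<real>\<^sub>\<le>\<^sub>0" using x by simp
  have "((\<lambda>w. exp (\<Phi> w) * exp (of_real \<gamma> * Ln w) * exp (\<i> * of_real \<kappa>)) has_field_derivative
      exp (\<Phi> (of_real x)) * exp (of_real \<gamma> * Ln (of_real x)) * exp (\<i> * of_real \<kappa>)
        * (deriv \<Phi> (of_real x) + of_real \<gamma> / of_real x)) (at (of_real x))"
    using nx x by (auto intro!: derivative_eq_intros D\<Phi> simp: algebra_simps divide_inverse)
  then have "(f has_field_derivative f (of_real x) * (deriv \<Phi> (of_real x) + of_real \<gamma> / of_real x)) (at (of_real x))"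
    using has_field_derivative_transform_within_open[OF _ op, of _ _ "of_real x" f] exp_\<Phi> x by simp
  then have "deriv f (of_real x) = f (of_real x) * (deriv \<Phi> (of_real x) + of_real \<gamma> / of_real x)"
    by (rule DERIV_imp_deriv)
  then show ?thesis using x by (simp add: algebra_simps)
qed

end

lemma deriv_cayley: "0 < Re w \<Longrightarrow> (cayley has_field_derivative - 2 / (1 + w)\<^sup>2) (at w)"
  unfolding cayley_def using one_plus_nonzero[of w]
  by (auto intro!: derivative_eq_intros simp: power2_eq_square field_simps)

text \<open>On the curve \<open>1 - f x\<close> the model derivative and the expansion of
  \<open>f\<close> give \<open>q = x powr (\<gamma> - 1) * A x\<close> with \<open>A\<close> tending
  to a nonzero limit, so the logarithm in question converges there. The curve is tangent to the ray
  of direction \<open>cis \<kappa>\<close>; its limit passes to the ray and then, by Lindeloef's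
  theorem, to every sector.\<close>

lemma corner_model_limit:
  assumes h: "h \<in> Sigma1" and corner: "dini_corner f \<gamma> \<kappa> \<rho> d" and \<kappa>: "\<bar>\<kappa>\<bar> < pi / 2"
    and \<alpha>: "\<alpha> = 1 / \<gamma>"
    and \<phi>: "\<phi> holomorphic_on unit_disk" "\<phi> ` unit_disk \<subseteq> unit_disk"
    and f: "\<And>w. 0 < Re w \<Longrightarrow> f w = 1 - \<phi> (cayley w)"
    and c: "c \<noteq> 0" "\<And>z. z \<in> unit_disk \<Longrightarrow> deriv h (\<phi> z) * deriv \<phi> z = c / (1 - z)\<^sup>2"
  obtains l where "sector_limit (\<lambda>z. Ln ((1 - z)\<^sup>2 * deriv h z) + of_real (\<alpha> - 1) * Ln (1 - z)) l"
proof -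
  interpret dini_corner f \<gamma> \<kappa> \<rho> d by (rule corner)
  obtain l where l: "((\<lambda>x. \<Phi> (of_real x)) \<longlongrightarrow> of_real l) (at_right 0)"
    "((\<lambda>x. of_real x * deriv \<Phi> (of_real x)) \<longlongrightarrow> 0) (at_right (0::real))"
    by (rule radial_limit)
  define q where "q = (\<lambda>z. (1 - z)\<^sup>2 * deriv h z)"
  define \<Lambda> where "\<Lambda> = (\<lambda>z. Ln (q z) + of_real (\<alpha> - 1) * Ln (1 - z))"
  have op: "open {w::complex. 0 < Re w}" by (rule open_halfspace_Re_gt)
  have q: "0 \<le> Re (q z)" "q z \<noteq> 0" if "z \<in> unit_disk" for z
    using Sigma1_Berkson_Porta[OF h that] Sigma1_deriv_nonzero[OF h that] that by (auto simp: q_def)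
  have slit: "w \<notin> \<real>\<^sub>\<le>\<^sub>0" if "0 \<le> Re w" "w \<noteq> 0" for w :: complex
    using that by (auto simp: complex_nonpos_Reals_iff complex_eq_iff)
  have qhol: "q holomorphic_on unit_disk" unfolding q_def
    by (intro holomorphic_intros holomorphic_deriv Sigma1D(1)[OF h]) auto
  have \<Lambda>hol: "\<Lambda> holomorphic_on unit_disk" unfolding \<Lambda>_def
    by (intro holomorphic_intros qhol slit q less_imp_le[OF Re_one_minus_pos]) auto
  define B where "B = pi / 2 + \<bar>\<alpha> - 1\<bar> * (pi / 2)"
  have B: "0 < B" unfolding B_def by (intro add_pos_nonneg) auto
  have \<Lambda>B: "\<bar>Im (\<Lambda> z)\<bar> \<le> B" if z: "z \<in> unit_disk" for z
  proof -
    have "\<bar>Im (Ln (q z))\<bar> \<le> pi / 2" using q[OF z] Re_Ln_pos_le by blast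
    moreover have "\<bar>Im (Ln (1 - z))\<bar> \<le> pi / 2"
      using Re_Ln_pos_lt_imp[OF Re_one_minus_pos[OF z]] by simp
    then have "\<bar>(\<alpha> - 1) * Im (Ln (1 - z))\<bar> \<le> \<bar>\<alpha> - 1\<bar> * (pi / 2)"
      unfolding abs_mult by (intro mult_left_mono) auto
    ultimately show ?thesis by (simp add: \<Lambda>_def B_def del: Im_Ln_eq_0)
  qed
  have in_disk: "1 - f (of_real x) \<in> unit_disk" if "0 < x" for x
    using \<phi>(2) cayley_in_disk[of "of_real x"] that f[of "of_real x"] by (auto simp: image_subset_iff)
  \<comment> \<open>Since \<open>1 - cayley w = 2 * w / (1 + w)\<close>, the factors 1 + w cancel in
    the chain rule.\<close>
  have hf: "deriv h (1 - f (of_real x)) * deriv f (of_real x) = c / (2 * of_real x ^ 2)" if x: "0 < x" for x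
  proof -
    define w where "w = complex_of_real x"
    have w: "0 < Re w" using x by (simp add: w_def)
    note cd = cayley_in_disk[OF w]
    have D\<phi>: "(\<phi> has_field_derivative deriv \<phi> (cayley w)) (at (cayley w))"
      by (rule holomorphic_derivI[OF \<phi>(1) open_ball cd])
    have "((\<lambda>w. 1 - \<phi> (cayley w)) has_field_derivative 0 - deriv \<phi> (cayley w) * (- 2 / (1 + w)\<^sup>2)) (at w)"
      by (intro derivative_intros DERIV_chain2[OF D\<phi> deriv_cayley[OF w]])
    then have "(f has_field_derivative 0 - deriv \<phi> (cayley w) * (- 2 / (1 + w)\<^sup>2)) (at w)"
      using has_field_derivative_transform_within_open[OF _ op, of _ _ w f] f w by simp
    then have "deriv f w = deriv \<phi> (cayley w) * (2 / (1 + w)\<^sup>2)" using DERIV_imp_deriv by fastforce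
    then have "deriv h (1 - f w) * deriv f w = deriv h (\<phi> (cayley w)) * deriv \<phi> (cayley w) * (2 / (1 + w)\<^sup>2)"
      using f[OF w] by simp
    also have "\<dots> = c / (1 - cayley w)\<^sup>2 * (2 / (1 + w)\<^sup>2)" by (simp only: c(2)[OF cd])
    also have "1 - cayley w = 2 * w / (1 + w)"
      using one_plus_nonzero[of w] w by (simp add: cayley_def field_simps)
    also have "c / (2 * w / (1 + w))\<^sup>2 * (2 / (1 + w)\<^sup>2) = c / (2 * w\<^sup>2)"
      using one_plus_nonzero[of w] w by (simp add: power_divide power_mult_distrib)
    finally show ?thesis by (simp add: w_def)
  qed
  define A where "A = (\<lambda>x. c / 2 * exp (\<Phi> (of_real x) + \<i> * of_real \<kappa>) / (of_real \<gamma> + of_real x * deriv \<Phi> (of_real x)))"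
  define A0 where "A0 = c / 2 * exp (of_real l + \<i> * of_real \<kappa>) / (of_real \<gamma> + 0)"
  have A0: "A0 \<noteq> 0" using c \<gamma> by (simp add: A0_def)
  have Alim: "(A \<longlongrightarrow> A0) (at_right 0)"
    unfolding A_def A0_def by (intro tendsto_intros l) (use \<gamma> in auto)
  have qA: "q (1 - f (of_real x)) = of_real (x powr (\<gamma> - 1)) * A x" if x: "0 < x" for x
  proof -
    define fx E e where "fx = f (of_real x)" and "E = exp (\<Phi> (of_real x) + \<i> * of_real \<kappa>)"
      and "e = of_real \<gamma> + of_real x * deriv \<Phi> (of_real x)"
    have fE: "fx = E * of_real (x powr \<gamma>)" using f_powr_asymptotics[OF x] by (simp add: fx_def E_def)
    have fx0: "fx \<noteq> 0" unfolding fE E_def using x by simp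
    have d: "of_real x * deriv f (of_real x) = fx * e" using f_has_derivative[OF x] by (simp add: fx_def e_def)
    \<comment> \<open>\<open>deriv f\<close> cannot vanish on the radius, because its product with
      \<open>deriv h\<close> is a nonzero multiple of 1 / x^2.\<close>
    have e0: "e \<noteq> 0"
    proof
      assume "e = 0"
      then have "deriv f (of_real x) = 0" using d x by simp
      then show False using hf[OF x] c(1) x by simp
    qed
    have "deriv h (1 - fx) * (fx * e) = deriv h (1 - fx) * (of_real x * deriv f (of_real x))"
      by (simp only: d)
    also have "\<dots> = of_real x * (deriv h (1 - fx) * deriv f (of_real x))"
      by (rule mult.left_commute)
    also have "\<dots> = of_real x * (c / (2 * of_real x ^ 2))" by (simp only: fx_def hf[OF x])
    finally have "deriv h (1 - fx) * (fx * e) = of_real x * (c / (2 * of_real x ^ 2))" .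
    then have "deriv h (1 - fx) * (fx * e) = c / (2 * of_real x)"
      using x by (simp add: power2_eq_square)
    moreover have "fx * e \<noteq> 0" using fx0 e0 by simp
    ultimately have "deriv h (1 - fx) = c / (2 * of_real x) / (fx * e)"
      by (rule nonzero_eq_divide_eq[THEN iffD2, rotated])
    then have "q (1 - fx) = c / 2 * fx / (of_real x * e)" using fx0 by (simp add: q_def power2_eq_square)
    also have "\<dots> = of_real (x powr \<gamma> / x) * (c / 2 * E / e)" by (simp add: fE mult_ac)
    also have "x powr \<gamma> / x = x powr (\<gamma> - 1)" using x by (simp add: powr_diff)
    finally show ?thesis by (simp add: fx_def A_def E_def e_def)
  qed
  have ev: "\<forall>\<^sub>F x in at_right 0. 0 < (x::real)" by (rule eventually_at_right_less)
  have ReA: "0 \<le> Re (A x)" "A x \<noteq> 0" if x: "0 < x" for x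
  proof -
    have "Re (q (1 - f (of_real x))) = x powr (\<gamma> - 1) * Re (A x)" using qA[OF x] by simp
    then show "0 \<le> Re (A x)" using q(1)[OF in_disk[OF x]] x by (simp add: zero_le_mult_iff)
    show "A x \<noteq> 0" using q(2)[OF in_disk[OF x]] qA[OF x] by auto
  qed
  \<comment> \<open>Together with \<open>A0 \<noteq> 0\<close> this keeps the limit off the branch
    cut of \<open>Ln\<close>.\<close>
  have ReA0: "0 \<le> Re A0"
  proof (rule tendsto_lowerbound)
    show "((\<lambda>x. Re (A x)) \<longlongrightarrow> Re A0) (at_right 0)" by (intro tendsto_intros Alim)
    show "\<forall>\<^sub>F x in at_right 0. 0 \<le> Re (A x)" using ev by eventually_elim (rule ReA)
  qed simp
  have Lf: "Ln (f (of_real x)) = \<Phi> (of_real x) + of_real (\<gamma> * ln x) + \<i> * of_real \<kappa>" if "0 < x" for x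
    using that by (simp add: \<Phi>_def Ln_of_real)
  define \<nu> where "\<nu> = Ln A0 + of_real (\<alpha> - 1) * (of_real l + \<i> * of_real \<kappa>)"
  have curve: "((\<lambda>x. \<Lambda> (1 - f (of_real x))) \<longlongrightarrow> \<nu>) (at_right 0)"
  proof (rule Lim_transform_eventually)
    show "((\<lambda>x. Ln (A x) + of_real (\<alpha> - 1) * (\<Phi> (of_real x) + \<i> * of_real \<kappa>)) \<longlongrightarrow> \<nu>) (at_right 0)"
      unfolding \<nu>_def by (intro tendsto_intros l Alim slit[OF ReA0 A0])
    show "\<forall>\<^sub>F x in at_right 0. Ln (A x) + of_real (\<alpha> - 1) * (\<Phi> (of_real x) + \<i> * of_real \<kappa>) = \<Lambda> (1 - f (of_real x))"
      using ev
    proof eventually_elim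
      case (elim x)
      have p: "0 < x powr (\<gamma> - 1)" using elim by simp
      have "Ln (q (1 - f (of_real x))) = of_real (ln (x powr (\<gamma> - 1))) + Ln (A x)"
        unfolding qA[OF elim] using Ln_times_of_real[OF p ReA(2)[OF elim]] Ln_of_real[OF p] by simp
      also have "ln (x powr (\<gamma> - 1)) = (\<gamma> - 1) * ln x" using elim by (simp add: ln_powr)
      finally have "\<Lambda> (1 - f (of_real x)) = Ln (A x) + of_real (\<alpha> - 1) * (\<Phi> (of_real x) + \<i> * of_real \<kappa>)
          + of_real ((\<gamma> - 1) * ln x + (\<alpha> - 1) * (\<gamma> * ln x))"
        using Lf[OF elim] by (simp add: \<Lambda>_def algebra_simps)
      \<comment> \<open>The divergent multiples of ln x cancel exactly because \<alpha> \<gamma> =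
        1.\<close>
      also have "(\<gamma> - 1) * ln x + (\<alpha> - 1) * (\<gamma> * ln x) = 0"
        using \<alpha> \<gamma> by (simp add: field_simps)
      finally show ?case by simp
    qed
  qed
  \<comment> \<open>Solves \<open>exp l * x powr \<gamma> = t\<close> for x, so that
    \<open>f (X t)\<close> is asymptotic to \<open>t * cis \<kappa>\<close>.\<close>
  define X where "X = (\<lambda>t. (t * exp (- l)) powr \<alpha>)"
  have Xpos: "0 < X t" if "0 < t" for t using that by (simp add: X_def)
  have \<alpha>0: "0 < \<alpha>" using \<alpha> \<gamma> by simp
  have X0: "filterlim X (at_right 0) (at_right 0)"
    unfolding filterlim_at
  proof
    show "\<forall>\<^sub>F t in at_right 0. X t \<in> {0<..} \<and> X t \<noteq> 0" using ev by eventually_elim (use Xpos in force)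
    have "((\<lambda>t. t * exp (- l)) \<longlongrightarrow> 0 * exp (- l)) (at_right 0)" by (intro tendsto_intros)
    moreover have "\<forall>\<^sub>F t in at_right 0. 0 \<le> t * exp (- l)" using ev by eventually_elim simp
    ultimately show "(X \<longlongrightarrow> 0) (at_right 0)" unfolding X_def
      using tendsto_powr'[of "\<lambda>t. t * exp (- l)" 0 "at_right 0" "\<lambda>_. \<alpha>" \<alpha>] \<alpha>0 by simp
  qed
  define p where "p = (\<lambda>t. exp (\<Phi> (of_real (X t)) - of_real l))"
  have fX: "f (of_real (X t)) = of_real t * (cis \<kappa> * p t)" if t: "0 < t" for t
  proof -
    have "X t powr \<gamma> = t * exp (- l)" using t \<alpha> \<gamma> by (simp add: X_def powr_powr)
    then have "f (of_real (X t)) = exp (\<Phi> (of_real (X t)) + \<i> * of_real \<kappa>) * (of_real t * exp (- of_real l))"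
      using f_powr_asymptotics[OF Xpos[OF t]] by (simp add: exp_of_real[symmetric])
    also have "\<dots> = of_real t * (cis \<kappa> * p t)"
      by (simp add: p_def cis_conv_exp exp_add exp_diff exp_minus divide_inverse mult_ac)
    finally show ?thesis .
  qed
  have pl: "(p \<longlongrightarrow> 1) (at_right 0)"
  proof -
    have "(p \<longlongrightarrow> exp (of_real l - of_real l)) (at_right 0)"
      unfolding p_def by (intro tendsto_intros filterlim_compose[OF l(1) X0])
    then show ?thesis by simp
  qed
  have a: "0 < Re (cis \<kappa>)" "cmod (cis \<kappa>) = 1" using \<kappa> cos_gt_zero_pi[of \<kappa>] by auto
  have "((\<lambda>t. \<Lambda> (1 - of_real t * (cis \<kappa> * p t))) \<longlongrightarrow> \<nu>) (at_right 0)"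
  proof (rule Lim_transform_eventually)
    show "((\<lambda>t. \<Lambda> (1 - f (of_real (X t)))) \<longlongrightarrow> \<nu>) (at_right 0)"
      by (rule filterlim_compose[OF curve X0])
    show "\<forall>\<^sub>F t in at_right 0. \<Lambda> (1 - f (of_real (X t))) = \<Lambda> (1 - of_real t * (cis \<kappa> * p t))"
      using ev by eventually_elim (simp add: fX)
  qed
  from limit_along_ray_of_perturbed[where p=p and a="cis \<kappa>", OF \<Lambda>hol B \<Lambda>B a(1) pl this]
  have "((\<lambda>t. \<Lambda> (1 - of_real t * cis \<kappa>)) \<longlongrightarrow> \<nu>) (at_right 0)" .
  from ray_limit_imp_sector_limit[where a="cis \<kappa>", OF \<Lambda>hol B \<Lambda>B a this]
  have "sector_limit \<Lambda> \<nu>" .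
  then show thesis by (intro that[of \<nu>]) (simp add: \<Lambda>_def q_def)
qed

theorem theorem39:
  fixes h \<phi> :: "complex \<Rightarrow> complex" and z\<^sub>0 :: complex and \<Omega> :: "complex set" and \<gamma> \<alpha> :: real
  assumes "h \<in> Sigma1"
    and "z\<^sub>0 \<in> unit_disk" and "extends_to_line h z\<^sub>0"
    and "((\<lambda>t. flow h t z\<^sub>0) \<longlongrightarrow> 1) at_bot"
    and "p_type h \<Omega>"
    and "riemann_map \<phi> \<Omega>" and "parabolic_group (conj_flow h \<phi>) 1"
    and "dini_smooth_corner \<phi> 1 \<gamma>"
    and "\<alpha> = 1 / \<gamma>"
  shows "h \<in> Sigma1_A \<alpha> \<and>
    (\<exists>\<mu>. has_angular_limit (\<lambda>z. (1 - z) powr (of_real (1 + \<alpha>)) * deriv h z) \<mu> \<and> \<mu> \<noteq> 0 \<and>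
         \<bar>Arg \<mu>\<bar> \<le> pi * (2 * \<gamma> - 1) / (2 * \<gamma>)) \<and>
    1 / 2 \<le> \<gamma> \<and> \<gamma> \<le> 1 \<and> pi / 2 \<le> pi * \<gamma> \<and>
    has_angular_limit (\<lambda>z. h z / ((1 - z) * deriv h z)) (of_real \<gamma>)"
proof -
  note h = assms(1) and \<alpha> = assms(9)
  note hol = Sigma1D(1)[OF h]
  have bfi: "backward_flow_invariant h \<Omega>" using assms(5) by (simp add: p_type_def)
  obtain c where c: "c \<noteq> 0" "\<And>z. z \<in> unit_disk \<Longrightarrow> deriv h (\<phi> z) * deriv \<phi> z = c / (1 - z)\<^sup>2"
    by (rule parabolic_group_model_derivative[OF h bfi assms(6,7)]) (rule that; assumption)
  have \<phi>: "\<phi> holomorphic_on unit_disk" "\<phi> ` unit_disk \<subseteq> unit_disk"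
    using assms(6) bfi by (simp_all add: riemann_map_def backward_flow_invariant_def bij_betw_def)
  obtain f \<kappa> \<rho> d where corner: "dini_corner f \<gamma> \<kappa> \<rho> d"
    and f: "\<And>w. 0 < Re w \<Longrightarrow> f w = 1 - \<phi> (cayley w)" and \<gamma>1: "\<gamma> \<le> 1" and \<kappa>: "\<bar>\<kappa>\<bar> < pi / 2"
    by (rule dini_smooth_corner_half_plane[OF \<phi> assms(8)]) (rule that; assumption)
  have \<gamma>: "0 < \<gamma>" by (rule dini_corner.\<gamma>[OF corner])
  have \<alpha>1: "1 \<le> \<alpha>" and \<alpha>\<gamma>: "\<alpha> * \<gamma> = 1" using \<alpha> \<gamma> \<gamma>1 by simp_all
  define q where "q = (\<lambda>z. (1 - z)\<^sup>2 * deriv h z)"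
  define \<Lambda> where "\<Lambda> = (\<lambda>z. Ln (q z) + of_real (\<alpha> - 1) * Ln (1 - z))"
  obtain l where l: "sector_limit \<Lambda> l"
    using corner_model_limit[OF h corner \<kappa> \<alpha> \<phi> f c] unfolding \<Lambda>_def q_def by metis
  have q: "0 \<le> Re (q z) \<and> q z \<noteq> 0" if "z \<in> unit_disk" for z
    using Sigma1_Berkson_Porta[OF h that] Sigma1_deriv_nonzero[OF h that] that by (auto simp: q_def)
  \<comment> \<open>Since the first summand is nonnegative, this bounds \<alpha> by 2; and it bounds
    \<open>Im l\<close>, the argument of the limit.\<close>
  have bound: "\<bar>Im l\<bar> + (\<alpha> - 1) * (pi / 2) \<le> pi / 2"
    by (rule sector_limit_arg_bound[OF q]) (use \<alpha>1 l in \<open>auto simp: \<Lambda>_def\<close>)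
  define \<mu> where "\<mu> = exp l"
  define g where "g = (\<lambda>z. (1 - z) powr of_real (1 + \<alpha>) * deriv h z)"
  have g\<Lambda>: "exp (\<Lambda> z) = g z" if z: "z \<in> unit_disk" for z
  proof -
    have z1: "1 - z \<noteq> 0" using z by auto
    have "exp (\<Lambda> z) = q z * exp (of_real (\<alpha> - 1) * Ln (1 - z))"
      using q[OF z] by (simp add: \<Lambda>_def exp_add)
    also have "q z = exp (2 * Ln (1 - z)) * deriv h z"
      using z1 by (simp add: q_def exp_double)
    also have "exp (2 * Ln (1 - z)) * deriv h z * exp (of_real (\<alpha> - 1) * Ln (1 - z))
        = exp (2 * Ln (1 - z) + of_real (\<alpha> - 1) * Ln (1 - z)) * deriv h z"
      by (simp add: exp_add)
    also have "2 * Ln (1 - z) + of_real (\<alpha> - 1) * Ln (1 - z) = of_real (1 + \<alpha>) * Ln (1 - z)"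
      by (simp add: algebra_simps)
    also have "exp (of_real (1 + \<alpha>) * Ln (1 - z)) = (1 - z) powr of_real (1 + \<alpha>)"
      using z1 by (simp only: powr_def) simp
    finally show ?thesis by (simp add: g_def)
  qed
  have gl: "sector_limit g \<mu>"
    unfolding sector_limit_def
  proof
    fix M :: real
    have "((\<lambda>z. exp (\<Lambda> z)) \<longlongrightarrow> \<mu>) (at 1 within {z \<in> unit_disk. cmod (1 - z) \<le> M * Re (1 - z)})"
      unfolding \<mu>_def using l by (intro tendsto_intros) (simp add: sector_limit_def)
    then show "(g \<longlongrightarrow> \<mu>) (at 1 within {z \<in> unit_disk. cmod (1 - z) \<le> M * Re (1 - z)})"
      by (rule Lim_transform_eventually) (auto simp: eventually_at_filter g\<Lambda> intro!: always_eventually)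
  qed
  have \<mu>0: "\<mu> \<noteq> 0" by (simp add: \<mu>_def)
  have \<alpha>2: "\<alpha> \<le> 2"
  proof -
    have "(\<alpha> - 1) * (pi / 2) \<le> 1 * (pi / 2)"
      using bound abs_ge_zero[of "Im l"] by linarith
    then show ?thesis by (simp only: mult_le_cancel_right_pos[OF pi_half_gt_zero])
  qed
  have \<gamma>2: "1 / 2 \<le> \<gamma>" using \<alpha>2 \<alpha> \<gamma> by (simp add: field_simps)
  have Iml: "\<bar>Im l\<bar> \<le> pi / 2" 
  proof -
    have "0 \<le> (\<alpha> - 1) * (pi / 2)" using \<alpha>1 by simp
    then show ?thesis using bound by linarith
  qed
  have Arg: "\<bar>Arg \<mu>\<bar> \<le> pi * (2 * \<gamma> - 1) / (2 * \<gamma>)"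
  proof -
    \<comment> \<open>This range makes \<open>l\<close> the principal logarithm of \<mu>, so that
      \<open>Arg \<mu>\<close> is \<open>Im l\<close> and not merely congruent to it modulo 2
      pi.\<close>
    have "- pi < Im l" "Im l \<le> pi" using Iml pi_gt_zero by linarith+
    then have "Ln \<mu> = l" unfolding \<mu>_def by (rule Ln_exp)
    then have "Arg \<mu> = Im l" using \<mu>0 by (simp add: Arg_eq_Im_Ln)
    moreover have "pi / 2 - (\<alpha> - 1) * (pi / 2) = pi * (2 * \<gamma> - 1) / (2 * \<gamma>)"
      using \<alpha> \<gamma> by (simp add: field_simps)
    ultimately show ?thesis using bound by linarith
  qed
  have quot: "sector_limit (\<lambda>z. h z / ((1 - z) * deriv h z)) (of_real \<gamma>)"
    unfolding sector_limit_def
  proof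
    fix M :: real
    let ?F = "at 1 within {z \<in> unit_disk. cmod (1 - z) \<le> M * Re (1 - z)}"
    \<comment> \<open>Integration gives the asymptotics of \<open>h\<close>; dividing by those of
      its derivative cancels \<mu> and leaves 1 / \<alpha> = \<gamma>.\<close>
    have "sector_limit (\<lambda>z. (1 - z) powr of_real \<alpha> * h z) (\<mu> / of_real \<alpha>)"
      by (rule sector_limit_integrate[OF hol]) (use \<alpha>1 gl in \<open>auto simp: g_def\<close>)
    then have "((\<lambda>z. ((1 - z) powr of_real \<alpha> * h z) / g z) \<longlongrightarrow> (\<mu> / of_real \<alpha>) / \<mu>) ?F"
      using gl \<mu>0 by (intro tendsto_divide) (auto simp: sector_limit_def)
    moreover have "(\<mu> / of_real \<alpha>) / \<mu> = of_real \<gamma>" using \<mu>0 \<alpha> by simp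
    moreover have "\<forall>\<^sub>F z in ?F. ((1 - z) powr of_real \<alpha> * h z) / g z = h z / ((1 - z) * deriv h z)"
    proof -
      have "((1 - z) powr of_real \<alpha> * h z) / g z = h z / ((1 - z) * deriv h z)" if "z \<in> unit_disk" for z
      proof -
        have z1: "1 - z \<noteq> 0" using that by auto
        have "(1 - z) powr of_real (1 + \<alpha>) = (1 - z) * (1 - z) powr of_real \<alpha>"
          using z1 by (simp add: powr_add)
        then show ?thesis using z1 by (simp add: g_def)
      qed
      then show ?thesis by (auto simp: eventually_at_filter intro!: always_eventually)
    qed
    ultimately show "((\<lambda>z. h z / ((1 - z) * deriv h z)) \<longlongrightarrow> of_real \<gamma>) ?F"
      by (simp add: Lim_transform_eventually)
  qed
  have ang: "has_angular_limit (\<lambda>z. (1 - z) powr (of_real (1 + \<alpha>)) * deriv h z) \<mu>"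
    using sector_limit_imp_angular[OF gl] by (simp only: g_def)
  moreover have "h \<in> Sigma1_A \<alpha>"
    unfolding Sigma1_A_def using h \<alpha>1 \<mu>0 ang by (intro CollectI conjI exI[of _ \<mu>]) simp_all
  moreover have "pi / 2 \<le> pi * \<gamma>" using mult_left_mono[OF \<gamma>2 pi_ge_zero] by simp
  ultimately show ?thesis
    using \<mu>0 Arg \<gamma>1 \<gamma>2 sector_limit_imp_angular[OF quot] by (intro conjI exI[of _ \<mu>])
qed

end
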